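(* Let $(X,\tau)$ be an uncountable Polish space and let $1<\xi<\omega_1$. For every ordinal $\lambda < \omega_1$ we have $\Phi_\lambda = \mathscr{B}_\xi^{\lambda+1}$, where $\Phi_0 = \mathscr{B}_\xi^1$ and, for $0<\lambda<\omega_1$, $\Phi_\lambda = \Phi\left(\bigcup_{\eta<\lambda}\Phi_\eta\right)$.
   Context: For a Polish topology $\tau'$ on $X$, $\boldsymbol{\Sigma}^0_\xi(\tau')$, $\boldsymbol{\Pi}^0_\xi(\tau')$ denote the additive and multiplicative Borel classes of $(X,\tau')$ ($\boldsymbol{\Sigma}^0_1$ = open sets, $\boldsymbol{\Pi}^0_1$ = closed sets), and $\mathcal{B}_\xi(\tau')$ the set of real-valued Baire class $\xi$ functions on $(X,\tau')$; when $\tau'$ is omitted, $\tau$ is meant. Baire class 1 functions are the pointwise limits of sequences of continuous functions, and for $1<\xi<\omega_1$ Baire class $\xi$ functions are the pointwise limits of sequences of functions from smaller classes; equivalently, $f\in\mathcal{B}_\xi$ iff $\{f<c\},\{f>c\}\in\boldsymbol{\Sigma}^0_{\xi+1}$ for all $c\in\mathbb{R}$. An ordinal is even if it has the form $\mu + n$ with $\mu$ limit or $0$ and $n$ an even natural number. The classes $\mathscr{B}_\xi^\lambda$. Consider a decreasing sequence $(F_\eta)_{\eta<\mu}$ ($\mu<\omega_1$) of $\boldsymbol{\Pi}^0_\xi(\tau)$ subsets of $X$ that is continuous (for every limit ordinal $\theta<\mu$, $F_\theta = \bigcap_{\eta<\theta}F_\eta$), with $F_0 = X$, and with $\bigcap_{\eta<\mu}F_\eta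 = \emptyset$ if $\mu$ is limit. Put $F_\eta=\emptyset$ for $\eta \ge \mu$. Sets $A, B \subseteq X$ can be separated by the transfinite difference of this sequence if $$A \subseteq \bigcup_{\eta<\mu,\ \eta \text{ even}} F_\eta\setminus F_{\eta+1} \subseteq X \setminus B .$$ $\alpha_\xi(A,B)$ is the least length $\mu$ of such a sequence if one exists, and $\omega_1$ otherwise. For $f\in\mathcal{B}_\xi$, $\alpha_\xi(f) = \sup_{p<q,\ p,q\in\mathbb{Q}} \alpha_\xi(\{f\le p\},\{f\ge q\})$, and $\mathscr{B}_\xi^\lambda$ is the set of bounded $f \in \mathcal{B}_\xi$ with $\alpha_\xi(f)\le\omega^\lambda$. Pseudouniform convergence with respect to a Polish topology $\tau'$ on $X$. For a sequence $(f_n)_{n\in\mathbb{N}}$ of real-valued functions on $X$, a $\tau'$-closed set $F\subseteq X$ and $x\in X$ let $$\omega((f_n)_{n},x,F) = \inf_{U \ni x,\ U\in\tau'}\ \inf_{N\in\mathbb{N}}\ \sup\{|f_m(y)-f_n(y)| : n,m\ge N,\ y\in U\cap F\}.$$ For $\varepsilon>0$ let $D_{(f_n)_n,\varepsilon}(F) = \{x\in F : \omega((f_n)_n,x,F)\ge\varepsilon\}$ (a $\tau'$-closed set). For such an operation $D$ put $D^0(F)=F$, $D^{\theta+1}(F)=D(D^\theta(F))$, $D^\theta(F)=\bigcap_{\eta<\theta}D^\eta(F)$ for limit $\theta$; its rank $\operatorname{rk}(D)$ is the least $\theta$ with $D^\theta(X)=\emptyset$ if such $\theta$ exists, and $\omega_1$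 otherwise. Let $\gamma_{\tau'}((f_n)_{n\in\mathbb{N}}) = \sup_{\varepsilon>0}\operatorname{rk}(D_{(f_n)_n,\varepsilon})$. We say $f_n\to f$ pseudouniformly with respect to $\tau'$ if $f_n\to f$ pointwise and $\gamma_{\tau'}((f_n)_{n\in\mathbb{N}})\le\omega$. The operation $\Phi$. For a class $\mathcal{F}$ of bounded Baire class $\xi$ functions on $(X,\tau)$, $\Phi(\mathcal{F})$ is the set of bounded $f\in\mathcal{B}_\xi(\tau)$ for which there exist a sequence $(f_n)_{n\in\mathbb{N}}$ of elements of $\mathcal{F}$ and a Polish topology $\tau'\supseteq\tau$ on $X$ such that $\tau'\subseteq\boldsymbol{\Sigma}^0_\xi(\tau)$, $f\in\mathcal{B}_1(\tau')$ and $f_n\in\mathcal{B}_1(\tau')$ for all $n$, and $f_n\to f$ pseudouniformly with respect to $\tau'$. *)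

theory Defs
  imports "HOL-Analysis.Analysis" "HOL-Library.Countable_Set_Type"
begin

section \<open>Ordinals\<close>

text \<open>
  The elements of \<open>ordinal\<close> are the ordinals below \<open>\<omega>\<^sub>2\<close>, so that \<open>\<omega>\<^sub>1\<close> is itself an element,
  and suprema of families of ordinals \<open>\<le> \<omega>\<^sub>1\<close> exist.
\<close>

lemma Card_order_ordinal: "Card_order (cardSuc (cardSuc natLeq))"
  by (intro cardSuc_Card_order natLeq_Card_order)

lemma infinite_ordinal: "infinite (Field (cardSuc (cardSuc natLeq)))"
  using cardSuc_finite[OF cardSuc_Card_order[OF natLeq_Card_order]]
    cardSuc_finite[OF natLeq_Card_order] by (simp add: Field_natLeq)

typedef ordinal = "Field (cardSuc (cardSuc natLeq))"
  using infinite_imp_nonempty[OF infinite_ordinal] by blast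

instantiation ordinal :: linorder
begin

definition less_eq_ordinal :: "ordinal \<Rightarrow> ordinal \<Rightarrow> bool" where
  "\<alpha> \<le> \<beta> \<longleftrightarrow> (Rep_ordinal \<alpha>, Rep_ordinal \<beta>) \<in> cardSuc (cardSuc natLeq)"

definition less_ordinal :: "ordinal \<Rightarrow> ordinal \<Rightarrow> bool" where
  "(\<alpha> :: ordinal) < \<beta> \<longleftrightarrow> \<alpha> \<le> \<beta> \<and> \<alpha> \<noteq> \<beta>"

lemma Well_order_ordinal: "Well_order (cardSuc (cardSuc natLeq))"
  by (intro cardSuc_Well_order cardSuc_Card_order natLeq_Card_order)

instance
proof
  note wo = Well_order_ordinal[unfolded well_order_on_def linear_order_on_def
      partial_order_on_def preorder_on_def]
  fix x y z :: ordinal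
  show antisym: "x \<le> y \<Longrightarrow> y \<le> x \<Longrightarrow> x = y"
    using wo unfolding less_eq_ordinal_def antisym_def by (metis Rep_ordinal_inject)
  show refl: "x \<le> x"
    using wo Rep_ordinal by (auto simp: less_eq_ordinal_def refl_on_def)
  show "x < y \<longleftrightarrow> x \<le> y \<and> \<not> y \<le> x"
    using antisym refl by (auto simp: less_ordinal_def)
  show "x \<le> y \<Longrightarrow> y \<le> z \<Longrightarrow> x \<le> z"
    using wo by (auto simp: less_eq_ordinal_def trans_def)
  show "x \<le> y \<or> y \<le> x"
  proof (cases "x = y")
    case True
    then show ?thesis using wo Rep_ordinal by (auto simp: less_eq_ordinal_def refl_on_def)
  next
    case False
    then show ?thesis
      using wo Rep_ordinal[of x] Rep_ordinal[of y]
      by (auto simp: less_eq_ordinal_def total_on_def Rep_ordinal_inject)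
  qed
qed

end

instance ordinal :: wellorder
proof
  fix P :: "ordinal \<Rightarrow> bool" and \<alpha> :: ordinal
  assume step: "\<And>x. (\<And>y. y < x \<Longrightarrow> P y) \<Longrightarrow> P x"
  have "{(x, y). x < y} \<subseteq> inv_image (cardSuc (cardSuc natLeq) - Id) Rep_ordinal"
    by (auto simp: less_ordinal_def less_eq_ordinal_def Rep_ordinal_inject)
  moreover have "wf (cardSuc (cardSuc natLeq) - Id)"
    using Well_order_ordinal unfolding well_order_on_def by blast
  ultimately have "wf {(x::ordinal, y). x < y}"
    by (blast intro: wf_subset wf_inv_image)
  then show "P \<alpha>"
    by (induction rule: wf_induct_rule) (use step in auto)
qed

instance ordinal :: no_top
proof
  fix \<alpha> :: ordinal
  have "\<exists>b \<in> Field (cardSuc (cardSuc natLeq)).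
      Rep_ordinal \<alpha> \<noteq> b \<and> (Rep_ordinal \<alpha>, b) \<in> cardSuc (cardSuc natLeq)"
    by (rule infinite_Card_order_limit[OF Card_order_ordinal infinite_ordinal Rep_ordinal])
  then show "\<exists>\<beta>. \<alpha> < \<beta>"
    by (metis Abs_ordinal_inverse less_eq_ordinal_def less_ordinal_def)
qed

instantiation ordinal :: conditionally_complete_linorder
begin

definition inf_ordinal :: "ordinal \<Rightarrow> ordinal \<Rightarrow> ordinal" where "inf_ordinal = min"
definition sup_ordinal :: "ordinal \<Rightarrow> ordinal \<Rightarrow> ordinal" where "sup_ordinal = max"
definition Inf_ordinal :: "ordinal set \<Rightarrow> ordinal" where "Inf (S :: ordinal set) = (LEAST \<alpha>. \<alpha> \<in> S)"
definition Sup_ordinal :: "ordinal set \<Rightarrow> ordinal" where "Sup (S :: ordinal set) = (LEAST \<beta>. \<forall>\<alpha>\<in>S. \<alpha> \<le> \<beta>)"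

instance
proof
  fix x z :: ordinal and S :: "ordinal set"
  show "x \<in> S \<Longrightarrow> bdd_below S \<Longrightarrow> Inf S \<le> x"
    by (simp add: Inf_ordinal_def Least_le)
  show "S \<noteq> {} \<Longrightarrow> (\<And>x. x \<in> S \<Longrightarrow> z \<le> x) \<Longrightarrow> z \<le> Inf S"
    unfolding Inf_ordinal_def by (metis LeastI_ex ex_in_conv)
  show "x \<in> S \<Longrightarrow> bdd_above S \<Longrightarrow> x \<le> Sup S"
    unfolding Sup_ordinal_def bdd_above_def
    by (rule bspec[of S "\<lambda>\<alpha>. \<alpha> \<le> (LEAST \<beta>. \<forall>\<alpha>\<in>S. \<alpha> \<le> \<beta>)"], rule LeastI_ex)
  show "S \<noteq> {} \<Longrightarrow> (\<And>x. x \<in> S \<Longrightarrow> x \<le> z) \<Longrightarrow> Sup S \<le> z"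
    unfolding Sup_ordinal_def by (simp add: Least_le)
qed (auto simp: inf_ordinal_def sup_ordinal_def)

end

definition succ :: "ordinal \<Rightarrow> ordinal" where
  "succ \<alpha> = (LEAST \<beta>. \<alpha> < \<beta>)"

instantiation ordinal :: "{zero, one}"
begin

definition zero_ordinal :: ordinal where "(0 :: ordinal) = (LEAST \<alpha>. True)"
definition one_ordinal :: ordinal where "(1 :: ordinal) = succ 0"

instance ..

end

definition limit :: "ordinal \<Rightarrow> bool" where
  "limit \<theta> \<longleftrightarrow> \<theta> \<noteq> 0 \<and> (\<forall>\<eta><\<theta>. succ \<eta> < \<theta>)"

definition even_ordinal :: "ordinal \<Rightarrow> bool" where
  "even_ordinal \<eta> \<longleftrightarrow> (\<exists>\<mu> n. (limit \<mu> \<or> \<mu> = 0) \<and> even n \<and> \<eta> = (succ ^^ n) \<mu>)"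

text \<open>The predecessor of a successor ordinal.\<close>

definition opred :: "ordinal \<Rightarrow> ordinal" where
  "opred \<alpha> = (THE \<beta>. succ \<beta> = \<alpha>)"

lemma less_succ: "\<alpha> < succ \<alpha>"
  unfolding succ_def by (rule LeastI_ex) (rule gt_ex)

lemma succ_le_iff: "succ \<alpha> \<le> \<beta> \<longleftrightarrow> \<alpha> < \<beta>"
  using less_succ[of \<alpha>] by (auto simp: succ_def intro: Least_le)

lemma succ_inject: "succ \<alpha> = succ \<beta> \<longleftrightarrow> \<alpha> = \<beta>"
  by (metis less_succ not_less succ_le_iff order.antisym)

lemma opred_succ [simp]: "opred (succ \<alpha>) = \<alpha>"
  by (simp add: opred_def succ_inject)

lemma zero_le_ordinal [simp]: "0 \<le> (\<alpha> :: ordinal)"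
  by (simp add: zero_ordinal_def Least_le)

lemma successor_ordinal:
  assumes "\<theta> \<noteq> 0" "\<not> limit \<theta>"
  shows "succ (opred \<theta>) = \<theta>"
proof -
  obtain \<eta> where "\<eta> < \<theta>" "\<not> succ \<eta> < \<theta>"
    using assms by (auto simp: limit_def)
  then have "succ \<eta> = \<theta>"
    using succ_le_iff[of \<eta> \<theta>] by simp
  then show ?thesis by auto
qed

lemma opred_less: "\<theta> \<noteq> 0 \<Longrightarrow> \<not> limit \<theta> \<Longrightarrow> opred \<theta> < \<theta>"
  using less_succ[of "opred \<theta>"] successor_ordinal[of \<theta>] by simp

definition omega :: ordinal where
  "omega = (LEAST \<alpha>. limit \<alpha>)"

definition omega1 :: ordinal where
  "omega1 = (LEAST \<alpha>. uncountable {..<\<alpha>})"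

context
  includes cardinal_syntax
begin

lemma ex_uncountable_lessThan: "\<exists>\<alpha>::ordinal. uncountable {..<\<alpha>}"
proof -
  let ?r = "cardSuc (cardSuc natLeq)" let ?s = "cardSuc natLeq"
  have s: "Card_order ?s" by (intro cardSuc_Card_order natLeq_Card_order)
  have "?s <o ?r" by (rule cardSuc_greater[OF s])
  then obtain a where a: "a \<in> Field ?r" "?s =o Restr ?r (underS ?r a)"
    using ordLess_iff_ordIso_Restr[OF Well_order_ordinal cardSuc_Well_order[OF natLeq_Card_order]]
    by auto
  obtain \<alpha> where al: "Rep_ordinal \<alpha> = a" using a(1) by (metis Abs_ordinal_inverse)
  have im: "underS ?r a \<subseteq> Rep_ordinal ` {..<\<alpha>}"
  proof
    fix b assume b: "b \<in> underS ?r a"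
    then have "b \<in> Field ?r" by (auto simp: underS_def Field_def)
    then obtain \<beta> where be: "Rep_ordinal \<beta> = b" by (metis Abs_ordinal_inverse)
    have "\<beta> < \<alpha>" using b unfolding less_ordinal_def less_eq_ordinal_def be al
      by (auto simp: underS_def be al simp flip: Rep_ordinal_inject)
    then show "b \<in> Rep_ordinal ` {..<\<alpha>}" using be by auto
  qed
  have "uncountable (underS ?r a)"
  proof
    assume c: "countable (underS ?r a)"
    have "Field (Restr ?r (underS ?r a)) \<subseteq> underS ?r a" by (auto simp: Field_def)
    then have c2: "countable (Field (Restr ?r (underS ?r a)))" using c countable_subset by blast
    have "|Field ?s| =o |Field (Restr ?r (underS ?r a))|" 
      using a(2) by (metis card_of_cong)
    then have "countable (Field ?s)"
      using c2 unfolding card_of_ordIso[symmetric] by (meson countableI_bij2 bij_betw_inv card_of_ordIso)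
    then have "|Field ?s| \<le>o natLeq" by (simp add: countable_card_le_natLeq)
    then have "?s \<le>o natLeq" using card_of_Field_ordIso[OF s] 
      by (meson ordIso_symmetric ordIso_ordLeq_trans)
    then show False using cardSuc_greater[OF natLeq_Card_order] not_ordLess_ordLeq by blast
  qed
  then have "uncountable (Rep_ordinal ` {..<\<alpha>})" using im countable_subset by blast
  then show ?thesis using countable_image by blast
qed

end

lemma uncountable_lessThan_omega1: "uncountable {..<omega1}"
  unfolding omega1_def by (rule LeastI_ex) (rule ex_uncountable_lessThan)

lemma countable_lessThan: "\<alpha> < omega1 \<Longrightarrow> countable {..<\<alpha>}"
  unfolding omega1_def using not_less_Least by blast

text \<open>
  Ordinal arithmetic by recursion on the right argument. The cases zero, successor and limit are
  merged into one supremum. The formula for powers is the usual one for bases \<open>\<alpha> \<ge> 1\<close>.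
\<close>

context
  notes [fundef_cong] = image_cong
begin

function oadd :: "ordinal \<Rightarrow> ordinal \<Rightarrow> ordinal" where
  "oadd \<alpha> \<beta> = Sup (insert \<alpha> ((\<lambda>\<gamma>. succ (oadd \<alpha> \<gamma>)) ` {..<\<beta>}))"
  by auto
termination
  by (relation "inv_image {(x, y). x < y} snd") (auto simp: wf)

declare oadd.simps [simp del]

function omult :: "ordinal \<Rightarrow> ordinal \<Rightarrow> ordinal" where
  "omult \<alpha> \<beta> = Sup ((\<lambda>\<gamma>. oadd (omult \<alpha> \<gamma>) \<alpha>) ` {..<\<beta>})"
  by auto
termination
  by (relation "inv_image {(x, y). x < y} snd") (auto simp: wf)

declare omult.simps [simp del]

function opower :: "ordinal \<Rightarrow> ordinal \<Rightarrow> ordinal" where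
  "opower \<alpha> \<beta> = Sup (insert 1 ((\<lambda>\<gamma>. omult (opower \<alpha> \<gamma>) \<alpha>) ` {..<\<beta>}))"
  by auto
termination
  by (relation "inv_image {(x, y). x < y} snd") (auto simp: wf)

declare opower.simps [simp del]

end


section \<open>Borel classes and Baire classes\<close>

definition polish :: "'a topology \<Rightarrow> bool" where
  "polish \<tau> \<longleftrightarrow> completely_metrizable_space \<tau> \<and> separable_space \<tau>"

text \<open>Both hierarchies start at index 1; the classes with index 0 are empty.\<close>

inductive Sigma0 :: "'a topology \<Rightarrow> ordinal \<Rightarrow> 'a set \<Rightarrow> bool" for \<tau> where
  "openin \<tau> U \<Longrightarrow> Sigma0 \<tau> 1 U"
| "1 < \<xi> \<Longrightarrow>
   \<forall>n::nat. A n \<subseteq> topspace \<tau> \<and> (\<exists>\<eta><\<xi>. Sigma0 \<tau> \<eta> (topspace \<tau> - A n)) \<Longrightarrow>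
   Sigma0 \<tau> \<xi> (\<Union>n. A n)"

definition Pi0 :: "'a topology \<Rightarrow> ordinal \<Rightarrow> 'a set \<Rightarrow> bool" where
  "Pi0 \<tau> \<xi> A \<longleftrightarrow> A \<subseteq> topspace \<tau> \<and> Sigma0 \<tau> \<xi> (topspace \<tau> - A)"

text \<open>
  Functions on the space are total functions on the carrier type. All notions below depend only on
  their values on \<open>topspace \<tau>\<close>.
\<close>

inductive baire :: "'a topology \<Rightarrow> ordinal \<Rightarrow> ('a \<Rightarrow> real) \<Rightarrow> bool" for \<tau> where
  "\<forall>n::nat. continuous_map \<tau> euclideanreal (g n) \<Longrightarrow>
   \<forall>x\<in>topspace \<tau>. (\<lambda>n. g n x) \<longlonglongrightarrow> f x \<Longrightarrow>
   baire \<tau> 1 f"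
| "1 < \<xi> \<Longrightarrow>
   \<forall>n::nat. \<exists>\<eta><\<xi>. baire \<tau> \<eta> (g n) \<Longrightarrow>
   \<forall>x\<in>topspace \<tau>. (\<lambda>n. g n x) \<longlonglongrightarrow> f x \<Longrightarrow>
   baire \<tau> \<xi> f"


section \<open>Separation by transfinite differences\<close>

text \<open>
  A sequence \<open>(F\<^sub>\<eta>)\<close> of length \<open>\<mu>\<close> is a function on all ordinals that is empty from \<open>\<mu>\<close> on.
\<close>

definition separating_seq ::
  "'a topology \<Rightarrow> ordinal \<Rightarrow> ordinal \<Rightarrow> (ordinal \<Rightarrow> 'a set) \<Rightarrow> 'a set \<Rightarrow> 'a set \<Rightarrow> bool" where
  "separating_seq \<tau> \<xi> \<mu> F A B \<longleftrightarrow>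
     \<mu> < omega1 \<and>
     (\<forall>\<eta><\<mu>. Pi0 \<tau> \<xi> (F \<eta>)) \<and>
     (\<forall>\<eta> \<zeta>. \<eta> \<le> \<zeta> \<and> \<zeta> < \<mu> \<longrightarrow> F \<zeta> \<subseteq> F \<eta>) \<and>
     (\<forall>\<theta><\<mu>. limit \<theta> \<longrightarrow> F \<theta> = (\<Inter>\<eta>\<in>{..<\<theta>}. F \<eta>)) \<and>
     F 0 = topspace \<tau> \<and>
     (limit \<mu> \<longrightarrow> (\<Inter>\<eta>\<in>{..<\<mu>}. F \<eta>) = {}) \<and>
     (\<forall>\<eta>\<ge>\<mu>. F \<eta> = {}) \<and>
     A \<subseteq> (\<Union>\<eta>\<in>{\<eta>. \<eta> < \<mu> \<and> even_ordinal \<eta>}. F \<eta> - F (succ \<eta>)) \<and>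
     (\<Union>\<eta>\<in>{\<eta>. \<eta> < \<mu> \<and> even_ordinal \<eta>}. F \<eta> - F (succ \<eta>)) \<subseteq> topspace \<tau> - B"

definition sep_rank :: "'a topology \<Rightarrow> ordinal \<Rightarrow> 'a set \<Rightarrow> 'a set \<Rightarrow> ordinal" where
  "sep_rank \<tau> \<xi> A B =
     (if \<exists>\<mu> F. separating_seq \<tau> \<xi> \<mu> F A B
      then LEAST \<mu>. \<exists>F. separating_seq \<tau> \<xi> \<mu> F A B
      else omega1)"

definition fun_sep_rank :: "'a topology \<Rightarrow> ordinal \<Rightarrow> ('a \<Rightarrow> real) \<Rightarrow> ordinal" where
  "fun_sep_rank \<tau> \<xi> f =
     Sup {sep_rank \<tau> \<xi> {x \<in> topspace \<tau>. f x \<le> p} {x \<in> topspace \<tau>. q \<le> f x} |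
          p q. p \<in> \<rat> \<and> q \<in> \<rat> \<and> p < q}"

definition baire_rank_class :: "'a topology \<Rightarrow> ordinal \<Rightarrow> ordinal \<Rightarrow> ('a \<Rightarrow> real) set" where
  "baire_rank_class \<tau> \<xi> \<nu> =
     {f. bounded (f ` topspace \<tau>) \<and> baire \<tau> \<xi> f \<and> fun_sep_rank \<tau> \<xi> f \<le> opower omega \<nu>}"


section \<open>Pseudouniform convergence\<close>

definition seq_oscillation ::
  "'a topology \<Rightarrow> (nat \<Rightarrow> 'a \<Rightarrow> real) \<Rightarrow> 'a \<Rightarrow> 'a set \<Rightarrow> ennreal" where
  "seq_oscillation \<tau> fs x F =
     (INF U\<in>{U. openin \<tau> U \<and> x \<in> U}. INF N.
        Sup {ennreal \<bar>fs m y - fs n y\<bar> | m n y. N \<le> n \<and> N \<le> m \<and> y \<in> U \<inter> F})"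

definition seq_derivative ::
  "'a topology \<Rightarrow> (nat \<Rightarrow> 'a \<Rightarrow> real) \<Rightarrow> real \<Rightarrow> 'a set \<Rightarrow> 'a set" where
  "seq_derivative \<tau> fs \<epsilon> F = {x \<in> F. ennreal \<epsilon> \<le> seq_oscillation \<tau> fs x F}"

context
  notes [fundef_cong] = image_cong
begin

function iter_derivative :: "('a set \<Rightarrow> 'a set) \<Rightarrow> ordinal \<Rightarrow> 'a set \<Rightarrow> 'a set" where
  "iter_derivative D \<theta> F =
     (if \<theta> = 0 then F
      else if limit \<theta> then (\<Inter>\<eta>\<in>{..<\<theta>}. iter_derivative D \<eta> F)
      else D (iter_derivative D (opred \<theta>) F))"
  by auto
termination
proof (relation "inv_image {(x, y). x < y} (\<lambda>(D, \<theta>, F). \<theta>)")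
  show "wf (inv_image {(x, y). x < y} (\<lambda>(D :: 'a set \<Rightarrow> 'a set, \<theta> :: ordinal, F :: 'a set). \<theta>))"
    by (simp add: wf)
qed (auto simp: opred_less)

declare iter_derivative.simps [simp del]

end

definition derivative_rank :: "'a topology \<Rightarrow> ('a set \<Rightarrow> 'a set) \<Rightarrow> ordinal" where
  "derivative_rank \<tau> D =
     (if \<exists>\<theta>. iter_derivative D \<theta> (topspace \<tau>) = {}
      then LEAST \<theta>. iter_derivative D \<theta> (topspace \<tau>) = {}
      else omega1)"

definition convergence_rank :: "'a topology \<Rightarrow> (nat \<Rightarrow> 'a \<Rightarrow> real) \<Rightarrow> ordinal" where
  "convergence_rank \<tau> fs = (SUP \<epsilon>\<in>{0<..}. derivative_rank \<tau> (seq_derivative \<tau> fs \<epsilon>))"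

definition pseudouniform_limit ::
  "'a topology \<Rightarrow> (nat \<Rightarrow> 'a \<Rightarrow> real) \<Rightarrow> ('a \<Rightarrow> real) \<Rightarrow> bool" where
  "pseudouniform_limit \<tau> fs f \<longleftrightarrow>
     (\<forall>x\<in>topspace \<tau>. (\<lambda>n. fs n x) \<longlonglongrightarrow> f x) \<and> convergence_rank \<tau> fs \<le> omega"


section \<open>The operation \<open>\<Phi>\<close>\<close>

definition Phi :: "'a topology \<Rightarrow> ordinal \<Rightarrow> ('a \<Rightarrow> real) set \<Rightarrow> ('a \<Rightarrow> real) set" where
  "Phi \<tau> \<xi> \<F> =
     {f. bounded (f ` topspace \<tau>) \<and> baire \<tau> \<xi> f \<and>
       (\<exists>fs \<tau>'. (\<forall>n::nat. fs n \<in> \<F>) \<and>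
          polish \<tau>' \<and> topspace \<tau>' = topspace \<tau> \<and>
          (\<forall>U. openin \<tau> U \<longrightarrow> openin \<tau>' U) \<and>
          (\<forall>U. openin \<tau>' U \<longrightarrow> Sigma0 \<tau> \<xi> U) \<and>
          baire \<tau>' 1 f \<and> (\<forall>n. baire \<tau>' 1 (fs n)) \<and>
          pseudouniform_limit \<tau>' fs f)}"

context
  notes [fundef_cong] = image_cong
begin

function Phi_iter :: "'a topology \<Rightarrow> ordinal \<Rightarrow> ordinal \<Rightarrow> ('a \<Rightarrow> real) set" where
  "Phi_iter \<tau> \<xi> \<nu> =
     (if \<nu> = 0 then baire_rank_class \<tau> \<xi> 1
      else Phi \<tau> \<xi> (\<Union>\<eta>\<in>{..<\<nu>}. Phi_iter \<tau> \<xi> \<eta>))"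
  by auto
termination
proof (relation "inv_image {(x, y). x < y} (\<lambda>(\<tau>, \<xi>, \<nu>). \<nu>)")
  show "wf (inv_image {(x, y). x < y} (\<lambda>(\<tau> :: 'a topology, \<xi> :: ordinal, \<nu> :: ordinal). \<nu>))"
    by (simp add: wf)
qed auto

declare Phi_iter.simps [simp del]

end

end

theory Submission
  imports Defs
begin

text \<open>
  A separating sequence is a rank function \<open>r\<close> with values below its length whose sets
  \<open>{\<eta> \<le> r}\<close> are \<open>\<Pi>\<^sup>0\<^sub>\<xi>\<close>, and that is even on \<open>A\<close> and odd on \<open>B\<close>. Countably many of these sets become
  closed in a finer Polish topology contained in \<open>\<Sigma>\<^sup>0\<^sub>\<xi>\<close>, so one can argue topologically.

  Let \<open>w = \<omega>\<^sup>\<nu>\<close> and let \<open>f\<close> be the pseudouniform limit of functions of rank at most \<open>w\<close>. Off the next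
  derivative, \<open>f\<close> is locally uniformly close to a single term of the sequence, so \<open>w\<close> alternating
  closures of \<open>{f \<le> p}\<close> and \<open>{f \<ge> q}\<close> pass from one derivative to the next. As there are \<open>\<omega>\<close>
  derivatives, \<open>f\<close> has rank at most \<open>w \<cdot> \<omega>\<close>.

  Conversely, let \<open>f\<close> have rank at most \<open>w \<cdot> \<omega>\<close>, and let \<open>r\<^sub>i\<close> be rank functions for an enumeration of
  the pairs \<open>p < q\<close>. The \<open>n\<close>-th approximation at \<open>x\<close> only uses those \<open>r\<^sub>i(x)\<close>, \<open>i \<le> n\<close>, that lie among the
  first \<open>\<rho>\<^sub>n\<close> elements of one of the first \<open>n\<close> blocks of length \<open>w\<close>, where \<open>\<rho>\<^sub>n\<close> is cofinal in \<open>w\<close>.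
  Collapsing the remaining ordinals and taking the Hessenberg sum over \<open>i \<le> n\<close> bounds its rank by
  \<open>\<omega>\<^sup>\<gamma>\<^sup>+\<^sup>1\<close> with \<open>\<gamma> < \<nu>\<close>. Convergence is uniform near \<open>x\<close> on the closed set where the sum over \<open>i \<le> J\<close> of
  the block numbers of \<open>r\<^sub>i\<close> is at least its value at \<open>x\<close>, which makes it pseudouniform.
\<close>

subsection \<open>Ordinals\<close>

text \<open>Near a point a rank function can only drop in the refined topology, since the sets
  {\<eta> \<le> r} are closed. Rank functions that separate only on different open sets cannot be
  glued, so upper bounds go through one canonical object, the alternating closures, which every
  local rank function controls.

  The approximants need one ordinal that controls n+1 ranks at once. An ordinary sum can miss a
  change of a left summand (0 + \<omega> = 1 + \<omega>); the Hessenberg sum is strictly monotone in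
  each argument and still keeps ordinals below a power of \<omega> below that power. Collapsing is
  forced by the rank bound: the sum of the ranks themselves is only known to lie below
  \<omega>^(\<nu>+1), whereas members of the union have rank at most \<omega>^(\<gamma>+1) with
  \<gamma> < \<nu>.

  Block numbers are natural numbers, and so is their sum over i \<le> J; hence the bound of \<omega>
  derivatives. As \<omega>^\<nu> is the supremum of \<omega>^(\<gamma>+1) over \<gamma> < \<nu>
  whenever \<nu> \<noteq> 0, successor and limit \<nu> need no separate treatment.\<close>

lemma less_ordinal_Rep:
  "(\<alpha>::ordinal) < \<beta> \<longleftrightarrow> Rep_ordinal \<alpha> \<in> underS (cardSuc (cardSuc natLeq)) (Rep_ordinal \<beta>)"
  by (auto simp: underS_def less_ordinal_def less_eq_ordinal_def Rep_ordinal_inject)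

context
  includes cardinal_syntax
begin

text \<open>Suprema of \<open>\<omega>\<^sub>2\<close>-small families exist because \<open>\<omega>\<^sub>2\<close> is regular.\<close>

lemma bdd_above_image_lessThan: "bdd_above (f ` {..<\<beta>::ordinal} :: ordinal set)"
proof -
  let ?r = "cardSuc (cardSuc natLeq)"
  have Cinf: "Cinfinite natLeq" by (rule natLeq_Cinfinite)
  have reg: "regularCard ?r"
    by (intro regularCard_cardSuc Cinfinite_cardSuc Cinf)
  let ?K = "Rep_ordinal ` f ` {..<\<beta>}"
  have "Rep_ordinal ` {..<\<beta>} \<subseteq> underS ?r (Rep_ordinal \<beta>)"
    using less_ordinal_Rep by auto
  then have "|Rep_ordinal ` {..<\<beta>}| <o ?r"
    using card_of_underS[OF Card_order_ordinal Rep_ordinal[of \<beta>]] card_of_mono1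
      ordLeq_ordLess_trans by blast
  moreover have "|?K| \<le>o |Rep_ordinal ` {..<\<beta>}|"
  proof -
    have "?K = (\<lambda>x. Rep_ordinal (f (Abs_ordinal x))) ` Rep_ordinal ` {..<\<beta>}"
      by (simp add: image_image Rep_ordinal_inverse)
    then show ?thesis by (metis card_of_image)
  qed
  ultimately have "|?K| <o ?r" using ordLeq_ordLess_trans by blast
  then have "\<not> |?K| =o ?r" using not_ordLess_ordIso by blast
  moreover have "?K \<subseteq> Field ?r" using Rep_ordinal by auto
  ultimately have "\<not> cofinal ?K ?r" using reg unfolding regularCard_def by blast
  then have "\<exists>a \<in> Field ?r. \<forall>b \<in> ?K. a = b \<or> (a, b) \<notin> ?r"
    unfolding cofinal_def by simp
  then obtain a where a: "a \<in> Field ?r" "\<forall>b \<in> ?K. a = b \<or> (a, b) \<notin> ?r" ..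
  obtain \<alpha> where al: "Rep_ordinal \<alpha> = a" using a(1) by (metis Abs_ordinal_inverse)
  have "x \<le> \<alpha>" if "x \<in> f ` {..<\<beta>}" for x
  proof -
    have "\<alpha> = x \<or> \<not> \<alpha> \<le> x"
      using bspec[OF a(2) imageI[OF that]] al
      by (auto simp: less_eq_ordinal_def simp flip: Rep_ordinal_inject)
    then show ?thesis by auto
  qed
  then show ?thesis by (auto simp: bdd_above_def)
qed

end

lemma less_succ_iff [simp]: "\<alpha> < succ \<beta> \<longleftrightarrow> \<alpha> \<le> \<beta>"
  by (meson not_less succ_le_iff)

lemma succ_mono_iff [simp]: "succ \<alpha> \<le> succ \<beta> \<longleftrightarrow> \<alpha> \<le> \<beta>"
  by (simp add: succ_le_iff)

lemma succ_neq_0 [simp]: "succ \<alpha> \<noteq> 0"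
  by (metis less_succ not_less zero_le_ordinal)

lemma not_less_zero_ordinal [simp]: "\<not> \<alpha> < (0::ordinal)"
  by (simp add: not_less)

lemma zero_less_ordinal_iff: "(0::ordinal) < \<alpha> \<longleftrightarrow> \<alpha> \<noteq> 0"
  by (metis le_neq_trans less_irrefl zero_le_ordinal)

lemma not_limit_succ [simp]: "\<not> limit (succ \<alpha>)"
  by (metis limit_def less_irrefl less_succ)

lemma not_limit_0 [simp]: "\<not> limit 0"
  by (simp add: limit_def)

lemma limit_succ_less: "limit \<theta> \<Longrightarrow> \<eta> < \<theta> \<Longrightarrow> succ \<eta> < \<theta>"
  by (simp add: limit_def)

lemma limit_pos: "limit \<theta> \<Longrightarrow> 0 < \<theta>"
  by (simp add: limit_def zero_less_ordinal_iff)

lemma ordinal_cases [case_names zero succ limit]: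
  obtains "\<alpha> = 0" | \<beta> where "\<alpha> = succ \<beta>" | "limit \<alpha>"
  by (metis successor_ordinal)

lemma ordinal_induct [case_names zero succ limit]:
  assumes "P 0" "\<And>\<alpha>. P \<alpha> \<Longrightarrow> P (succ \<alpha>)"
    "\<And>\<theta>. limit \<theta> \<Longrightarrow> (\<And>\<eta>. \<eta> < \<theta> \<Longrightarrow> P \<eta>) \<Longrightarrow> P \<theta>"
  shows "P \<alpha>"
proof (induction \<alpha> rule: less_induct)
  case (less \<alpha>)
  show ?case
    by (cases \<alpha> rule: ordinal_cases) (use assms less less_succ in auto)
qed

lemma less_limit_iff: "limit \<theta> \<Longrightarrow> \<alpha> < \<theta> \<longleftrightarrow> (\<exists>\<beta><\<theta>. \<alpha> < \<beta>)"
  by (meson limit_succ_less less_succ order.strict_trans)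

lemma limit_le_if: "limit \<theta> \<Longrightarrow> (\<And>\<eta>. \<eta> < \<theta> \<Longrightarrow> \<eta> \<le> \<beta>) \<Longrightarrow> \<theta> \<le> \<beta>"
  by (meson less_limit_iff not_le)

lemma ordinal_decomp: "\<exists>\<mu> n. (limit \<mu> \<or> \<mu> = 0) \<and> \<eta> = (succ ^^ n) \<mu>"
proof (induction \<eta> rule: ordinal_induct)
  case (succ \<alpha>)
  then obtain \<mu> n where "limit \<mu> \<or> \<mu> = 0" "\<alpha> = (succ ^^ n) \<mu>" by blast
  then have "succ \<alpha> = (succ ^^ Suc n) \<mu>" by simp
  with \<open>limit \<mu> \<or> \<mu> = 0\<close> show ?case by blast
qed (metis funpow_0)+

text \<open>Parity is defined by an existential over decompositions; uniqueness of the finite part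
  is what makes even and odd exclusive.\<close>

lemma ordinal_decomp_unique:
  assumes "limit \<mu> \<or> \<mu> = 0" "limit \<mu>' \<or> \<mu>' = 0" "(succ ^^ n) \<mu> = (succ ^^ m) \<mu>'"
  shows "n = m"
  using assms(3)
proof (induction n arbitrary: m)
  case 0
  then show ?case using assms by (cases m) auto
next
  case (Suc n)
  then show ?case using assms by (cases m) (auto simp: succ_inject)
qed

lemma even_ordinal_zero [simp]: "even_ordinal 0"
  unfolding even_ordinal_def by (intro exI[of _ 0]) auto

lemma even_ordinal_limit: "limit \<mu> \<Longrightarrow> even_ordinal \<mu>"
  unfolding even_ordinal_def by (intro exI[of _ \<mu>] exI[of _ 0]) auto

lemma even_ordinal_funpow:
  assumes "limit \<mu> \<or> \<mu> = 0"
  shows "even_ordinal ((succ ^^ n) \<mu>) \<longleftrightarrow> even n"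
proof
  assume "even_ordinal ((succ ^^ n) \<mu>)"
  then obtain \<mu>' m where m: "limit \<mu>' \<or> \<mu>' = 0" "even m" "(succ ^^ n) \<mu> = (succ ^^ m) \<mu>'"
    unfolding even_ordinal_def by (elim exE conjE)
  then show "even n"
    using ordinal_decomp_unique[OF assms m(1,3)] by simp
next
  assume "even n"
  then show "even_ordinal ((succ ^^ n) \<mu>)"
    unfolding even_ordinal_def using assms by (intro exI[of _ \<mu>] exI[of _ n]) simp
qed

lemma even_ordinal_succ [simp]: "even_ordinal (succ \<eta>) \<longleftrightarrow> \<not> even_ordinal \<eta>"
proof -
  obtain \<mu> n where n: "limit \<mu> \<or> \<mu> = 0" "\<eta> = (succ ^^ n) \<mu>" using ordinal_decomp by blast
  then show ?thesis
    using even_ordinal_funpow[OF n(1), of n] even_ordinal_funpow[OF n(1), of "Suc n"] by simp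
qed

text \<open>Without a limit ordinal every ordinal would be a finite iterate of \<open>succ\<close>
  on 0, and \<open>omega1\<close> would have only countably many predecessors.\<close>

lemma omega_limit: "limit omega"
proof -
  have "\<exists>\<alpha>. limit \<alpha>"
  proof (rule ccontr)
    assume "\<nexists>\<alpha>. limit \<alpha>"
    then have "\<exists>n. \<alpha> = (succ ^^ n) 0" for \<alpha>
      using ordinal_decomp[of \<alpha>] by (elim exE conjE disjE) auto
    then have "{..<omega1} \<subseteq> range (\<lambda>n. (succ ^^ n) 0)"
      by (intro subsetI) (simp add: image_iff)
    then have "countable {..<omega1}" by (rule countable_subset) simp
    then show False using uncountable_lessThan_omega1 by simp
  qed
  then show ?thesis unfolding omega_def by (rule LeastI_ex)
qed

lemma less_omega_iff: "\<alpha> < omega \<longleftrightarrow> (\<exists>n. \<alpha> = (succ ^^ n) 0)"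
proof
  assume "\<alpha> < omega"
  obtain \<mu> n where n: "limit \<mu> \<or> \<mu> = 0" "\<alpha> = (succ ^^ n) \<mu>" using ordinal_decomp by blast
  have "\<mu> \<le> (succ ^^ n) \<mu>" for n
    by (induction n) (auto intro: order.trans less_imp_le less_succ)
  with n \<open>\<alpha> < omega\<close> have "\<mu> < omega" by (metis order.strict_trans1)
  then have "\<not> limit \<mu>" unfolding omega_def using not_less_Least by blast
  with n show "\<exists>n. \<alpha> = (succ ^^ n) 0" by blast
next
  assume "\<exists>n. \<alpha> = (succ ^^ n) 0"
  then obtain n where "\<alpha> = (succ ^^ n) 0" by blast
  moreover have "(succ ^^ n) 0 < omega"
    by (induction n) (auto simp: omega_limit limit_pos limit_succ_less)
  ultimately show "\<alpha> < omega" by simp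
qed

lemma less_omega1_iff: "\<alpha> < omega1 \<longleftrightarrow> countable {..<\<alpha>}"
  by (metis countable_lessThan countable_subset lessThan_subset_iff not_less
      uncountable_lessThan_omega1)

lemma limit_omega1: "limit omega1"
proof -
  have "succ \<eta> < omega1" if "\<eta> < omega1" for \<eta>
  proof -
    have "{..<succ \<eta>} = insert \<eta> {..<\<eta>}" by auto
    with that show ?thesis by (simp add: less_omega1_iff)
  qed
  moreover have "{..<0::ordinal} = {}" by auto
  then have "omega1 \<noteq> 0"
    using uncountable_lessThan_omega1 by (metis countable_empty)
  ultimately show ?thesis by (simp add: limit_def)
qed

lemma Sup_empty_ordinal: "Sup {} = (0::ordinal)"
  by (simp add: Sup_ordinal_def zero_ordinal_def)

text \<open>Regularity of \<open>omega1\<close>: the predecessors of the supremum form a countable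
  union of countable initial segments.\<close>

lemma Sup_less_omega1:
  fixes S :: "ordinal set"
  assumes "countable S" "\<And>s. s \<in> S \<Longrightarrow> s < omega1"
  shows "Sup S < omega1"
proof (cases "S = {}")
  case True
  then show ?thesis using limit_omega1 limit_pos by (simp add: Sup_empty_ordinal)
next
  case False
  have "bdd_above S" using assms by (meson bdd_aboveI less_imp_le)
  then have "{..<Sup S} \<subseteq> (\<Union>s\<in>S. {..<s})"
    using less_cSup_iff[OF False] by blast
  moreover have "countable (\<Union>s\<in>S. {..<s})"
    using assms by (auto simp: less_omega1_iff)
  ultimately show ?thesis using countable_subset by (auto simp: less_omega1_iff)
qed

subsection \<open>Ordinal arithmetic\<close>

lemma ordinal_leI: "(\<And>x. x < \<alpha> \<Longrightarrow> x < \<beta>) \<Longrightarrow> \<alpha> \<le> (\<beta>::ordinal)"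
  by (meson not_less less_irrefl)

text \<open>Arithmetic is developed by comparing predecessors instead of computing suprema;
  \<open>bdd_above_image_lessThan\<close> guarantees that the supremum in the recursion
  exists.\<close>

lemma less_oadd_iff: "x < oadd \<alpha> \<beta> \<longleftrightarrow> x < \<alpha> \<or> (\<exists>\<gamma><\<beta>. x \<le> oadd \<alpha> \<gamma>)"
  by (subst oadd.simps, subst less_cSup_iff) (auto simp: bdd_above_image_lessThan)

lemma oadd_0 [simp]: "oadd \<alpha> 0 = \<alpha>"
  by (metis less_oadd_iff linorder_cases less_irrefl not_less_zero_ordinal)

lemma oadd_strict_mono: "\<beta> < \<gamma> \<Longrightarrow> oadd \<alpha> \<beta> < oadd \<alpha> \<gamma>"
  using less_oadd_iff by blast

lemma oadd_mono: "\<beta> \<le> \<gamma> \<Longrightarrow> oadd \<alpha> \<beta> \<le> oadd \<alpha> \<gamma>"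
  by (metis le_less oadd_strict_mono)

lemma oadd_less_iff [simp]: "oadd \<alpha> \<beta> < oadd \<alpha> \<gamma> \<longleftrightarrow> \<beta> < \<gamma>"
  by (meson not_less oadd_mono oadd_strict_mono)

lemma oadd_le_iff [simp]: "oadd \<alpha> \<beta> \<le> oadd \<alpha> \<gamma> \<longleftrightarrow> \<beta> \<le> \<gamma>"
  by (meson not_less oadd_less_iff)

lemma le_oadd_left: "\<alpha> \<le> oadd \<alpha> \<beta>"
  by (metis oadd_0 oadd_mono zero_le_ordinal)

lemma le_oadd_right: "\<beta> \<le> oadd \<alpha> \<beta>"
proof (induction \<beta> rule: less_induct)
  case (less \<beta>)
  then show ?case
    by (metis less_irrefl not_le oadd_strict_mono)
qed

lemma oadd_succ [simp]: "oadd \<alpha> (succ \<beta>) = succ (oadd \<alpha> \<beta>)"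
proof (rule antisym)
  show "oadd \<alpha> (succ \<beta>) \<le> succ (oadd \<alpha> \<beta>)"
  proof (rule ordinal_leI)
    fix x assume "x < oadd \<alpha> (succ \<beta>)"
    then have "x < \<alpha> \<or> (\<exists>\<gamma>\<le>\<beta>. x \<le> oadd \<alpha> \<gamma>)" by (simp add: less_oadd_iff[of x])
    then have "x \<le> oadd \<alpha> \<beta>"
      using le_oadd_left[of \<alpha> \<beta>] oadd_mono[of _ \<beta> \<alpha>] by (meson less_imp_le order.trans)
    then show "x < succ (oadd \<alpha> \<beta>)" by simp
  qed
  show "succ (oadd \<alpha> \<beta>) \<le> oadd \<alpha> (succ \<beta>)"
    by (simp add: succ_le_iff)
qed

lemma less_oadd_limit: "limit \<beta> \<Longrightarrow> x < oadd \<alpha> \<beta> \<longleftrightarrow> (\<exists>\<gamma><\<beta>. x < oadd \<alpha> \<gamma>)"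
  unfolding less_oadd_iff[of x \<alpha> \<beta>]
proof
  assume "limit \<beta>" "x < \<alpha> \<or> (\<exists>\<gamma><\<beta>. x \<le> oadd \<alpha> \<gamma>)"
  then consider "x < \<alpha>" | \<gamma> where "\<gamma> < \<beta>" "x \<le> oadd \<alpha> \<gamma>" by blast
  then show "\<exists>\<gamma><\<beta>. x < oadd \<alpha> \<gamma>"
  proof cases
    case 1
    then show ?thesis using limit_pos[OF \<open>limit \<beta>\<close>] by (intro exI[of _ 0]) simp
  next
    case 2
    then show ?thesis
      using limit_succ_less[OF \<open>limit \<beta>\<close>] by (intro exI[of _ "succ \<gamma>"]) simp
  qed
qed (meson less_imp_le)

lemma limit_oadd:
  assumes "limit \<beta>"
  shows "limit (oadd \<alpha> \<beta>)"
  unfolding limit_def[of "oadd \<alpha> \<beta>"]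
proof (intro conjI allI impI)
  have "0 < oadd \<alpha> \<beta>"
    using limit_pos[OF assms] le_oadd_right[of \<beta> \<alpha>] by (rule order.strict_trans2)
  then show "oadd \<alpha> \<beta> \<noteq> 0" by simp
next
  fix \<eta> assume "\<eta> < oadd \<alpha> \<beta>"
  then obtain \<gamma> where "\<gamma> < \<beta>" "\<eta> < oadd \<alpha> \<gamma>"
    using less_oadd_limit[OF assms] by blast
  then show "succ \<eta> < oadd \<alpha> \<beta>"
    by (meson oadd_strict_mono order.strict_trans1 succ_le_iff)
qed

text \<open>Allows the alternation between two sets to be restarted at any even index without
  changing parities.\<close>

lemma even_ordinal_oadd: "even_ordinal \<theta> \<Longrightarrow> even_ordinal (oadd \<theta> \<eta>) \<longleftrightarrow> even_ordinal \<eta>"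
  by (induction \<eta> rule: ordinal_induct) (auto simp: even_ordinal_limit limit_oadd)

text \<open>Left subtraction: for the least \<beta> with x below \<alpha> + \<beta> there is
  \<gamma> < \<beta> with x \<le> \<alpha> + \<gamma>, and minimality of \<beta> excludes strict
  inequality.\<close>

lemma oadd_diff: "\<alpha> \<le> x \<Longrightarrow> \<exists>\<gamma>. x = oadd \<alpha> \<gamma>"
proof -
  assume "\<alpha> \<le> x"
  have ex: "\<exists>\<beta>. x < oadd \<alpha> \<beta>"
    by (metis le_oadd_right less_succ order.strict_trans2)
  define \<beta> where "\<beta> = (LEAST \<beta>. x < oadd \<alpha> \<beta>)"
  have "x < oadd \<alpha> \<beta>" unfolding \<beta>_def using ex by (rule LeastI_ex)
  with \<open>\<alpha> \<le> x\<close> obtain \<gamma> where "\<gamma> < \<beta>" "x \<le> oadd \<alpha> \<gamma>"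
    unfolding less_oadd_iff by (auto simp: not_le)
  moreover have "\<not> x < oadd \<alpha> \<gamma>"
    using \<open>\<gamma> < \<beta>\<close> not_less_Least unfolding \<beta>_def by blast
  ultimately show ?thesis by (metis order.order_iff_strict)
qed

lemma oadd_mono_left: "\<alpha> \<le> \<alpha>' \<Longrightarrow> oadd \<alpha> \<beta> \<le> oadd \<alpha>' \<beta>"
proof (induction \<beta> rule: less_induct)
  case (less \<beta>)
  have "x < oadd \<alpha>' \<beta>" if "x < oadd \<alpha> \<beta>" for x
    using that less unfolding less_oadd_iff[of x]
    by (meson order.strict_trans2 order.trans)
  then show ?case by (meson not_less less_irrefl)
qed

lemma oadd_less_omega1: "\<alpha> < omega1 \<Longrightarrow> \<beta> < omega1 \<Longrightarrow> oadd \<alpha> \<beta> < omega1"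
proof (induction \<beta> rule: less_induct)
  case (less \<beta>)
  then show ?case
    by (subst oadd.simps, intro Sup_less_omega1)
      (auto simp: countable_lessThan intro!: limit_succ_less limit_omega1)
qed

lemma less_omult_iff: "x < omult \<alpha> \<beta> \<longleftrightarrow> (\<exists>\<gamma><\<beta>. x < oadd (omult \<alpha> \<gamma>) \<alpha>)"
proof (cases "\<beta> = 0")
  case True
  then have "omult \<alpha> \<beta> = Sup {}"
    by (subst omult.simps) (simp add: lessThan_def)
  with True show ?thesis by (simp add: Sup_empty_ordinal)
next
  case False
  then have "{..<\<beta>} \<noteq> {}" using zero_less_ordinal_iff by auto
  then show ?thesis
    by (subst omult.simps, subst less_cSup_iff) (auto simp: bdd_above_image_lessThan)
qed

lemma omult_mono: "\<beta> \<le> \<gamma> \<Longrightarrow> omult \<alpha> \<beta> \<le> omult \<alpha> \<gamma>"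
  by (rule ordinal_leI) (meson less_omult_iff order.strict_trans2)

lemma omult_succ: "omult \<alpha> (succ \<beta>) = oadd (omult \<alpha> \<beta>) \<alpha>"
proof (rule antisym)
  show "omult \<alpha> (succ \<beta>) \<le> oadd (omult \<alpha> \<beta>) \<alpha>"
    by (rule ordinal_leI)
      (auto simp: less_omult_iff[of _ _ "succ \<beta>"] intro: order.strict_trans2 oadd_mono_left omult_mono)
  show "oadd (omult \<alpha> \<beta>) \<alpha> \<le> omult \<alpha> (succ \<beta>)"
    by (rule ordinal_leI) (auto simp: less_omult_iff[of _ _ "succ \<beta>"])
qed

text \<open>Below \<omega>^(\<nu>+1) only finite multiples of \<omega>^\<nu> matter. Adding \<alpha>
  on the right appends one more block of length \<alpha> at the end.\<close>

definition omult_nat :: "ordinal \<Rightarrow> nat \<Rightarrow> ordinal" where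
  "omult_nat \<alpha> n = ((\<lambda>\<beta>. oadd \<beta> \<alpha>) ^^ n) 0"

lemma omult_nat_0 [simp]: "omult_nat \<alpha> 0 = 0"
  and omult_nat_Suc: "omult_nat \<alpha> (Suc n) = oadd (omult_nat \<alpha> n) \<alpha>"
  by (simp_all add: omult_nat_def)

lemma omult_funpow_succ: "omult \<alpha> ((succ ^^ n) 0) = omult_nat \<alpha> n"
proof (induction n)
  case 0
  have "\<not> 0 < omult \<alpha> 0" by (simp add: less_omult_iff)
  then show ?case by (simp add: zero_less_ordinal_iff)
qed (simp add: omult_succ omult_nat_Suc)

lemma less_omult_omega_iff: "x < omult \<alpha> omega \<longleftrightarrow> (\<exists>n. x < omult_nat \<alpha> (Suc n))"
  unfolding less_omult_iff[of x \<alpha> omega] less_omega_iff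
  by (metis omult_funpow_succ omult_nat_Suc)

lemma omult_nat_mono: "m \<le> n \<Longrightarrow> omult_nat \<alpha> m \<le> omult_nat \<alpha> n"
  by (induction n rule: dec_induct) (auto simp: omult_nat_Suc intro: order.trans le_oadd_left)

lemma omult_nat_mono_left: "\<alpha> \<le> \<beta> \<Longrightarrow> omult_nat \<alpha> n \<le> omult_nat \<beta> n"
  by (induction n) (auto simp: omult_nat_Suc intro: order.trans oadd_mono oadd_mono_left)

lemma even_omult_nat: "limit \<alpha> \<Longrightarrow> even_ordinal (omult_nat \<alpha> n)"
  by (cases n) (auto simp: omult_nat_Suc even_ordinal_limit limit_oadd)

lemma less_one_ordinal_iff [simp]: "\<alpha> < 1 \<longleftrightarrow> \<alpha> = (0::ordinal)"
  unfolding one_ordinal_def less_succ_iff by (metis antisym zero_le_ordinal order.refl)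

lemma less_opower_iff:
  "x < opower \<alpha> \<beta> \<longleftrightarrow> x = 0 \<or> (\<exists>\<gamma><\<beta>. x < omult (opower \<alpha> \<gamma>) \<alpha>)"
  by (subst opower.simps, subst less_cSup_iff) (auto simp: bdd_above_image_lessThan)

lemma opower_pos: "0 < opower \<alpha> \<beta>"
  by (simp add: less_opower_iff)

lemma opower_mono:
  assumes "\<beta> \<le> \<gamma>"
  shows "opower \<alpha> \<beta> \<le> opower \<alpha> \<gamma>"
proof (rule ordinal_leI)
  fix x assume "x < opower \<alpha> \<beta>"
  then show "x < opower \<alpha> \<gamma>"
    unfolding less_opower_iff[of x] using assms by (auto intro: order.strict_trans2)
qed

text \<open>The supremum defining the power runs over all exponents up to \<nu>; multiples for
  smaller exponents are dominated by those for \<nu>, and the extra element 1, whose only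
  predecessor is 0, by a single copy.\<close>

lemma less_opower_omega_succ:
  "x < opower omega (succ \<nu>) \<longleftrightarrow> (\<exists>n. x < omult_nat (opower omega \<nu>) n)"
proof -
  have "(\<exists>n. x < omult_nat (opower omega \<nu>) n)" if "\<gamma> \<le> \<nu>" "x < omult (opower omega \<gamma>) omega" for \<gamma>
  proof -
    obtain n where "x < omult_nat (opower omega \<gamma>) n"
      using \<open>x < omult (opower omega \<gamma>) omega\<close> less_omult_omega_iff by blast
    with omult_nat_mono_left[OF opower_mono[OF \<open>\<gamma> \<le> \<nu>\<close>]] show ?thesis
      by (meson order.strict_trans2)
  qed
  moreover have "0 < omult_nat (opower omega \<nu>) (Suc 0)"
    using opower_pos[of omega \<nu>] le_oadd_right[of "opower omega \<nu>" 0] by (simp add: omult_nat_Suc)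
  moreover have "x < omult (opower omega \<nu>) omega" if "x < omult_nat (opower omega \<nu>) n" for n
  proof -
    have "x < omult_nat (opower omega \<nu>) (Suc n)"
      using omult_nat_mono[of n "Suc n"] that by (simp add: order.strict_trans2)
    then show ?thesis unfolding less_omult_omega_iff ..
  qed
  ultimately show ?thesis
    unfolding less_opower_iff[of x omega "succ \<nu>"] less_succ_iff by blast
qed

lemma less_opower_omega_iff:
  assumes "\<nu> \<noteq> 0"
  shows "x < opower omega \<nu> \<longleftrightarrow> (\<exists>\<gamma><\<nu>. x < opower omega (succ \<gamma>))"
proof
  assume "x < opower omega \<nu>"
  then consider "x = 0" | \<gamma> where "\<gamma> < \<nu>" "x < omult (opower omega \<gamma>) omega"
    unfolding less_opower_iff by blast
  then show "\<exists>\<gamma><\<nu>. x < opower omega (succ \<gamma>)"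
  proof cases
    case 1
    then show ?thesis using assms opower_pos zero_less_ordinal_iff by blast
  next
    case 2
    then have "x < opower omega (succ \<gamma>)"
      using less_opower_iff[of x omega "succ \<gamma>"] less_succ by blast
    with 2 show ?thesis by blast
  qed
next
  assume "\<exists>\<gamma><\<nu>. x < opower omega (succ \<gamma>)"
  then show "x < opower omega \<nu>"
    by (meson opower_mono order.strict_trans2 succ_le_iff)
qed

lemma limit_opower_omega:
  assumes "\<nu> \<noteq> 0"
  shows "limit (opower omega \<nu>)"
  unfolding limit_def
proof (intro conjI allI impI)
  show "opower omega \<nu> \<noteq> 0" using opower_pos[of omega \<nu>] by (auto simp: zero_less_ordinal_iff)
next
  fix \<eta> assume "\<eta> < opower omega \<nu>"
  then obtain \<gamma> n where g: "\<gamma> < \<nu>" "\<eta> < omult_nat (opower omega \<gamma>) n"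
    using less_opower_omega_iff[OF assms] less_opower_omega_succ by blast
  have "oadd (omult_nat (opower omega \<gamma>) n) 0 < omult_nat (opower omega \<gamma>) (Suc n)"
    unfolding omult_nat_Suc oadd_less_iff by (rule opower_pos)
  with g(2) have "succ \<eta> < omult_nat (opower omega \<gamma>) (Suc n)"
    by (metis oadd_0 order.strict_trans1 succ_le_iff)
  then show "succ \<eta> < opower omega \<nu>"
    using g(1) less_opower_omega_iff[OF assms] less_opower_omega_succ by blast
qed

lemma omega_less_omega1: "omega < omega1"
proof -
  have "{..<omega} \<subseteq> range (\<lambda>n. (succ ^^ n) 0)"
    by (auto simp: less_omega_iff)
  then have "countable {..<omega}" by (rule countable_subset) simp
  then show ?thesis by (simp add: less_omega1_iff)
qed

lemma omult_less_omega1: "\<alpha> < omega1 \<Longrightarrow> \<beta> < omega1 \<Longrightarrow> omult \<alpha> \<beta> < omega1"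
proof (induction \<beta> rule: less_induct)
  case (less \<beta>)
  have "omult \<alpha> \<gamma> < omega1" if "\<gamma> < \<beta>" for \<gamma>
    using less that by (meson order.strict_trans)
  with less show ?case
    by (subst omult.simps, intro Sup_less_omega1) (auto simp: countable_lessThan oadd_less_omega1)
qed

lemma opower_omega_less_omega1: "\<beta> < omega1 \<Longrightarrow> opower omega \<beta> < omega1"
proof (induction \<beta> rule: less_induct)
  case (less \<beta>)
  have "opower omega \<gamma> < omega1" if "\<gamma> < \<beta>" for \<gamma>
    using less that by (meson order.strict_trans)
  moreover have "1 < omega1"
    using limit_succ_less[OF limit_omega1 limit_pos[OF limit_omega1]] by (simp add: one_ordinal_def)
  ultimately show ?case using less.prems
    by (subst opower.simps, intro Sup_less_omega1)
      (auto simp: countable_lessThan omult_less_omega1 omega_less_omega1)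
qed

lemma less_omult_natE:
  assumes "x < omult_nat w m"
  obtains k c where "k < m" "c < w" "x = oadd (omult_nat w k) c"
  using assms
proof (induction m arbitrary: thesis)
  case (Suc m)
  show ?case
  proof (cases "x < omult_nat w m")
    case True
    then show ?thesis using Suc.IH Suc.prems(1) by (metis less_SucI)
  next
    case False
    then obtain c where c: "x = oadd (omult_nat w m) c" by (meson not_less oadd_diff)
    with Suc.prems(2) have "c < w" by (simp add: omult_nat_Suc)
    with c show ?thesis using Suc.prems(1) by blast
  qed
qed simp

subsection \<open>Hessenberg sums\<close>

context
  notes [fundef_cong] = image_cong
begin

text \<open>The least ordinal above every sum in which one argument is lowered. Strict monotonicity
  in both arguments is built into this recursion; the work lies in bounding the result by powers of
  \<omega>.\<close>

function hsum :: "ordinal \<Rightarrow> ordinal \<Rightarrow> ordinal" where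
  "hsum \<alpha> \<beta> = Sup ((\<lambda>\<gamma>. succ (hsum \<gamma> \<beta>)) ` {..<\<alpha>} \<union> (\<lambda>\<gamma>. succ (hsum \<alpha> \<gamma>)) ` {..<\<beta>})"
  by auto
termination
  by (relation "{(x, y). x < y} <*lex*> {(x, y). x < y}") (auto simp: wf)

declare hsum.simps [simp del]

end

lemma less_hsum_iff:
  "x < hsum \<alpha> \<beta> \<longleftrightarrow> (\<exists>\<gamma><\<alpha>. x \<le> hsum \<gamma> \<beta>) \<or> (\<exists>\<gamma><\<beta>. x \<le> hsum \<alpha> \<gamma>)"
proof (cases "\<alpha> = 0 \<and> \<beta> = 0")
  case True
  have "{..<0::ordinal} = {}" by auto
  with True have "hsum \<alpha> \<beta> = 0" by (subst hsum.simps) (simp add: Sup_empty_ordinal)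
  with True show ?thesis by simp
next
  case False
  then have "0 < \<alpha> \<or> 0 < \<beta>" by (simp add: zero_less_ordinal_iff)
  then have "{..<\<alpha>} \<noteq> {} \<or> {..<\<beta>} \<noteq> {}" by blast
  then show ?thesis
    by (subst hsum.simps, subst less_cSup_iff) (auto simp: bdd_above_image_lessThan bex_Un)
qed

lemma hsum_strict_mono_left: "\<alpha> < \<alpha>' \<Longrightarrow> hsum \<alpha> \<beta> < hsum \<alpha>' \<beta>"
  and hsum_strict_mono_right: "\<beta> < \<beta>' \<Longrightarrow> hsum \<alpha> \<beta> < hsum \<alpha> \<beta>'"
  unfolding less_hsum_iff[of _ \<alpha>'] less_hsum_iff[of _ \<alpha> \<beta>'] by blast+

lemma hsum_mono:
  assumes "\<alpha> \<le> \<alpha>'" "\<beta> \<le> \<beta>'"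
  shows "hsum \<alpha> \<beta> \<le> hsum \<alpha>' \<beta>'"
proof -
  have "hsum \<alpha> \<beta> \<le> hsum \<alpha>' \<beta>"
    using assms(1) hsum_strict_mono_left[of \<alpha> \<alpha>' \<beta>] by (auto simp: le_less)
  also have "\<dots> \<le> hsum \<alpha>' \<beta>'"
    using assms(2) hsum_strict_mono_right[of \<beta> \<beta>' \<alpha>'] by (auto simp: le_less)
  finally show ?thesis .
qed

text \<open>Raising either argument raises the sum strictly. This is the property that ordinary
  addition lacks on the left.\<close>

lemma hsum_eq_mono:
  assumes "\<alpha> \<le> \<alpha>'" "\<beta> \<le> \<beta>'" "hsum \<alpha>' \<beta>' \<le> hsum \<alpha> \<beta>"
  shows "\<alpha> = \<alpha>' \<and> \<beta> = \<beta>'"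
proof (rule ccontr)
  assume "\<not> (\<alpha> = \<alpha>' \<and> \<beta> = \<beta>')"
  with assms consider "\<alpha> < \<alpha>'" | "\<beta> < \<beta>'" by (auto simp: le_less)
  then have "hsum \<alpha> \<beta> < hsum \<alpha>' \<beta>'"
  proof cases
    case 1
    then show ?thesis
      using hsum_strict_mono_left[OF 1, of \<beta>] hsum_mono[OF order.refl assms(2), of \<alpha>'] by simp
  next
    case 2
    then show ?thesis
      using hsum_strict_mono_right[OF 2, of \<alpha>'] hsum_mono[OF assms(1) order.refl, of \<beta>] by simp
  qed
  with assms(3) show False by simp
qed

lemma hsum_0_0: "hsum 0 0 = 0"
  using less_hsum_iff[of 0 0 0] by (simp add: zero_less_ordinal_iff)

lemma le_hsum_left: "\<alpha> \<le> hsum \<alpha> \<beta>"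
proof (induction \<alpha> rule: less_induct)
  case (less \<alpha>)
  then show ?case
    using hsum_strict_mono_left by (intro ordinal_leI) (meson order.strict_trans1)
qed

lemma oadd_le_hsum: "oadd \<alpha> \<beta> \<le> hsum \<alpha> \<beta>"
proof (induction \<beta> rule: less_induct)
  case (less \<beta>)
  show ?case
  proof (rule ordinal_leI)
    fix x assume "x < oadd \<alpha> \<beta>"
    then consider "x < \<alpha>" | \<gamma> where "\<gamma> < \<beta>" "x \<le> oadd \<alpha> \<gamma>" unfolding less_oadd_iff by blast
    then show "x < hsum \<alpha> \<beta>"
    proof cases
      case 1
      then show ?thesis using le_hsum_left by (rule order.strict_trans2)
    next
      case 2
      with less[of \<gamma>] show ?thesis unfolding less_hsum_iff by (meson order.trans)
    qed
  qed
qed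

text \<open>Lowering one argument either lowers its remainder inside the same block or moves it to
  an earlier block. The first case lowers the sum of the remainders; in the second a whole block is
  lost, which outweighs any remainder because sums of remainders stay below w.\<close>

lemma hsum_omult_nat_le:
  assumes closed: "\<And>c d. c < w \<Longrightarrow> d < w \<Longrightarrow> hsum c d < w"
  shows "\<alpha> = oadd (omult_nat w m) c \<Longrightarrow> \<beta> = oadd (omult_nat w n) d \<Longrightarrow> c < w \<Longrightarrow> d < w \<Longrightarrow>
    hsum \<alpha> \<beta> \<le> oadd (omult_nat w (m + n)) (hsum c d)"
proof (induction \<alpha> \<beta> arbitrary: m c n d rule: hsum.induct)
  case (1 \<alpha> \<beta>)
  have step: "x < oadd (omult_nat w (m + n)) (hsum c d)"
    if x: "x \<le> oadd (omult_nat w k) e" and "e < w" "k < m + n" for x k e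
  proof -
    have "oadd (omult_nat w k) e < oadd (omult_nat w k) w" using \<open>e < w\<close> by simp
    also have "\<dots> \<le> omult_nat w (m + n)"
      using omult_nat_mono[of "Suc k" "m + n" w] \<open>k < m + n\<close> by (simp add: omult_nat_Suc)
    finally show ?thesis using x le_oadd_left by (meson order.strict_trans1 order.strict_trans2)
  qed
  show ?case
  proof (rule ordinal_leI)
    fix x assume "x < hsum \<alpha> \<beta>"
    then consider (l) \<gamma> where "\<gamma> < \<alpha>" "x \<le> hsum \<gamma> \<beta>" | (r) \<gamma> where "\<gamma> < \<beta>" "x \<le> hsum \<alpha> \<gamma>"
      unfolding less_hsum_iff by blast
    then show "x < oadd (omult_nat w (m + n)) (hsum c d)"
    proof cases
      case l
      show ?thesis
      proof (cases "\<gamma> < omult_nat w m")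
        case True
        then obtain k e where k: "k < m" "e < w" "\<gamma> = oadd (omult_nat w k) e"
          by (rule less_omult_natE)
        have "hsum \<gamma> \<beta> \<le> oadd (omult_nat w (k + n)) (hsum e d)"
          using 1(1)[of \<gamma> k e n d] l(1) k 1 by simp
        with l(2) show ?thesis
          using closed[OF k(2) 1(6)] k(1) by (intro step[of x "k + n" "hsum e d"]) auto
      next
        case False
        then obtain e where e: "\<gamma> = oadd (omult_nat w m) e" by (meson not_less oadd_diff)
        then have "e < c" using l 1(3) by simp
        then have "hsum \<gamma> \<beta> \<le> oadd (omult_nat w (m + n)) (hsum e d)"
          using 1(1)[of \<gamma> m e n d] l(1) e 1 by simp
        also have "\<dots> < oadd (omult_nat w (m + n)) (hsum c d)"
          using hsum_strict_mono_left[OF \<open>e < c\<close>] by simp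
        finally show ?thesis using l(2) by simp
      qed
    next
      case r
      show ?thesis
      proof (cases "\<gamma> < omult_nat w n")
        case True
        then obtain k e where k: "k < n" "e < w" "\<gamma> = oadd (omult_nat w k) e"
          by (rule less_omult_natE)
        have "hsum \<alpha> \<gamma> \<le> oadd (omult_nat w (m + k)) (hsum c e)"
          using 1(2)[of \<gamma> m c k e] r(1) k 1 by simp
        with r(2) show ?thesis
          using closed[OF 1(5) k(2)] k(1) by (intro step[of x "m + k" "hsum c e"]) auto
      next
        case False
        then obtain e where e: "\<gamma> = oadd (omult_nat w n) e" by (meson not_less oadd_diff)
        then have "e < d" using r 1(4) by simp
        then have "hsum \<alpha> \<gamma> \<le> oadd (omult_nat w (m + n)) (hsum c e)"
          using 1(2)[of \<gamma> m c n e] r(1) e 1 by simp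
        also have "\<dots> < oadd (omult_nat w (m + n)) (hsum c d)"
          using hsum_strict_mono_right[OF \<open>e < d\<close>] by simp
        finally show ?thesis using r(2) by simp
      qed
    qed
  qed
qed

text \<open>Both arguments lie below \<omega>^(\<gamma>+1) for a common \<gamma> < \<nu>, hence are
  finite multiples of \<omega>^\<gamma> plus remainders. The induction hypothesis for \<gamma> keeps
  sums of remainders inside one block, which is the closure that \<open>hsum_omult_nat_le\<close>
  asks for.\<close>

lemma hsum_less_opower_omega:
  "\<alpha> < opower omega \<nu> \<Longrightarrow> \<beta> < opower omega \<nu> \<Longrightarrow> hsum \<alpha> \<beta> < opower omega \<nu>"
proof (induction \<nu> arbitrary: \<alpha> \<beta> rule: less_induct)
  case (less \<nu>)
  show ?case
  proof (cases "\<nu> = 0")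
    case True
    with less.prems show ?thesis by (simp add: less_opower_iff hsum_0_0)
  next
    case False
    obtain \<gamma>1 \<gamma>2 where "\<gamma>1 < \<nu>" "\<gamma>2 < \<nu>"
      and g: "\<alpha> < opower omega (succ \<gamma>1)" "\<beta> < opower omega (succ \<gamma>2)"
      using less.prems less_opower_omega_iff[OF False] by blast
    define \<gamma> where "\<gamma> = max \<gamma>1 \<gamma>2"
    have \<gamma>: "\<gamma> < \<nu>" using \<open>\<gamma>1 < \<nu>\<close> \<open>\<gamma>2 < \<nu>\<close> by (simp add: \<gamma>_def)
    let ?w = "opower omega \<gamma>"
    have "\<alpha> < opower omega (succ \<gamma>)" "\<beta> < opower omega (succ \<gamma>)"
      using g opower_mono[of "succ \<gamma>1" "succ \<gamma>"] opower_mono[of "succ \<gamma>2" "succ \<gamma>"]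
      by (auto simp: \<gamma>_def intro: order.strict_trans2)
    then obtain m n where "\<alpha> < omult_nat ?w m" "\<beta> < omult_nat ?w n"
      unfolding less_opower_omega_succ by blast
    then obtain m c n d where *: "c < ?w" "\<alpha> = oadd (omult_nat ?w m) c"
      "d < ?w" "\<beta> = oadd (omult_nat ?w n) d"
      by (meson less_omult_natE)
    have "hsum \<alpha> \<beta> \<le> oadd (omult_nat ?w (m + n)) (hsum c d)"
      using * less.IH[OF \<gamma>] by (intro hsum_omult_nat_le) auto
    also have "\<dots> < omult_nat ?w (Suc (m + n))"
      using less.IH[OF \<gamma>] * by (simp add: omult_nat_Suc)
    finally have "hsum \<alpha> \<beta> < opower omega (succ \<gamma>)" unfolding less_opower_omega_succ by blast
    with \<gamma> show ?thesis using less_opower_omega_iff[OF False] by blast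
  qed
qed

lemma oadd_less_opower_omega:
  "\<alpha> < opower omega \<nu> \<Longrightarrow> \<beta> < opower omega \<nu> \<Longrightarrow> oadd \<alpha> \<beta> < opower omega \<nu>"
  using oadd_le_hsum hsum_less_opower_omega by (meson order.strict_trans1)

lemma omult_nat_less_opower_omega: "\<alpha> < opower omega \<nu> \<Longrightarrow> omult_nat \<alpha> n < opower omega \<nu>"
  by (induction n) (auto simp: omult_nat_Suc oadd_less_opower_omega opower_pos)

primrec hsum_upto :: "(nat \<Rightarrow> ordinal) \<Rightarrow> nat \<Rightarrow> ordinal" where
  "hsum_upto v 0 = v 0"
| "hsum_upto v (Suc n) = hsum (hsum_upto v n) (v (Suc n))"

lemma hsum_upto_mono: "(\<And>i. i \<le> n \<Longrightarrow> u i \<le> v i) \<Longrightarrow> hsum_upto u n \<le> hsum_upto v n"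
  by (induction n) (auto intro!: hsum_mono)

text \<open>Meant for u the collapsed ranks at a point near the one with collapsed ranks v: nearby
  ranks can only drop, so a point with the same total agrees in every coordinate.\<close>

lemma hsum_upto_eq_mono:
  "(\<And>i. i \<le> n \<Longrightarrow> u i \<le> v i) \<Longrightarrow> hsum_upto v n \<le> hsum_upto u n \<Longrightarrow> i \<le> n \<Longrightarrow> u i = v i"
proof (induction n)
  case (Suc n)
  have *: "hsum_upto u n = hsum_upto v n \<and> u (Suc n) = v (Suc n)"
    using Suc.prems by (intro hsum_eq_mono hsum_upto_mono) auto
  with Suc.IH Suc.prems show ?case by (cases "i = Suc n") auto
qed simp

lemma hsum_upto_less_opower_omega:
  "(\<And>i. i \<le> n \<Longrightarrow> v i < opower omega \<nu>) \<Longrightarrow> hsum_upto v n < opower omega \<nu>"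
  by (induction n) (auto intro!: hsum_less_opower_omega)

subsection \<open>Collapsing ordinals below a finite multiple\<close>

text \<open>Quotient and, in \<open>off\<close>, remainder on division by w. They are meaningful
  only below some \<open>omult_nat w n\<close>, hence the bounds assumed in most lemmas that
  follow.\<close>

definition blk :: "ordinal \<Rightarrow> ordinal \<Rightarrow> nat" where
  "blk w r = (LEAST k. r < omult_nat w (Suc k))"

definition off :: "ordinal \<Rightarrow> ordinal \<Rightarrow> ordinal" where
  "off w r = (SOME c. r = oadd (omult_nat w (blk w r)) c)"

lemma blk_off:
  assumes "r < omult_nat w n"
  shows "r = oadd (omult_nat w (blk w r)) (off w r)" and "off w r < w"
proof -
  \<comment> \<open>\<open>blk\<close> tries only bounds of the form \<open>Suc k\<close>, so n is
    enlarged to \<open>Suc n\<close> to obtain a witness.\<close>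
  have "r < omult_nat w (Suc n)"
    using assms omult_nat_mono[of n "Suc n" w] by (simp add: order.strict_trans2)
  then have less: "r < omult_nat w (Suc (blk w r))"
    unfolding blk_def by (rule LeastI)
  have "\<not> r < omult_nat w (blk w r)"
  proof (cases "blk w r")
    case (Suc k)
    then show ?thesis unfolding blk_def by (metis lessI not_less_Least)
  qed simp
  then have "\<exists>c. r = oadd (omult_nat w (blk w r)) c" by (intro oadd_diff) (simp add: not_less)
  then show r: "r = oadd (omult_nat w (blk w r)) (off w r)"
    unfolding off_def by (rule someI_ex)
  show "off w r < w" using less by (subst (asm) r) (simp add: omult_nat_Suc)
qed

lemma blk_mono:
  assumes "r \<le> r'" "r' < omult_nat w n"
  shows "blk w r \<le> blk w r'"
proof -
  have "r' < omult_nat w (Suc n)"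
    using assms omult_nat_mono[of n "Suc n" w] by (simp add: order.strict_trans2)
  then have "r' < omult_nat w (Suc (blk w r'))"
    unfolding blk_def by (rule LeastI)
  with assms(1) show ?thesis
    unfolding blk_def[of w r] by (intro Least_le) simp
qed

lemma off_mono:
  assumes "r \<le> r'" "r' < omult_nat w n" "blk w r = blk w r'"
  shows "off w r \<le> off w r'"
proof -
  have "r < omult_nat w n" using assms by simp
  then show ?thesis using blk_off(1)[of r w n] blk_off(1)[of r' w n] assms by (metis oadd_le_iff)
qed

text \<open>
  The order-preserving map that keeps the first \<open>\<rho>\<close> elements of each of the first \<open>n\<close> blocks of
  length \<open>w\<close> and identifies the rest of each block.
\<close>

definition collapse :: "ordinal \<Rightarrow> ordinal \<Rightarrow> nat \<Rightarrow> ordinal \<Rightarrow> ordinal" where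
  "collapse w \<rho> n r =
     oadd (omult_nat (succ \<rho>) (min (blk w r) n)) (if blk w r < n then min (off w r) \<rho> else 0)"

text \<open>The ordinals that \<open>collapse\<close> keeps apart from all others. In a block below
  n the offsets from \<rho> on share the value \<rho>, which is why image blocks have length
  \<open>succ \<rho>\<close>; everything from block n on goes to one point.\<close>

definition kept :: "ordinal \<Rightarrow> ordinal \<Rightarrow> nat \<Rightarrow> ordinal \<Rightarrow> bool" where
  "kept w \<rho> n r \<longleftrightarrow> blk w r < n \<and> off w r < \<rho>"

lemma oadd_omult_nat_less:
  assumes "c < w" "k < l"
  shows "oadd (omult_nat w k) c < oadd (omult_nat w l) d"
proof -
  have "oadd (omult_nat w k) c < omult_nat w (Suc k)"
    using assms by (simp add: omult_nat_Suc)
  also have "\<dots> \<le> omult_nat w l" using assms by (intro omult_nat_mono) simp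
  also have "\<dots> \<le> oadd (omult_nat w l) d" by (rule le_oadd_left)
  finally show ?thesis .
qed

lemma collapse_mono:
  assumes "r \<le> r'" "r' < omult_nat w m"
  shows "collapse w \<rho> n r \<le> collapse w \<rho> n r'"
proof (cases "min (blk w r) n = min (blk w r') n")
  case False
  with blk_mono[OF assms] have "min (blk w r) n < min (blk w r') n" by auto
  then show ?thesis unfolding collapse_def
    by (intro less_imp_le oadd_omult_nat_less) auto
next
  case True
  show ?thesis
  proof (cases "blk w r < n")
    case True': True
    with True have "blk w r = blk w r'" by auto
    with off_mono[OF assms] show ?thesis
      unfolding collapse_def by (auto intro: min.coboundedI1 simp: min_le_iff_disj)
  next
    case False
    with blk_mono[OF assms] have "\<not> blk w r' < n" by simp
    with False True show ?thesis unfolding collapse_def by simp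
  qed
qed

text \<open>The truncated offset is below \<open>succ \<rho>\<close>, so the value determines the
  truncated block number and offset. Being kept means that both are strictly below their cut-offs n
  and \<rho>, and then truncation has changed nothing.\<close>

lemma collapse_eq:
  assumes "collapse w \<rho> n r = collapse w \<rho> n r'"
  shows "kept w \<rho> n r \<longleftrightarrow> kept w \<rho> n r'"
    and "kept w \<rho> n r \<Longrightarrow> r < omult_nat w m \<Longrightarrow> r' < omult_nat w m \<Longrightarrow> r = r'"
proof -
  let ?c = "\<lambda>r. if blk w r < n then min (off w r) \<rho> else 0"
  have c: "?c r < succ \<rho>" for r by auto
  have b: "min (blk w r) n = min (blk w r') n"
  proof (rule linorder_cases)
    assume "min (blk w r) n < min (blk w r') n"
    from oadd_omult_nat_less[OF c[of r] this, of "?c r'"] assms show ?thesis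
      by (simp add: collapse_def)
  next
    assume "min (blk w r') n < min (blk w r) n"
    from oadd_omult_nat_less[OF c[of r'] this, of "?c r"] assms show ?thesis
      by (simp add: collapse_def)
  qed
  with assms have "oadd (omult_nat (succ \<rho>) (min (blk w r') n)) (?c r) =
      oadd (omult_nat (succ \<rho>) (min (blk w r') n)) (?c r')"
    unfolding collapse_def by simp
  then have c_eq: "?c r = ?c r'" unfolding eq_iff by (simp only: oadd_le_iff)
  show kept: "kept w \<rho> n r \<longleftrightarrow> kept w \<rho> n r'"
    using b c_eq unfolding kept_def by (auto simp: min_def split: if_splits)
  assume "kept w \<rho> n r" "r < omult_nat w m" "r' < omult_nat w m"
  moreover with b c_eq kept have "blk w r = blk w r'" "off w r = off w r'"
    unfolding kept_def by (auto simp: min_def split: if_splits)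
  ultimately show "r = r'" using blk_off(1)[of r w m] blk_off(1)[of r' w m] by simp
qed

text \<open>Whatever w is, the image consists of finitely many blocks of length
  \<open>succ \<rho>\<close>, and powers of \<omega> are closed under finite sums.\<close>

lemma collapse_less_opower_omega:
  assumes "\<gamma> \<noteq> 0" "\<rho> < opower omega \<gamma>"
  shows "collapse w \<rho> n r < opower omega \<gamma>"
proof -
  have "succ \<rho> < opower omega \<gamma>"
    using assms limit_opower_omega limit_succ_less by blast
  moreover have "(if blk w r < n then min (off w r) \<rho> else 0) < opower omega \<gamma>"
    using assms(2) by (auto simp: opower_pos min_less_iff_disj)
  ultimately show ?thesis
    unfolding collapse_def by (intro oadd_less_opower_omega omult_nat_less_opower_omega)
qed

subsection \<open>Borel classes\<close>

lemma Sigma0_ge_1: "Sigma0 \<tau> \<xi> A \<Longrightarrow> 1 \<le> \<xi>"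
  by (cases rule: Sigma0.cases) auto

lemma Sigma0_subset: "Sigma0 \<tau> \<xi> A \<Longrightarrow> A \<subseteq> topspace \<tau>"
  by (cases rule: Sigma0.cases) (auto dest: openin_subset)

lemma Sigma0_1_iff [simp]: "Sigma0 \<tau> 1 A \<longleftrightarrow> openin \<tau> A"
  by (auto intro: Sigma0.intros elim: Sigma0.cases)

lemma Pi0_1_iff [simp]: "Pi0 \<tau> 1 A \<longleftrightarrow> closedin \<tau> A"
  by (simp add: Pi0_def closedin_def)

lemma Sigma0_UN_Pi0:
  assumes "1 < \<xi>" "\<And>n::nat. \<exists>\<eta><\<xi>. Pi0 \<tau> \<eta> (A n)"
  shows "Sigma0 \<tau> \<xi> (\<Union>n. A n)"
  using assms by (intro Sigma0.intros(2)) (auto simp: Pi0_def)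

lemma Sigma0E_Pi0:
  assumes "Sigma0 \<tau> \<xi> A" "1 < \<xi>"
  obtains C where "A = (\<Union>n::nat. C n)" "\<And>n. \<exists>\<eta><\<xi>. Pi0 \<tau> \<eta> (C n)"
  using assms
proof (cases rule: Sigma0.cases)
  case (2 C)
  then show ?thesis by (intro that[of C]) (auto simp: Pi0_def)
qed simp

lemma Sigma0_compl_Pi0: "Pi0 \<tau> \<xi> A \<Longrightarrow> Sigma0 \<tau> \<xi> (topspace \<tau> - A)"
  by (simp add: Pi0_def)

lemma Pi0_subset: "Pi0 \<tau> \<xi> A \<Longrightarrow> A \<subseteq> topspace \<tau>"
  by (simp add: Pi0_def)

text \<open>Metrizability enters at the first level, where open sets are F-sigma; from any higher
  level the same countable union serves for every larger index.\<close>

lemma Sigma0_mono: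
  assumes "metrizable_space \<tau>" "Sigma0 \<tau> \<xi> A" "\<xi> \<le> \<zeta>"
  shows "Sigma0 \<tau> \<zeta> A"
proof (cases "\<xi> = \<zeta>")
  case False
  then have "\<xi> < \<zeta>" "1 < \<zeta>" using assms Sigma0_ge_1[OF assms(2)] by auto
  show ?thesis
  proof (cases "\<xi> = 1")
    case True
    then have "fsigma_in \<tau> A" using assms by (intro open_imp_fsigma_in) auto
    then obtain C where C: "\<And>n. closedin \<tau> (C n)" "A = (\<Union>n::nat. C n)"
      unfolding fsigma_in_ascending by blast
    show ?thesis unfolding C(2)
      using \<open>1 < \<zeta>\<close> C(1) by (intro Sigma0_UN_Pi0) (auto intro!: exI[of _ 1])
  next
    case False
    then have "1 < \<xi>" using Sigma0_ge_1[OF assms(2)] by simp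
    from Sigma0E_Pi0[OF assms(2) this] obtain C
      where C: "A = (\<Union>n::nat. C n)" "\<And>n. \<exists>\<eta><\<xi>. Pi0 \<tau> \<eta> (C n)" by blast
    show ?thesis unfolding C(1)
      using \<open>1 < \<zeta>\<close> C(2) \<open>\<xi> < \<zeta>\<close> by (intro Sigma0_UN_Pi0) (auto intro: order.strict_trans)
  qed
qed (use assms in simp)

lemma Pi0_mono: "metrizable_space \<tau> \<Longrightarrow> Pi0 \<tau> \<xi> A \<Longrightarrow> \<xi> \<le> \<zeta> \<Longrightarrow> Pi0 \<tau> \<zeta> A"
  unfolding Pi0_def using Sigma0_mono by blast

lemma Pi0_imp_Sigma0:
  assumes "Pi0 \<tau> \<eta> A" "\<eta> < \<xi>"
  shows "Sigma0 \<tau> \<xi> A"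
proof -
  have "1 < \<xi>" using assms Sigma0_ge_1 unfolding Pi0_def by (meson order.strict_trans1)
  then have "Sigma0 \<tau> \<xi> (\<Union>n::nat. A)" using assms by (intro Sigma0_UN_Pi0) auto
  then show ?thesis by simp
qed

lemma Sigma0_UN:
  assumes "\<And>n::nat. Sigma0 \<tau> \<xi> (A n)"
  shows "Sigma0 \<tau> \<xi> (\<Union>n. A n)"
proof (cases "\<xi> = 1")
  case True
  with assms show ?thesis by auto
next
  case False
  then have "1 < \<xi>" using Sigma0_ge_1[OF assms] by simp
  then have "\<exists>C. A n = (\<Union>m::nat. C m) \<and> (\<forall>m. \<exists>\<eta><\<xi>. Pi0 \<tau> \<eta> (C m))" for n
    by (metis Sigma0E_Pi0[OF assms[of n]])
  then obtain C where C: "\<And>n. A n = (\<Union>m::nat. C n m)" "\<And>n m. \<exists>\<eta><\<xi>. Pi0 \<tau> \<eta> (C n m)"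
    by metis
  have "(\<Union>n. A n) = (\<Union>k. case prod_decode k of (n, m) \<Rightarrow> C n m)"
  proof (intro equalityI subsetI)
    fix x assume "x \<in> (\<Union>n. A n)"
    then obtain n m where "x \<in> C n m" unfolding C(1) by blast
    then have "x \<in> (case prod_decode (prod_encode (n, m)) of (n, m) \<Rightarrow> C n m)" by simp
    then show "x \<in> (\<Union>k. case prod_decode k of (n, m) \<Rightarrow> C n m)" by (rule UN_I[OF UNIV_I])
  next
    fix x assume "x \<in> (\<Union>k. case prod_decode k of (n, m) \<Rightarrow> C n m)"
    then obtain k where k: "x \<in> (case prod_decode k of (n, m) \<Rightarrow> C n m)" by (elim UN_E)
    show "x \<in> (\<Union>n. A n)" unfolding C(1)
      using k by (cases "prod_decode k") auto
  qed
  also have "Sigma0 \<tau> \<xi> \<dots>"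
    using \<open>1 < \<xi>\<close> C(2) by (intro Sigma0_UN_Pi0) (auto split: prod.splits)
  finally show ?thesis .
qed

lemma Sigma0_empty: "1 \<le> \<xi> \<Longrightarrow> metrizable_space \<tau> \<Longrightarrow> Sigma0 \<tau> \<xi> {}"
  and Sigma0_topspace: "1 \<le> \<xi> \<Longrightarrow> metrizable_space \<tau> \<Longrightarrow> Sigma0 \<tau> \<xi> (topspace \<tau>)"
  using Sigma0_mono[of \<tau> 1 _ \<xi>] by auto

lemma Sigma0_countable_Union:
  assumes "1 \<le> \<xi>" "metrizable_space \<tau>" "countable \<A>" "\<And>A. A \<in> \<A> \<Longrightarrow> Sigma0 \<tau> \<xi> A"
  shows "Sigma0 \<tau> \<xi> (\<Union>\<A>)"
proof (cases "\<A> = {}")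
  case True
  then show ?thesis using Sigma0_empty assms by simp
next
  case False
  have "\<Union>\<A> = (\<Union>n. from_nat_into \<A> n)"
    using range_from_nat_into[OF False assms(3)] by (metis)
  also have "Sigma0 \<tau> \<xi> \<dots>"
    using assms(4) from_nat_into[OF False] by (intro Sigma0_UN) auto
  finally show ?thesis .
qed

lemma Sigma0_Un:
  assumes "Sigma0 \<tau> \<xi> A" "Sigma0 \<tau> \<xi> B"
  shows "Sigma0 \<tau> \<xi> (A \<union> B)"
proof -
  have "Sigma0 \<tau> \<xi> (\<Union>n::nat. if n = 0 then A else B)"
    using assms by (intro Sigma0_UN) auto
  also have "(\<Union>n::nat. if n = 0 then A else B) = A \<union> B" by (auto split: if_splits)
  finally show ?thesis .
qed

lemma Pi0_Int:
  assumes "Pi0 \<tau> \<xi> A" "Pi0 \<tau> \<xi> B"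
  shows "Pi0 \<tau> \<xi> (A \<inter> B)"
  using assms Sigma0_Un[of \<tau> \<xi> "topspace \<tau> - A" "topspace \<tau> - B"]
  by (auto simp: Pi0_def Diff_Int)

lemma Sigma0_Int:
  assumes "metrizable_space \<tau>" "Sigma0 \<tau> \<xi> A" "Sigma0 \<tau> \<xi> B"
  shows "Sigma0 \<tau> \<xi> (A \<inter> B)"
proof (cases "\<xi> = 1")
  case True
  with assms show ?thesis by auto
next
  case False
  then have \<xi>: "1 < \<xi>" using Sigma0_ge_1[OF assms(2)] by simp
  obtain C where C: "A = (\<Union>n::nat. C n)" "\<And>n. \<exists>\<eta><\<xi>. Pi0 \<tau> \<eta> (C n)"
    using Sigma0E_Pi0[OF assms(2) \<xi>] by metis
  obtain D where D: "B = (\<Union>n::nat. D n)" "\<And>n. \<exists>\<eta><\<xi>. Pi0 \<tau> \<eta> (D n)"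
    using Sigma0E_Pi0[OF assms(3) \<xi>] by metis
  have "Sigma0 \<tau> \<xi> (C n \<inter> D m)" for n m
  proof -
    obtain \<eta> \<zeta> where *: "\<eta> < \<xi>" "\<zeta> < \<xi>" "Pi0 \<tau> \<eta> (C n)" "Pi0 \<tau> \<zeta> (D m)" using C D by blast
    then have "Pi0 \<tau> (max \<eta> \<zeta>) (C n)" "Pi0 \<tau> (max \<eta> \<zeta>) (D m)"
      using Pi0_mono[OF assms(1)] by (meson max.cobounded1 max.cobounded2)+
    then have "Pi0 \<tau> (max \<eta> \<zeta>) (C n \<inter> D m)" by (rule Pi0_Int)
    then show ?thesis by (rule Pi0_imp_Sigma0) (use * in simp)
  qed
  then have "Sigma0 \<tau> \<xi> (\<Union>n. \<Union>m. C n \<inter> D m)" by (intro Sigma0_UN)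
  also have "(\<Union>n. \<Union>m. C n \<inter> D m) = A \<inter> B" unfolding C D by blast
  finally show ?thesis .
qed

lemma Pi0_Un:
  assumes "metrizable_space \<tau>" "Pi0 \<tau> \<xi> A" "Pi0 \<tau> \<xi> B"
  shows "Pi0 \<tau> \<xi> (A \<union> B)"
  using assms Sigma0_Int[of \<tau> \<xi> "topspace \<tau> - A" "topspace \<tau> - B"]
  by (auto simp: Pi0_def Diff_Un)

lemma Sigma0_finite_Inter:
  assumes "metrizable_space \<tau>" "1 \<le> \<xi>" "finite N" "\<And>n. n \<in> N \<Longrightarrow> Sigma0 \<tau> \<xi> (V n)"
  shows "Sigma0 \<tau> \<xi> (topspace \<tau> \<inter> (\<Inter>n\<in>N. V n))"
  using assms(3,4)
proof (induction N rule: finite_induct)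
  case empty
  then show ?case using Sigma0_topspace assms by simp
next
  case (insert n N)
  have "topspace \<tau> \<inter> (\<Inter>n\<in>insert n N. V n) = V n \<inter> (topspace \<tau> \<inter> (\<Inter>n\<in>N. V n))" by blast
  with insert show ?case using Sigma0_Int[OF assms(1)] by auto
qed

lemma Sigma0_succE:
  assumes "metrizable_space \<tau>" "Sigma0 \<tau> (succ \<xi>) A" "1 \<le> \<xi>"
  obtains C where "A = (\<Union>n::nat. C n)" "\<And>n. Pi0 \<tau> \<xi> (C n)" "incseq C"
proof -
  have "1 < succ \<xi>" using assms by simp
  from Sigma0E_Pi0[OF assms(2) this] obtain D
    where D: "A = (\<Union>n::nat. D n)" "\<And>n. \<exists>\<eta><succ \<xi>. Pi0 \<tau> \<eta> (D n)" by blast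
  have D': "Pi0 \<tau> \<xi> (D n)" for n
    using D(2)[of n] Pi0_mono[OF assms(1)] by auto
  define C where "C n = (\<Union>i\<le>n. D i)" for n
  show thesis
  proof
    show "A = (\<Union>n. C n)" unfolding C_def D by auto
    show "incseq C" by (auto simp: incseq_def C_def intro: order.trans)
    show "Pi0 \<tau> \<xi> (C n)" for n
    proof (induction n)
      case (Suc n)
      have "C (Suc n) = C n \<union> D (Suc n)" unfolding C_def by (auto simp: le_Suc_eq)
      with Suc D' show ?case using Pi0_Un[OF assms(1)] by simp
    qed (use D' in \<open>simp add: C_def\<close>)
  qed
qed

text \<open>By the Lindelof property countably many of the local sets cover U. It thus suffices to
  know the Borel class of basic open sets of \<sigma>.\<close>

lemma Sigma0_if_local:
  assumes "metrizable_space \<tau>" "1 \<le> \<xi>" "second_countable \<sigma>" "openin \<sigma> U"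
    and "\<And>x. x \<in> U \<Longrightarrow> \<exists>V. openin \<sigma> V \<and> Sigma0 \<tau> \<xi> V \<and> x \<in> V \<and> V \<subseteq> U"
  shows "Sigma0 \<tau> \<xi> U"
proof -
  obtain V where V: "\<And>x. x \<in> U \<Longrightarrow> openin \<sigma> (V x) \<and> Sigma0 \<tau> \<xi> (V x) \<and> x \<in> V x \<and> V x \<subseteq> U"
    using assms(5) by metis
  have "Lindelof_space (subtopology \<sigma> U)"
    by (intro second_countable_imp_Lindelof_space second_countable_subtopology assms)
  moreover have "U \<subseteq> topspace \<sigma>" using assms(4) openin_subset by blast
  moreover have "\<forall>W\<in>V ` U. openin \<sigma> W" using V by auto
  moreover have "U \<subseteq> \<Union>(V ` U)" using V by blast
  ultimately obtain \<V> where \<V>: "countable \<V>" "\<V> \<subseteq> V ` U" "U \<subseteq> \<Union>\<V>"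
    using Lindelof_space_subtopology_subset by metis
  then have "U = \<Union>\<V>" using V by blast
  moreover have "Sigma0 \<tau> \<xi> (\<Union>\<V>)"
    using \<V> V assms by (intro Sigma0_countable_Union) auto
  ultimately show ?thesis by simp
qed

subsection \<open>Refining Polish topologies\<close>

text \<open>Second countability is the form in which separability is used, for countable bases and
  for the Lindelof property.\<close>

lemma polish_iff: "polish \<tau> \<longleftrightarrow> completely_metrizable_space \<tau> \<and> second_countable \<tau>"
proof -
  have "second_countable \<tau>" if metr: "metrizable_space \<tau>" and sep: "separable_space \<tau>"
  proof -
    obtain M d where Md: "Metric_space M d" and \<tau>: "\<tau> = Metric_space.mtopology M d"
      using metr unfolding metrizable_space_def by blast
    interpret Metric_space M d by (rule Md)
    obtain C where C: "countable C" "C \<subseteq> M" "\<And>T. openin \<tau> T \<Longrightarrow> T \<noteq> {} \<Longrightarrow> C \<inter> T \<noteq> {}"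
      using sep unfolding separable_space_def dense_intersects_open \<tau> by auto
    define \<B> where "\<B> = (\<lambda>(c, n::nat). mball c (1 / real (Suc n))) ` (C \<times> UNIV)"
    have "\<exists>V\<in>\<B>. x \<in> V \<and> V \<subseteq> U" if "openin \<tau> U" "x \<in> U" for U x
    proof -
      have "x \<in> M" "\<exists>r>0. mball x r \<subseteq> U"
        using that unfolding \<tau> openin_mtopology by auto
      then obtain r where r: "r > 0" "mball x r \<subseteq> U" by blast
      obtain n :: nat where n: "1 / real (Suc n) < r / 2"
        using r(1) nat_approx_posE[of "r / 2"] by auto
      have "x \<in> mball x (1 / real (Suc n))" using \<open>x \<in> M\<close> by simp
      then have "mball x (1 / real (Suc n)) \<noteq> {}" by (metis empty_iff)
      moreover have "openin \<tau> (mball x (1 / real (Suc n)))" unfolding \<tau> by auto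
      ultimately obtain c where c: "c \<in> C" "c \<in> mball x (1 / real (Suc n))" using C(3) by blast
      have "mball c (1 / real (Suc n)) \<subseteq> mball x r"
      proof
        fix y assume "y \<in> mball c (1 / real (Suc n))"
        then show "y \<in> mball x r"
          using c n triangle[of x c y] \<open>x \<in> M\<close> by auto
      qed
      then have "mball c (1 / real (Suc n)) \<subseteq> U" using r by blast
      moreover have "x \<in> mball c (1 / real (Suc n))"
        using c \<open>x \<in> M\<close> by (auto simp: commute)
      moreover have "mball c (1 / real (Suc n)) \<in> \<B>"
        using c(1) unfolding \<B>_def by (intro image_eqI[of _ _ "(c, n)"]) auto
      ultimately show ?thesis by (intro bexI conjI)
    qed
    moreover have "countable \<B>" unfolding \<B>_def using C(1) by auto
    moreover have "openin \<tau> V" if "V \<in> \<B>" for V using that unfolding \<B>_def \<tau> by auto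
    ultimately show ?thesis unfolding second_countable_def by blast
  qed
  then show ?thesis
    unfolding polish_def
    using second_countable_imp_separable_space completely_metrizable_imp_metrizable_space by blast
qed

text \<open>Pulling back along an injection makes X a homeomorphic copy of its image, and a G-delta
  subspace of a completely metrizable space is completely metrizable. Both refinements below arise
  in this way, one from a graph and one from a diagonal.\<close>

lemma completely_metrizable_space_pullback:
  assumes "completely_metrizable_space P" "gdelta_in P (f ` X)" "inj_on f X"
  shows "completely_metrizable_space (pullback_topology X f P)"
proof -
  let ?Q = "pullback_topology X f P" let ?S = "subtopology P (f ` X)"
  have fX: "f ` X \<subseteq> topspace P" using assms(2) gdelta_in_subset by blast
  have top: "topspace ?Q = X" using fX by (auto simp: topspace_pullback_topology)
  have topS: "topspace ?S = f ` X" using fX by auto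
  have "homeomorphic_maps ?Q ?S f (inv_into X f)"
    unfolding homeomorphic_maps_def
  proof (intro conjI ballI)
    have "continuous_map ?Q P (id \<circ> f)" by (intro continuous_map_pullback) simp
    then show "continuous_map ?Q ?S f"
      by (simp add: continuous_map_in_subtopology top)
    have "continuous_map ?S P (f \<circ> inv_into X f)"
      by (rule continuous_map_eq[of _ _ id])
        (auto simp: topS f_inv_into_f intro: continuous_map_from_subtopology)
    then show "continuous_map ?S ?Q (inv_into X f)"
      by (intro continuous_map_pullback') (use topS inv_into_into[of _ f X] in auto)
    show "inv_into X f (f x) = x" if "x \<in> topspace ?Q" for x
      using that assms(3) top by simp
    show "f (inv_into X f y) = y" if "y \<in> topspace ?S" for y
      using that topS f_inv_into_f by metis
  qed
  then have "?Q homeomorphic_space ?S" by (rule homeomorphic_maps_imp_homeomorphic_space)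
  moreover have "completely_metrizable_space ?S"
    using assms by (intro completely_metrizable_space_gdelta_in)
  ultimately show ?thesis using homeomorphic_completely_metrizable_space by blast
qed

text \<open>Pull back along the graph of the characteristic function of F into the product with a
  discrete two-point space. The image is a closed set together with an open set, hence a
  G-delta.\<close>

lemma polish_closed_to_clopen:
  assumes "polish \<sigma>" "closedin \<sigma> F"
  obtains \<sigma>' where "polish \<sigma>'" "topspace \<sigma>' = topspace \<sigma>"
    "\<And>U. openin \<sigma>' U \<longleftrightarrow> (\<exists>V W. openin \<sigma> V \<and> openin \<sigma> W \<and> U = (V \<inter> F) \<union> (W - F))"
proof
  let ?X = "topspace \<sigma>" let ?f = "\<lambda>x. (x, x \<in> F)"
  let ?P = "prod_topology \<sigma> (discrete_topology (UNIV :: bool set))"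
  let ?\<sigma> = "pullback_topology ?X ?f ?P"
  have F: "F \<subseteq> ?X" using assms(2) closedin_subset by blast
  show top: "topspace ?\<sigma> = ?X" by (auto simp: topspace_pullback_topology)
  show op: "openin ?\<sigma> U \<longleftrightarrow> (\<exists>V W. openin \<sigma> V \<and> openin \<sigma> W \<and> U = (V \<inter> F) \<union> (W - F))" for U
  proof
    assume "openin ?\<sigma> U"
    then obtain T where T: "openin ?P T" "U = ?f -` T \<inter> ?X"
      unfolding openin_pullback_topology by blast
    have "openin \<sigma> {x \<in> ?X. (x, b) \<in> T}" for b
      by (rule openin_continuous_map_preimage[OF _ T(1)]) (intro continuous_map_pairedI; simp)
    moreover have "U = ({x \<in> ?X. (x, True) \<in> T} \<inter> F) \<union> ({x \<in> ?X. (x, False) \<in> T} - F)"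
      unfolding T(2)
    proof (rule set_eqI)
      fix x
      show "x \<in> ?f -` T \<inter> ?X \<longleftrightarrow>
          x \<in> ({x \<in> ?X. (x, True) \<in> T} \<inter> F) \<union> ({x \<in> ?X. (x, False) \<in> T} - F)"
        by (cases "x \<in> F") auto
    qed
    ultimately show "\<exists>V W. openin \<sigma> V \<and> openin \<sigma> W \<and> U = (V \<inter> F) \<union> (W - F)" by blast
  next
    assume "\<exists>V W. openin \<sigma> V \<and> openin \<sigma> W \<and> U = (V \<inter> F) \<union> (W - F)"
    then obtain V W where VW: "openin \<sigma> V" "openin \<sigma> W" "U = (V \<inter> F) \<union> (W - F)" by blast
    then have "V \<subseteq> ?X" "W \<subseteq> ?X" using openin_subset by blast+
    then have "U = ?f -` (V \<times> {True} \<union> W \<times> {False}) \<inter> ?X" unfolding VW by auto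
    moreover have "openin ?P (V \<times> {True} \<union> W \<times> {False})"
      using VW by (intro openin_Un) (auto simp: openin_prod_Times_iff)
    ultimately show "openin ?\<sigma> U" unfolding openin_pullback_topology by blast
  qed
  have "completely_metrizable_space ?P"
    using assms by (auto simp: completely_metrizable_space_prod_topology polish_def
        completely_metrizable_space_discrete_topology)
  moreover have "gdelta_in ?P (?f ` ?X)"
  proof -
    have "?f ` ?X = (F \<times> {True}) \<union> ((?X - F) \<times> {False})" using F by auto
    moreover have "gdelta_in ?P (F \<times> {True})"
      using \<open>completely_metrizable_space ?P\<close> assms(2)
      by (intro closed_imp_gdelta_in completely_metrizable_imp_metrizable_space)
        (auto simp: closedin_prod_Times_iff)
    moreover have "gdelta_in ?P ((?X - F) \<times> {False})"
      using assms(2) by (intro open_imp_gdelta_in) (auto simp: openin_prod_Times_iff)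
    ultimately show ?thesis by (simp add: gdelta_in_Un)
  qed
  moreover have "inj_on ?f ?X" by (auto simp: inj_on_def)
  ultimately have "completely_metrizable_space ?\<sigma>" by (rule completely_metrizable_space_pullback)
  moreover have "second_countable ?\<sigma>"
  proof -
    obtain \<B> where \<B>: "countable \<B>" "\<And>V. V \<in> \<B> \<Longrightarrow> openin \<sigma> V"
      "\<And>U x. openin \<sigma> U \<Longrightarrow> x \<in> U \<Longrightarrow> \<exists>V\<in>\<B>. x \<in> V \<and> V \<subseteq> U"
      using assms(1) unfolding polish_iff second_countable_def by metis
    let ?\<B> = "(\<lambda>V. V \<inter> F) ` \<B> \<union> (\<lambda>V. V - F) ` \<B>"
    have "openin ?\<sigma> V" if "V \<in> ?\<B>" for V
    proof -
      from that obtain W where W: "W \<in> \<B>" "V = W \<inter> F \<or> V = W - F" by blast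
      then have "V = (W \<inter> F) \<union> ({} - F) \<or> V = ({} \<inter> F) \<union> (W - F)" by blast
      with \<B>(2)[OF W(1)] show ?thesis unfolding op by (metis openin_empty)
    qed
    moreover have "\<exists>V\<in>?\<B>. x \<in> V \<and> V \<subseteq> U" if U: "openin ?\<sigma> U" and "x \<in> U" for U x
    proof -
      obtain V W where VW: "openin \<sigma> V" "openin \<sigma> W" "U = (V \<inter> F) \<union> (W - F)"
        using U unfolding op by blast
      show ?thesis
      proof (cases "x \<in> F")
        case True
        then have "x \<in> V" using VW \<open>x \<in> U\<close> by blast
        from \<B>(3)[OF VW(1) this] obtain B where "B \<in> \<B>" "x \<in> B" "B \<subseteq> V" by blast
        then show ?thesis using True VW(3) by (intro bexI[of _ "B \<inter> F"]) auto
      next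
        case False
        then have "x \<in> W" using VW \<open>x \<in> U\<close> by blast
        from \<B>(3)[OF VW(2) this] obtain B where "B \<in> \<B>" "x \<in> B" "B \<subseteq> W" by blast
        then show ?thesis using False VW(3) by (intro bexI[of _ "B - F"]) auto
      qed
    qed
    ultimately show ?thesis
      unfolding second_countable_def using \<B>(1)
      by (intro exI[of _ ?\<B>]) auto
  qed
  ultimately show "polish ?\<sigma>" by (simp add: polish_iff)
qed

text \<open>Pull back along the diagonal map into the product of all the topologies. The diagonal is
  closed there because the projections are continuous into the common coarser Hausdorff topology
  \<tau>.\<close>

lemma polish_join:
  fixes T :: "nat \<Rightarrow> 'a topology"
  assumes "Hausdorff_space \<tau>" "\<And>n. polish (T n)" "\<And>n. topspace (T n) = topspace \<tau>"
    "\<And>n U. openin \<tau> U \<Longrightarrow> openin (T n) U"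
  obtains \<sigma> where "polish \<sigma>" "topspace \<sigma> = topspace \<tau>" "\<And>n U. openin (T n) U \<Longrightarrow> openin \<sigma> U"
    "\<And>U x. openin \<sigma> U \<Longrightarrow> x \<in> U \<Longrightarrow>
      \<exists>N V. finite N \<and> (\<forall>n\<in>N. openin (T n) (V n)) \<and> x \<in> topspace \<tau> \<inter> (\<Inter>n\<in>N. V n) \<and>
        topspace \<tau> \<inter> (\<Inter>n\<in>N. V n) \<subseteq> U"
proof
  let ?X = "topspace \<tau>" let ?f = "\<lambda>x::'a. \<lambda>n::nat. x"
  let ?P = "product_topology T UNIV"
  let ?\<sigma> = "pullback_topology ?X ?f ?P"
  have topP: "topspace ?P = {y. \<forall>n. y n \<in> ?X}"
    by (auto simp: assms(3) PiE_iff)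
  show top: "topspace ?\<sigma> = ?X" by (auto simp: topspace_pullback_topology assms(3))
  show sub: "openin ?\<sigma> U" if "openin (T n) U" for n U
  proof -
    have "openin ?P {y \<in> topspace ?P. y n \<in> U}"
      using that by (intro openin_continuous_map_preimage[OF continuous_map_product_projection]) auto
    moreover have "U = ?f -` {y \<in> topspace ?P. y n \<in> U} \<inter> ?X"
      using openin_subset[OF that] by (auto simp: topP assms(3))
    ultimately show ?thesis unfolding openin_pullback_topology by blast
  qed
  show nbh: "\<exists>N V. finite N \<and> (\<forall>n\<in>N. openin (T n) (V n)) \<and> x \<in> topspace \<tau> \<inter> (\<Inter>n\<in>N. V n) \<and>
        topspace \<tau> \<inter> (\<Inter>n\<in>N. V n) \<subseteq> U" if "openin ?\<sigma> U" and x: "x \<in> U" for U x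
  proof -
    from that(1) obtain S where S: "openin ?P S" "U = ?f -` S \<inter> ?X"
      unfolding openin_pullback_topology by (elim exE conjE)
    with x have "?f x \<in> S" by simp
    then obtain V where V: "finite {i. V i \<noteq> topspace (T i)}" "\<And>i. openin (T i) (V i)"
      "\<And>i. x \<in> V i" "Pi\<^sub>E UNIV V \<subseteq> S"
      using S(1) unfolding openin_product_topology_alt by (auto simp: PiE_iff)
    let ?N = "{i. V i \<noteq> topspace (T i)}"
    have "?X \<inter> (\<Inter>n\<in>?N. V n) \<subseteq> U"
    proof
      fix y assume y: "y \<in> ?X \<inter> (\<Inter>n\<in>?N. V n)"
      then have "?f y \<in> Pi\<^sub>E UNIV V" using assms(3) by (auto simp: PiE_iff)
      then show "y \<in> U" using V(4) y unfolding S(2) by auto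
    qed
    moreover have "x \<in> ?X" using S(2) x by simp
    ultimately show ?thesis using V by (intro exI[of _ ?N] exI[of _ V]) auto
  qed
  have "completely_metrizable_space ?P"
    using assms(2) by (auto simp: completely_metrizable_space_product_topology polish_def)
  moreover have "gdelta_in ?P (?f ` ?X)"
  proof (rule closed_imp_gdelta_in)
    show "metrizable_space ?P"
      using calculation completely_metrizable_imp_metrizable_space by blast
    have cont: "continuous_map ?P \<tau> (\<lambda>y. y n)" for n
    proof -
      have "continuous_map (T n) \<tau> id"
        using assms(3,4) by (auto simp: continuous_map_def Collect_conj_eq Int_def[symmetric]
            Int_absorb1 openin_subset)
      then have "continuous_map ?P \<tau> (id \<circ> (\<lambda>y. y n))"
        by (rule continuous_map_compose[rotated]) (auto intro: continuous_map_product_projection)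
      then show ?thesis by (simp add: o_def)
    qed
    have "?f ` ?X = (\<Inter>n. {y \<in> topspace ?P. y n = y 0})"
    proof (intro equalityI subsetI)
      fix y assume "y \<in> ?f ` ?X"
      then show "y \<in> (\<Inter>n. {y \<in> topspace ?P. y n = y 0})" unfolding topP by auto
    next
      fix y assume y: "y \<in> (\<Inter>n. {y \<in> topspace ?P. y n = y 0})"
      then have "y = ?f (y 0)" "y 0 \<in> ?X" unfolding topP by (auto intro: ext)
      then show "y \<in> ?f ` ?X" by (rule image_eqI)
    qed
    also have "closedin ?P \<dots>"
      using closedin_continuous_maps_eq[OF assms(1) cont cont] by blast
    finally show "closedin ?P (?f ` ?X)" .
  qed
  moreover have "inj_on ?f ?X" by (auto simp: inj_on_def dest: fun_cong)
  ultimately have "completely_metrizable_space ?\<sigma>" by (rule completely_metrizable_space_pullback)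
  moreover have "second_countable ?\<sigma>"
  proof -
    have "\<exists>\<B>. countable \<B> \<and> (\<forall>V\<in>\<B>. openin (T n) V) \<and>
        (\<forall>U x. openin (T n) U \<and> x \<in> U \<longrightarrow> (\<exists>V\<in>\<B>. x \<in> V \<and> V \<subseteq> U))" for n
      using assms(2)[of n] unfolding polish_iff second_countable_def by blast
    then obtain \<B> where \<B>: "\<And>n. countable (\<B> n)" "\<And>n V. V \<in> \<B> n \<Longrightarrow> openin (T n) V"
      "\<And>n U x. openin (T n) U \<Longrightarrow> x \<in> U \<Longrightarrow> \<exists>V\<in>\<B> n. x \<in> V \<and> V \<subseteq> U"
      by metis
    let ?\<F> = "{\<F>. finite \<F> \<and> \<F> \<subseteq> (\<Union>n. \<B> n)}"
    let ?\<B> = "(\<lambda>\<F>. ?X \<inter> \<Inter>\<F>) ` ?\<F>"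
    have "countable ?\<B>" using \<B>(1) by (intro countable_image countable_Collect_finite_subset) auto
    moreover have "openin ?\<sigma> V" if V: "V \<in> ?\<B>" for V
    proof -
      obtain \<F> where F: "finite \<F>" "\<F> \<subseteq> (\<Union>n. \<B> n)" "V = ?X \<inter> \<Inter>\<F>" using V by blast
      have "openin ?\<sigma> W" if "W \<in> \<F>" for W using that F(2) \<B>(2) sub by blast
      then have "openin ?\<sigma> (\<Inter>(insert ?X \<F>))"
        using F(1) top by (intro openin_Inter) (auto, metis openin_topspace)
      then show ?thesis using F(3) by simp
    qed
    moreover have "\<exists>B\<in>?\<B>. x \<in> B \<and> B \<subseteq> U" if U: "openin ?\<sigma> U" "x \<in> U" for U x
    proof -
      from nbh[OF U] obtain N V where N: "finite N" "\<forall>n\<in>N. openin (T n) (V n)"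
        "x \<in> ?X \<inter> (\<Inter>n\<in>N. V n)" "?X \<inter> (\<Inter>n\<in>N. V n) \<subseteq> U"
        by (elim exE conjE)
      have "\<forall>n\<in>N. \<exists>B\<in>\<B> n. x \<in> B \<and> B \<subseteq> V n"
        using N(2,3) by (intro ballI \<B>(3)) auto
      then obtain B where B: "\<And>n. n \<in> N \<Longrightarrow> B n \<in> \<B> n \<and> x \<in> B n \<and> B n \<subseteq> V n" by metis
      have "B ` N \<in> ?\<F>" using B N(1) by auto
      moreover have "x \<in> ?X \<inter> \<Inter>(B ` N)" using N(3) B by auto
      moreover have "?X \<inter> \<Inter>(B ` N) \<subseteq> U" using N(4) B by fastforce
      ultimately show ?thesis by (intro bexI[of _ "?X \<inter> \<Inter>(B ` N)"] conjI imageI)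
    qed
    ultimately show ?thesis unfolding second_countable_def by (intro exI[of _ ?\<B>]) blast
  qed
  ultimately show "polish ?\<sigma>" by (simp add: polish_iff)
qed

lemma polish_imp_metrizable: "polish \<tau> \<Longrightarrow> metrizable_space \<tau>"
  by (simp add: polish_def completely_metrizable_imp_metrizable_space)

lemma polish_imp_Hausdorff: "polish \<tau> \<Longrightarrow> Hausdorff_space \<tau>"
  by (simp add: polish_imp_metrizable metrizable_imp_Hausdorff_space)

text \<open>Exactly the condition that \<open>Phi\<close> imposes on its auxiliary topology.\<close>

definition refining_topology :: "'a topology \<Rightarrow> ordinal \<Rightarrow> 'a topology \<Rightarrow> bool" where
  "refining_topology \<tau> \<xi> \<sigma> \<longleftrightarrow> polish \<sigma> \<and> topspace \<sigma> = topspace \<tau> \<and> (\<forall>U. openin \<tau> U \<longrightarrow> openin \<sigma> U) \<and>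
     (\<forall>U. openin \<sigma> U \<longrightarrow> Sigma0 \<tau> \<xi> U)"

lemma refining_topology_join:
  assumes "polish \<tau>" "1 \<le> \<xi>" "\<And>n::nat. refining_topology \<tau> \<xi> (T n)"
  obtains \<sigma> where "refining_topology \<tau> \<xi> \<sigma>" "\<And>n U. openin (T n) U \<Longrightarrow> openin \<sigma> U"
proof -
  have "polish (T n)" "topspace (T n) = topspace \<tau>" "openin \<tau> U \<Longrightarrow> openin (T n) U" for n U
    using assms(3) unfolding refining_topology_def by blast+
  note T = this
  obtain \<sigma> where \<sigma>: "polish \<sigma>" "topspace \<sigma> = topspace \<tau>" "\<And>n U. openin (T n) U \<Longrightarrow> openin \<sigma> U"
    "\<And>U x. openin \<sigma> U \<Longrightarrow> x \<in> U \<Longrightarrow>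
      \<exists>N V. finite N \<and> (\<forall>n\<in>N. openin (T n) (V n)) \<and> x \<in> topspace \<tau> \<inter> (\<Inter>n\<in>N. V n) \<and>
        topspace \<tau> \<inter> (\<Inter>n\<in>N. V n) \<subseteq> U"
    using polish_join[of \<tau> T, OF polish_imp_Hausdorff[OF assms(1)] T] by metis
  have "Sigma0 \<tau> \<xi> U" if U: "openin \<sigma> U" for U
  proof (rule Sigma0_if_local[OF polish_imp_metrizable[OF assms(1)] assms(2) _ U])
    show "second_countable \<sigma>" using \<sigma>(1) by (simp add: polish_iff)
    fix x assume "x \<in> U"
    from \<sigma>(4)[OF U this] obtain N V where N: "finite N" "\<forall>n\<in>N. openin (T n) (V n)"
      "x \<in> topspace \<tau> \<inter> (\<Inter>n\<in>N. V n)" "topspace \<tau> \<inter> (\<Inter>n\<in>N. V n) \<subseteq> U"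
      by (elim exE conjE)
    have "Sigma0 \<tau> \<xi> (topspace \<tau> \<inter> (\<Inter>n\<in>N. V n))"
      using N assms by (intro Sigma0_finite_Inter polish_imp_metrizable) (auto simp: refining_topology_def)
    moreover have "openin \<sigma> (\<Inter>(insert (topspace \<tau>) (V ` N)))"
      using N \<sigma>(3) openin_topspace[of \<sigma>] \<sigma>(2) by (intro openin_Inter) auto
    ultimately show "\<exists>V. openin \<sigma> V \<and> Sigma0 \<tau> \<xi> V \<and> x \<in> V \<and> V \<subseteq> U"
      using N by (intro exI[of _ "topspace \<tau> \<inter> (\<Inter>n\<in>N. V n)"]) auto
  qed
  then have "refining_topology \<tau> \<xi> \<sigma>"
    unfolding refining_topology_def using \<sigma>(1,2) \<sigma>(3)[OF T(3)] by simp
  then show thesis using \<sigma>(3) by (rule that)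
qed

lemma refining_topology_self: "polish \<tau> \<Longrightarrow> 1 \<le> \<xi> \<Longrightarrow> refining_topology \<tau> \<xi> \<tau>"
  unfolding refining_topology_def using Sigma0_mono[of \<tau> 1] polish_imp_metrizable by auto

text \<open>Write A as a union of sets in \<open>Pi0 \<tau> \<eta>\<close> with \<eta> < \<xi>. By
  induction each is closed in some refinement of class \<eta>; making it clopen adds only sets of
  \<open>Sigma0 \<tau> \<xi>\<close>, since both the set and its complement are in that class. The
  join of these refinements makes A open.\<close>

lemma ex_refining_topology_open:
  assumes "polish \<tau>"
  shows "Sigma0 \<tau> \<xi> A \<Longrightarrow> \<exists>\<sigma>. refining_topology \<tau> \<xi> \<sigma> \<and> openin \<sigma> A"
proof (induction \<xi> arbitrary: A rule: less_induct)
  case (less \<xi>)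
  note metr = polish_imp_metrizable[OF assms]
  have \<xi>: "1 \<le> \<xi>" using less.prems Sigma0_ge_1 by blast
  show ?case
  proof (cases "\<xi> = 1")
    case True
    with less.prems assms show ?thesis by (intro exI[of _ \<tau>]) (auto simp: refining_topology_self)
  next
    case False
    with \<xi> have "1 < \<xi>" by simp
    from Sigma0E_Pi0[OF less.prems this] obtain C
      where C: "A = (\<Union>n::nat. C n)" "\<And>n. \<exists>\<eta><\<xi>. Pi0 \<tau> \<eta> (C n)" by metis
    have "\<exists>\<sigma>. refining_topology \<tau> \<xi> \<sigma> \<and> openin \<sigma> (C n)" for n
    proof -
      obtain \<eta> where \<eta>: "\<eta> < \<xi>" "Pi0 \<tau> \<eta> (C n)" using C(2) by blast
      then obtain \<sigma> where \<sigma>: "refining_topology \<tau> \<eta> \<sigma>" "openin \<sigma> (topspace \<tau> - C n)"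
        using less.IH[OF \<eta>(1) Sigma0_compl_Pi0] by blast
      have topeq: "topspace \<sigma> = topspace \<tau>" and "polish \<sigma>" using \<sigma>(1) by (auto simp: refining_topology_def)
      have cl: "closedin \<sigma> (C n)"
        using \<sigma>(2) Pi0_subset[OF \<eta>(2)] topeq by (simp add: closedin_def)
      obtain \<sigma>' where \<sigma>': "polish \<sigma>'" "topspace \<sigma>' = topspace \<sigma>"
        "\<And>U. openin \<sigma>' U \<longleftrightarrow> (\<exists>V W. openin \<sigma> V \<and> openin \<sigma> W \<and> U = (V \<inter> C n) \<union> (W - C n))"
        using polish_closed_to_clopen[OF \<open>polish \<sigma>\<close> cl] by metis
      have "Sigma0 \<tau> \<xi> U" if U: "openin \<sigma>' U" for U
      proof -
        obtain V W where VW: "openin \<sigma> V" "openin \<sigma> W" "U = (V \<inter> C n) \<union> (W - C n)"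
          using U \<sigma>'(3) by blast
        have "Sigma0 \<tau> \<xi> S" if "openin \<sigma> S" for S
          using \<sigma>(1) that Sigma0_mono[OF metr _ less_imp_le[OF \<eta>(1)]] unfolding refining_topology_def by blast
        moreover have "openin \<sigma> (W - C n)" using VW cl by (intro openin_diff)
        moreover have "Sigma0 \<tau> \<xi> (C n)" by (rule Pi0_imp_Sigma0[OF \<eta>(2,1)])
        ultimately show ?thesis unfolding VW(3) using VW by (intro Sigma0_Un Sigma0_Int metr) auto
      qed
      moreover have "openin \<sigma>' U" if "openin \<tau> U" for U
      proof -
        have "openin \<sigma> U" using that \<sigma>(1) by (auto simp: refining_topology_def)
        moreover have "U = (U \<inter> C n) \<union> (U - C n)" by blast
        ultimately show ?thesis using \<sigma>'(3) by blast
      qed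
      moreover have "openin \<sigma>' (C n)"
      proof -
        have "C n = (topspace \<sigma> \<inter> C n) \<union> ({} - C n)" using Pi0_subset[OF \<eta>(2)] topeq by blast
        then show ?thesis using \<sigma>'(3) openin_topspace[of \<sigma>] openin_empty[of \<sigma>] by blast
      qed
      ultimately show ?thesis using \<sigma>' topeq unfolding refining_topology_def by (intro exI[of _ \<sigma>']) auto
    qed
    then obtain T where T: "\<And>n. refining_topology \<tau> \<xi> (T n)" "\<And>n. openin (T n) (C n)" by metis
    obtain \<sigma> where "refining_topology \<tau> \<xi> \<sigma>" "\<And>n U. openin (T n) U \<Longrightarrow> openin \<sigma> U"
      using refining_topology_join[of \<tau> \<xi> T, OF assms \<xi> T(1)] by metis
    with T(2) C(1) show ?thesis by (intro exI[of _ \<sigma>]) auto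
  qed
qed

text \<open>Closedness is the most one can ask for a general \<open>Pi0 \<tau> \<xi>\<close> set, as
  open sets of \<sigma> must stay in \<open>Sigma0 \<tau> \<xi>\<close>.\<close>

lemma ex_refining_topology_closed:
  assumes "polish \<tau>" "refining_topology \<tau> \<xi> \<tau>'" "1 \<le> \<xi>" "countable \<P>" "\<And>P. P \<in> \<P> \<Longrightarrow> Pi0 \<tau> \<xi> P"
  obtains \<sigma> where "refining_topology \<tau> \<xi> \<sigma>" "\<And>U. openin \<tau>' U \<Longrightarrow> openin \<sigma> U" "\<And>P. P \<in> \<P> \<Longrightarrow> closedin \<sigma> P"
proof (cases "\<P> = {}")
  case True
  then show ?thesis using that[of \<tau>'] assms by simp
next
  case False
  define P where "P = from_nat_into \<P>"
  have P: "range P = \<P>" unfolding P_def using False assms(4) by (rule range_from_nat_into)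
  have "\<exists>\<sigma>. refining_topology \<tau> \<xi> \<sigma> \<and> openin \<sigma> (topspace \<tau> - P n)" for n
    using P assms(5) by (intro ex_refining_topology_open[OF assms(1)] Sigma0_compl_Pi0) auto
  then obtain T where T: "\<And>n. refining_topology \<tau> \<xi> (T n)" "\<And>n. openin (T n) (topspace \<tau> - P n)" by metis
  \<comment> \<open>Slot 0 of the joined sequence holds the given topology \<tau>', so that the
    result refines it as well.\<close>
  have "refining_topology \<tau> \<xi> (case n of 0 \<Rightarrow> \<tau>' | Suc m \<Rightarrow> T m)" for n
    using T assms(2) by (auto split: nat.splits)
  then obtain \<sigma> where \<sigma>: "refining_topology \<tau> \<xi> \<sigma>"
    "\<And>n U. openin (case n of 0 \<Rightarrow> \<tau>' | Suc m \<Rightarrow> T m) U \<Longrightarrow> openin \<sigma> U"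
    using refining_topology_join[of \<tau> \<xi> "\<lambda>n. case n of 0 \<Rightarrow> \<tau>' | Suc m \<Rightarrow> T m", OF assms(1,3)] by metis
  have "closedin \<sigma> Q" if "Q \<in> \<P>" for Q
  proof -
    obtain n where "Q = P n" using P \<open>Q \<in> \<P>\<close> by blast
    moreover have "openin \<sigma> (topspace \<tau> - P n)" using \<sigma>(2)[of "Suc n"] T(2) by simp
    ultimately show ?thesis
      using Pi0_subset[OF assms(5)[OF that]] \<sigma>(1) by (simp add: closedin_def refining_topology_def)
  qed
  then show ?thesis using that[of \<sigma>] \<sigma> \<sigma>(2)[of 0] by simp
qed

subsection \<open>Baire classes\<close>

lemma baire_ge_1: "baire \<tau> \<xi> f \<Longrightarrow> 1 \<le> \<xi>"
  by (cases rule: baire.cases) auto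

lemma baire_cong:
  assumes "baire \<tau> \<xi> f" "\<And>x. x \<in> topspace \<tau> \<Longrightarrow> f x = g x"
  shows "baire \<tau> \<xi> g"
  using assms(1)
proof (cases rule: baire.cases)
  case (1 h)
  then show ?thesis using assms(2) by (auto intro!: baire.intros(1)[of _ h])
next
  case (2 h)
  then show ?thesis using assms(2) by (auto intro!: baire.intros(2)[of _ _ h])
qed

lemma baire_limI:
  assumes "1 < \<xi>" "\<And>n::nat. \<exists>\<eta><\<xi>. baire \<tau> \<eta> (g n)"
    "\<And>x. x \<in> topspace \<tau> \<Longrightarrow> (\<lambda>n. g n x) \<longlonglongrightarrow> f x"
  shows "baire \<tau> \<xi> f"
  using assms by (intro baire.intros(2)[of \<xi> \<tau> g]) auto

lemma baire_mono:
  assumes "baire \<tau> \<eta> f" "\<eta> \<le> \<xi>"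
  shows "baire \<tau> \<xi> f"
proof (cases "\<eta> = \<xi>")
  case False
  then have "\<eta> < \<xi>" "1 < \<xi>" using assms baire_ge_1[OF assms(1)] by auto
  then show ?thesis using assms(1) by (intro baire_limI[of \<xi> _ "\<lambda>n. f"]) auto
qed (use assms in simp)

lemma baire_const:
  assumes "1 \<le> \<xi>"
  shows "baire \<tau> \<xi> (\<lambda>x. c)"
  by (rule baire_mono[OF baire.intros(1)[of _ "\<lambda>n x. c"] assms]) auto

lemma baire_compose2:
  fixes h :: "real \<times> real \<Rightarrow> real"
  assumes h: "continuous_on UNIV h"
  shows "baire \<tau> \<xi> f \<Longrightarrow> baire \<tau> \<xi> g \<Longrightarrow> baire \<tau> \<xi> (\<lambda>x. h (f x, g x))"
proof (induction \<xi> arbitrary: f g rule: less_induct)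
  case (less \<xi>)
  have tends: "(\<lambda>n. h (u n, v n)) \<longlonglongrightarrow> h (a, b)" if "u \<longlonglongrightarrow> a" "v \<longlonglongrightarrow> b" for u v a b
  proof -
    have "isCont h (a, b)" using h by (simp add: continuous_on_eq_continuous_at)
    then show ?thesis using tendsto_Pair[OF that] by (rule isCont_tendsto_compose)
  qed
  show ?case
  proof (cases "\<xi> = 1")
    case True
    obtain u where u: "\<forall>n::nat. continuous_map \<tau> euclideanreal (u n)"
      "\<forall>x\<in>topspace \<tau>. (\<lambda>n. u n x) \<longlonglongrightarrow> f x"
      using less.prems(1) True by (auto elim: baire.cases)
    obtain v where v: "\<forall>n::nat. continuous_map \<tau> euclideanreal (v n)"
      "\<forall>x\<in>topspace \<tau>. (\<lambda>n. v n x) \<longlonglongrightarrow> g x"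
      using less.prems(2) True by (auto elim: baire.cases)
    have "continuous_map \<tau> euclideanreal (h \<circ> (\<lambda>x. (u n x, v n x)))" for n
    proof (rule continuous_map_compose)
      show "continuous_map \<tau> (prod_topology euclideanreal euclideanreal) (\<lambda>x. (u n x, v n x))"
        using u v by (intro continuous_map_pairedI) auto
      show "continuous_map (prod_topology euclideanreal euclideanreal) euclideanreal h"
        using h by (simp add: euclidean_product_topology)
    qed
    then show ?thesis unfolding True
      using u v tends by (intro baire.intros(1)[of _ "\<lambda>n x. h (u n x, v n x)"]) (auto simp: o_def)
  next
    case False
    then have \<xi>: "1 < \<xi>" using baire_ge_1[OF less.prems(1)] by simp
    obtain u where u: "\<forall>n::nat. \<exists>\<eta><\<xi>. baire \<tau> \<eta> (u n)"
      "\<forall>x\<in>topspace \<tau>. (\<lambda>n. u n x) \<longlonglongrightarrow> f x"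
      using less.prems(1) False by (auto elim: baire.cases)
    obtain v where v: "\<forall>n::nat. \<exists>\<eta><\<xi>. baire \<tau> \<eta> (v n)"
      "\<forall>x\<in>topspace \<tau>. (\<lambda>n. v n x) \<longlonglongrightarrow> g x"
      using less.prems(2) False by (auto elim: baire.cases)
    have "\<exists>\<eta><\<xi>. baire \<tau> \<eta> (\<lambda>x. h (u n x, v n x))" for n
    proof -
      obtain \<eta> \<zeta> where *: "\<eta> < \<xi>" "\<zeta> < \<xi>" "baire \<tau> \<eta> (u n)" "baire \<tau> \<zeta> (v n)" using u v by metis
      then have "baire \<tau> (max \<eta> \<zeta>) (u n)" "baire \<tau> (max \<eta> \<zeta>) (v n)"
        by (auto intro: baire_mono)
      with * less.IH[of "max \<eta> \<zeta>"] show ?thesis by (intro exI[of _ "max \<eta> \<zeta>"]) auto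
    qed
    then show ?thesis
      using u v tends \<xi> by (intro baire_limI[of _ _ "\<lambda>n x. h (u n x, v n x)"]) auto
  qed
qed

lemma baire_add: "baire \<tau> \<xi> f \<Longrightarrow> baire \<tau> \<xi> g \<Longrightarrow> baire \<tau> \<xi> (\<lambda>x. f x + g x)"
  using baire_compose2[of "\<lambda>p. fst p + snd p"] by (simp add: continuous_intros)

lemma baire_diff: "baire \<tau> \<xi> f \<Longrightarrow> baire \<tau> \<xi> g \<Longrightarrow> baire \<tau> \<xi> (\<lambda>x. f x - g x)"
  using baire_compose2[of "\<lambda>p. fst p - snd p"] by (simp add: continuous_intros)

lemma baire_mult: "baire \<tau> \<xi> f \<Longrightarrow> baire \<tau> \<xi> g \<Longrightarrow> baire \<tau> \<xi> (\<lambda>x. f x * g x)"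
  using baire_compose2[of "\<lambda>p. fst p * snd p"] by (simp add: continuous_intros)

text \<open>Working with indicators reduces Boolean operations to sums and products of Baire
  functions of the same class.\<close>

definition baire_set :: "'a topology \<Rightarrow> ordinal \<Rightarrow> 'a set \<Rightarrow> bool" where
  "baire_set \<tau> \<xi> A \<longleftrightarrow> baire \<tau> \<xi> (indicat_real A)"

lemma baire_set_mono: "baire_set \<tau> \<eta> A \<Longrightarrow> \<eta> \<le> \<xi> \<Longrightarrow> baire_set \<tau> \<xi> A"
  unfolding baire_set_def by (rule baire_mono)

lemma baire_set_compl:
  assumes "baire_set \<tau> \<xi> A"
  shows "baire_set \<tau> \<xi> (topspace \<tau> - A)"
proof -
  have A: "baire \<tau> \<xi> (indicat_real A)" using assms by (simp add: baire_set_def)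
  have "baire \<tau> \<xi> (\<lambda>x. 1 - indicat_real A x)"
    by (intro baire_diff A baire_const baire_ge_1[OF A])
  then show ?thesis unfolding baire_set_def
    by (rule baire_cong) (simp add: indicator_def)
qed

lemma baire_set_Int:
  assumes "baire_set \<tau> \<xi> A" "baire_set \<tau> \<xi> B"
  shows "baire_set \<tau> \<xi> (A \<inter> B)"
  using baire_mult[of \<tau> \<xi> "indicat_real A" "indicat_real B"] assms
  unfolding baire_set_def indicator_inter_arith[symmetric] by simp

lemma baire_set_Un:
  assumes "baire_set \<tau> \<xi> A" "baire_set \<tau> \<xi> B"
  shows "baire_set \<tau> \<xi> (A \<union> B)"
proof -
  have "baire_set \<tau> \<xi> (topspace \<tau> - (topspace \<tau> - A) \<inter> (topspace \<tau> - B))"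
    using assms by (intro baire_set_compl baire_set_Int)
  then show ?thesis unfolding baire_set_def
    by (rule baire_cong) (auto simp: indicator_def)
qed

lemma baire_set_below_Un:
  assumes "\<exists>\<eta><\<xi>. baire_set \<tau> \<eta> A" "\<exists>\<eta><\<xi>. baire_set \<tau> \<eta> B"
  shows "\<exists>\<eta><\<xi>. baire_set \<tau> \<eta> (A \<union> B)"
proof -
  obtain \<eta> \<zeta> where *: "\<eta> < \<xi>" "\<zeta> < \<xi>" "baire_set \<tau> \<eta> A" "baire_set \<tau> \<zeta> B" using assms by blast
  then have "baire_set \<tau> (max \<eta> \<zeta>) (A \<union> B)"
    by (intro baire_set_Un) (auto intro: baire_set_mono)
  with * show ?thesis by (intro exI[of _ "max \<eta> \<zeta>"]) auto
qed

lemma baire_set_below_compl: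
  "\<exists>\<eta><\<xi>. baire_set \<tau> \<eta> A \<Longrightarrow> \<exists>\<eta><\<xi>. baire_set \<tau> \<eta> (topspace \<tau> - A)"
  using baire_set_compl by blast

lemma baire_set_below_UN:
  assumes "\<And>i. i \<le> (n::nat) \<Longrightarrow> \<exists>\<eta><\<xi>. baire_set \<tau> \<eta> (A i)"
  shows "\<exists>\<eta><\<xi>. baire_set \<tau> \<eta> (\<Union>i\<le>n. A i)"
  using assms
proof (induction n)
  case (Suc n)
  have "(\<Union>i\<le>Suc n. A i) = (\<Union>i\<le>n. A i) \<union> A (Suc n)" by (auto simp: le_Suc_eq)
  with Suc show ?case by (simp add: baire_set_below_Un)
qed simp

text \<open>Urysohn functions equal to 1 on C n and 0 on E n converge to the indicator: by
  monotonicity every point stays in one of the two sequences from some index on.\<close>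

lemma baire_set_1:
  assumes "metrizable_space \<tau>" "A = (\<Union>n::nat. C n)" "topspace \<tau> - A = (\<Union>n::nat. E n)"
    "\<And>n. closedin \<tau> (C n)" "\<And>n. closedin \<tau> (E n)" "incseq C" "incseq E"
  shows "baire_set \<tau> 1 A"
proof -
  have "\<exists>f. continuous_map \<tau> euclideanreal f \<and> f ` C n \<subseteq> {1} \<and> f ` E n \<subseteq> {0}" for n
  proof -
    have "C n \<subseteq> A" using assms(2) by blast
    moreover have "E n \<subseteq> topspace \<tau> - A" unfolding assms(3) by blast
    ultimately have "disjnt (C n) (E n)" by (auto simp: disjnt_def)
    then show ?thesis
      using Urysohn_lemma_alt[OF metrizable_imp_normal_space[OF assms(1)] assms(4,5)[of n]] by metis
  qed
  then obtain f where f: "\<And>n. continuous_map \<tau> euclideanreal (f n)" "\<And>n. f n ` C n \<subseteq> {1::real}"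
    "\<And>n. f n ` E n \<subseteq> {0}" by metis
  show ?thesis unfolding baire_set_def
  proof (rule baire.intros(1)[of _ f], safe)
    fix x assume x: "x \<in> topspace \<tau>"
    have "\<forall>\<^sub>F n in sequentially. f n x = indicat_real A x"
    proof (cases "x \<in> A")
      case True
      then obtain N where "x \<in> C N" using assms(2) by blast
      then have "f n x = indicat_real A x" if "n \<ge> N" for n
        using f(2)[of n] True incseqD[OF assms(6) that] by auto
      then show ?thesis unfolding eventually_sequentially by blast
    next
      case False
      then have "x \<in> (\<Union>n. E n)" using x assms(3) by blast
      then obtain N where "x \<in> E N" by blast
      then have "f n x = indicat_real A x" if "n \<ge> N" for n
        using f(3)[of n] False incseqD[OF assms(7) that] by auto
      then show ?thesis unfolding eventually_sequentially by blast
    qed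
    then show "(\<lambda>n. f n x) \<longlonglongrightarrow> indicat_real A x" by (rule tendsto_eventually)
  qed (rule f(1))
qed

lemma tendsto_indicatorI:
  assumes "x \<in> A \<Longrightarrow> \<forall>\<^sub>F n in sequentially. x \<in> B n" "x \<notin> A \<Longrightarrow> \<forall>\<^sub>F n in sequentially. x \<notin> B n"
  shows "(\<lambda>n. indicat_real (B n) x) \<longlonglongrightarrow> indicat_real A x"
proof (cases "x \<in> A")
  case True
  with assms(1) have "\<forall>\<^sub>F n in sequentially. indicat_real (B n) x = indicat_real A x"
    by (auto elim!: eventually_mono)
  then show ?thesis by (rule tendsto_eventually)
next
  case False
  with assms(2) have "\<forall>\<^sub>F n in sequentially. indicat_real (B n) x = indicat_real A x"
    by (auto elim!: eventually_mono)
  then show ?thesis by (rule tendsto_eventually)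
qed

lemma baire_set_if_Sigma0:
  assumes metr: "metrizable_space \<tau>"
  shows "Sigma0 \<tau> \<xi> A \<Longrightarrow> baire_set \<tau> \<xi> A"
proof (induction \<xi> arbitrary: A rule: less_induct)
  case (less \<xi>)
  show ?case
  proof (cases "\<xi> = 1")
    case True
    with less.prems have op: "openin \<tau> A" by simp
    then obtain C where C: "\<And>n. closedin \<tau> (C n)" "\<And>n::nat. C n \<subseteq> C (Suc n)" "(\<Union>n. C n) = A"
      using open_imp_fsigma_in[OF metr] unfolding fsigma_in_ascending by blast
    show ?thesis unfolding True
      by (rule baire_set_1[OF metr, of _ C "\<lambda>n. topspace \<tau> - A"])
        (use C op in \<open>auto simp: incseq_Suc_iff\<close>)
  next
    case False
    then have \<xi>: "1 < \<xi>" using Sigma0_ge_1[OF less.prems] by simp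
    from Sigma0E_Pi0[OF less.prems this] obtain C
      where C: "A = (\<Union>n::nat. C n)" "\<And>n. \<exists>\<eta><\<xi>. Pi0 \<tau> \<eta> (C n)" by metis
    have "\<exists>\<eta><\<xi>. baire_set \<tau> \<eta> (C n)" for n
    proof -
      obtain \<eta> where \<eta>: "\<eta> < \<xi>" "Pi0 \<tau> \<eta> (C n)" using C(2) by blast
      then have "baire_set \<tau> \<eta> (topspace \<tau> - (topspace \<tau> - C n))"
        using less.IH Sigma0_compl_Pi0 baire_set_compl by blast
      with \<eta> show ?thesis by (auto simp: double_diff Pi0_subset)
    qed
    then have "\<exists>\<eta><\<xi>. baire_set \<tau> \<eta> (\<Union>i\<le>n. C i)" for n by (intro baire_set_below_UN)
    then show ?thesis unfolding baire_set_def
    proof (rule baire_limI[OF \<xi>])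
      fix x
      show "(\<lambda>n. indicat_real (\<Union>i\<le>n. C i) x) \<longlonglongrightarrow> indicat_real A x"
      proof (rule tendsto_indicatorI)
        assume "x \<in> A"
        then obtain i where "x \<in> C i" using C(1) by blast
        then have "x \<in> (\<Union>i\<le>n. C i)" if "n \<ge> i" for n using that by blast
        then show "\<forall>\<^sub>F n in sequentially. x \<in> (\<Union>i\<le>n. C i)"
          unfolding eventually_sequentially by blast
      qed (use C(1) in auto)
    qed
  qed
qed

lemma baire_set_below_if_Pi0:
  assumes "metrizable_space \<tau>" "Pi0 \<tau> \<eta> A" "\<eta> < \<xi>"
  shows "\<exists>\<eta><\<xi>. baire_set \<tau> \<eta> A"
proof -
  have "baire_set \<tau> \<eta> (topspace \<tau> - (topspace \<tau> - A))"
    using assms by (intro baire_set_compl baire_set_if_Sigma0 Sigma0_compl_Pi0)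
  with assms show ?thesis by (auto simp: double_diff Pi0_subset)
qed

text \<open>For \<xi> > 1 both A and its complement are unions of \<open>Pi0 \<tau> \<xi>\<close>
  sets, and each of these is a decreasing intersection of sets of lower Baire class. At stage m one
  only sees the m-th approximations; a priority rule among the pieces decides on which side a point
  is put.\<close>

lemma baire_set_if_Sigma0_succ:
  assumes metr: "metrizable_space \<tau>" and "1 \<le> \<xi>"
    and A: "Sigma0 \<tau> (succ \<xi>) A" "Sigma0 \<tau> (succ \<xi>) (topspace \<tau> - A)"
  shows "baire_set \<tau> \<xi> A"
proof -
  obtain C where C: "A = (\<Union>n::nat. C n)" "\<And>n. Pi0 \<tau> \<xi> (C n)" "incseq C"
    using Sigma0_succE[OF metr A(1) \<open>1 \<le> \<xi>\<close>] by metis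
  obtain E where E: "topspace \<tau> - A = (\<Union>n::nat. E n)" "\<And>n. Pi0 \<tau> \<xi> (E n)" "incseq E"
    using Sigma0_succE[OF metr A(2) \<open>1 \<le> \<xi>\<close>] by metis
  show ?thesis
  proof (cases "\<xi> = 1")
    case True
    then show ?thesis using baire_set_1[OF metr C(1) E(1) _ _ C(3) E(3)] C(2) E(2) by simp
  next
    case False
    with \<open>1 \<le> \<xi>\<close> have \<xi>: "1 < \<xi>" by simp
    have approx: "\<exists>D. decseq D \<and> (\<Inter>m. D m) = P \<and> (\<forall>m::nat. \<exists>\<eta><\<xi>. baire_set \<tau> \<eta> (D m))"
      if P: "Pi0 \<tau> \<xi> P" for P
    proof -
      from Sigma0E_Pi0[OF Sigma0_compl_Pi0[OF P] \<xi>] obtain Q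
        where Q: "topspace \<tau> - P = (\<Union>n::nat. Q n)" "\<And>n. \<exists>\<eta><\<xi>. Pi0 \<tau> \<eta> (Q n)" by metis
      have "\<exists>\<eta><\<xi>. baire_set \<tau> \<eta> (topspace \<tau> - (\<Union>i\<le>m. Q i))" for m
        using Q(2) baire_set_below_if_Pi0[OF metr]
        by (intro baire_set_below_compl baire_set_below_UN) blast
      moreover have "(\<Inter>m. topspace \<tau> - (\<Union>i\<le>m. Q i)) = P"
      proof -
        have "(\<Inter>m. topspace \<tau> - (\<Union>i\<le>m. Q i)) = topspace \<tau> - (\<Union>n. Q n)" by auto
        also have "\<dots> = P" unfolding Q(1)[symmetric] using Pi0_subset[OF P] by blast
        finally show ?thesis .
      qed
      moreover have "decseq (\<lambda>m. topspace \<tau> - (\<Union>i\<le>m. Q i))"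
        by (auto simp: decseq_def)
      ultimately show ?thesis by (intro exI[of _ "\<lambda>m. topspace \<tau> - (\<Union>i\<le>m. Q i)"]) simp
    qed
    obtain c where c: "\<And>n. decseq (c n)" "\<And>n. (\<Inter>m. c n m) = C n"
      "\<And>n m. \<exists>\<eta><\<xi>. baire_set \<tau> \<eta> (c n m)"
      using approx[OF C(2)] by metis
    obtain e where e: "\<And>n. decseq (e n)" "\<And>n. (\<Inter>m. e n m) = E n"
      "\<And>n m. \<exists>\<eta><\<xi>. baire_set \<tau> \<eta> (e n m)"
      using approx[OF E(2)] by metis
    \<comment> \<open>At stage m the piece C n claims x if its approximation contains x and no
      approximation of an E i with i < n does. A point of C n is eventually released by those
      finitely many e i. A point of E k blocks all n > k at every stage and is eventually released
      by c i for i \<le> k. The empty set in the union encodes the strict bound i < n, also for n =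
      0.\<close>
    define K where "K m n = topspace \<tau> - ((topspace \<tau> - c n m) \<union> (\<Union>i\<le>n. if i < n then e i m else {}))"
      for m n
    have K_iff: "x \<in> K m n \<longleftrightarrow> x \<in> c n m \<and> (\<forall>i<n. x \<notin> e i m)" if "x \<in> topspace \<tau>" for x m n
      using that by (auto simp: K_def split: if_splits)
    have empty: "\<exists>\<eta><\<xi>. baire_set \<tau> \<eta> {}"
    proof -
      have "baire_set \<tau> 1 {}"
        by (simp add: baire_set_def indicator_def[abs_def] baire_const)
      with \<xi> show ?thesis by blast
    qed
    have "\<exists>\<eta><\<xi>. baire_set \<tau> \<eta> (K m n)" for m n
      unfolding K_def
      by (intro baire_set_below_compl baire_set_below_Un baire_set_below_UN c(3))
        (use e(3) empty in auto)
    then have "\<exists>\<eta><\<xi>. baire_set \<tau> \<eta> (\<Union>n\<le>m. K m n)" for m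
      by (intro baire_set_below_UN)
    then show ?thesis unfolding baire_set_def
    proof (rule baire_limI[OF \<xi>])
      fix x assume x: "x \<in> topspace \<tau>"
      have out: "\<forall>\<^sub>F m in sequentially. x \<notin> D m" if D: "decseq D" "x \<notin> (\<Inter>m. D m)" for D
      proof -
        obtain k where k: "x \<notin> D k" using D(2) by blast
        have "x \<notin> D m" if "k \<le> m" for m using decseqD[OF D(1) that] k by blast
        then show ?thesis unfolding eventually_sequentially by blast
      qed
      show "(\<lambda>m. indicat_real (\<Union>n\<le>m. K m n) x) \<longlonglongrightarrow> indicat_real A x"
      proof (rule tendsto_indicatorI)
        assume "x \<in> A"
        then obtain n where n: "x \<in> C n" using C(1) by blast
        have "x \<notin> E i" for i using \<open>x \<in> A\<close> E(1) by blast
        then have "\<forall>\<^sub>F m in sequentially. x \<notin> e i m" for i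
          using out[OF e(1)[of i]] e(2)[of i] by simp
        then have "\<forall>\<^sub>F m in sequentially. \<forall>i\<in>{..<n}. x \<notin> e i m"
          by (intro eventually_ball_finite) auto
        then show "\<forall>\<^sub>F m in sequentially. x \<in> (\<Union>n\<le>m. K m n)"
          using eventually_ge_at_top[of n]
        proof eventually_elim
          case (elim m)
          then have "x \<in> K m n" unfolding K_iff[OF x] using n c(2)[of n] by auto
          with elim show ?case by blast
        qed
      next
        assume "x \<notin> A"
        then have "x \<in> (\<Union>n. E n)" using x E(1) by blast
        then obtain k where k: "x \<in> E k" by blast
        have "x \<notin> C i" for i using \<open>x \<notin> A\<close> C(1) by blast
        then have "\<forall>\<^sub>F m in sequentially. x \<notin> c i m" for i
          using out[OF c(1)[of i]] c(2)[of i] by simp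
        then have "\<forall>\<^sub>F m in sequentially. \<forall>i\<in>{..k}. x \<notin> c i m"
          by (intro eventually_ball_finite) auto
        then show "\<forall>\<^sub>F m in sequentially. x \<notin> (\<Union>n\<le>m. K m n)"
        proof eventually_elim
          case (elim m)
          have "x \<in> e k m" using k e(2)[of k] by blast
          with elim have "x \<notin> K m n" for n unfolding K_iff[OF x] by (cases "n \<le> k") auto
          then show ?case by blast
        qed
      qed
    qed
  qed
qed

text \<open>Any function of finitely many membership bits is a polynomial in the indicators; the
  induction splits off one bit at a time, with h generalized to absorb it.\<close>

lemma baire_pattern:
  assumes "finite I" "\<And>i. i \<in> I \<Longrightarrow> baire_set \<tau> \<xi> (T i)" "1 \<le> \<xi>"
  shows "baire \<tau> \<xi> (\<lambda>x. h {i \<in> I. x \<in> T i})"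
  using assms(1,2)
proof (induction I arbitrary: h rule: finite_induct)
  case empty
  then show ?case using assms(3) by (simp add: baire_const)
next
  case (insert j I)
  let ?P = "\<lambda>x. {i \<in> I. x \<in> T i}"
  have "baire \<tau> \<xi> (\<lambda>x. indicat_real (T j) x * h (Set.insert j (?P x)) +
      (1 - indicat_real (T j) x) * h (?P x))"
    using insert.prems insert.IH[of "\<lambda>P. h (Set.insert j P)"] insert.IH[of h] assms(3)
    by (intro baire_add baire_mult baire_diff baire_const) (auto simp: baire_set_def)
  moreover have "{i \<in> Set.insert j I. x \<in> T i} = (if x \<in> T j then Set.insert j (?P x) else ?P x)" for x
    by auto
  ultimately show ?case by (elim baire_cong) (simp add: indicator_def)
qed

text \<open>The limit is a telescoping series of differences with summable bounds. Each difference
  is a limit of continuous functions, and dominated convergence for series merges these limits into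
  one.\<close>

lemma baire_1_uniform_limit:
  assumes "\<And>\<epsilon>. \<epsilon> > 0 \<Longrightarrow> \<exists>g. baire \<tau> 1 g \<and> (\<forall>x\<in>topspace \<tau>. \<bar>f x - g x\<bar> \<le> \<epsilon>)"
  shows "baire \<tau> 1 f"
proof -
  have "\<exists>g. baire \<tau> 1 g \<and> (\<forall>x\<in>topspace \<tau>. \<bar>f x - g x\<bar> \<le> (1/2)^j)" for j :: nat
    using assms by simp
  then obtain g where g: "\<And>j. baire \<tau> 1 (g j)"
    "\<And>j x. x \<in> topspace \<tau> \<Longrightarrow> \<bar>f x - g j x\<bar> \<le> (1/2)^j" by metis
  define k where "k j x = g (Suc j) x - g j x" for j x
  have "baire \<tau> 1 (k j)" for j unfolding k_def[abs_def] using g(1) by (intro baire_diff)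
  then have "\<exists>u. (\<forall>n::nat. continuous_map \<tau> euclideanreal (u n)) \<and>
      (\<forall>x\<in>topspace \<tau>. (\<lambda>n. u n x) \<longlonglongrightarrow> k j x)" for j
    by (rule baire.cases) auto
  then obtain u where u: "\<And>j n. continuous_map \<tau> euclideanreal (u j n)"
    "\<And>j x. x \<in> topspace \<tau> \<Longrightarrow> (\<lambda>n. u j n x) \<longlonglongrightarrow> k j x" by metis
  \<comment> \<open>Two consecutive approximations differ by at most the sum of their errors,
    (1/2)^j + (1/2)^(j+1), which is below this bound.\<close>
  define b :: "nat \<Rightarrow> real" where "b j = 2 * (1/2)^j" for j
  have b0: "b j \<ge> 0" for j by (simp add: b_def)
  have kb: "\<bar>k j x\<bar> \<le> b j" if "x \<in> topspace \<tau>" for j x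
  proof -
    have "(1/2::real) ^ Suc j \<le> (1/2) ^ j" by simp
    then show ?thesis
      using g(2)[OF that, of j] g(2)[OF that, of "Suc j"] unfolding k_def b_def by linarith
  qed
  \<comment> \<open>Clipping to [-b j, b j] keeps the functions continuous and makes them uniformly
    summable; it does not disturb the limit, as \<open>k j\<close> already lies in this
    interval.\<close>
  define t where "t j y = max (- b j) (min (b j) y)" for j y
  have tb: "\<bar>t j y\<bar> \<le> b j" for j y using b0[of j] by (auto simp: t_def abs_le_iff)
  have t_cont: "continuous_on UNIV (t j)" for j unfolding t_def[abs_def] by (intro continuous_intros)
  have t_id: "t j (k j x) = k j x" if "x \<in> topspace \<tau>" for j x
    using kb[OF that, of j] by (auto simp: t_def)
  have "summable (\<lambda>j. (1/2)^j :: real)" by (rule summable_geometric) simp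
  then have sb: "summable b" unfolding b_def[abs_def] by (rule summable_mult)
  have "baire \<tau> 1 (\<lambda>x. f x - g 0 x)"
  proof (rule baire.intros(1)[of _ "\<lambda>n x. \<Sum>j\<le>n. t j (u j n x)"], safe)
    fix n
    have "continuous_map \<tau> euclideanreal (t j \<circ> u j n)" for j
      using u(1) t_cont by (intro continuous_map_compose) auto
    then show "continuous_map \<tau> euclideanreal (\<lambda>x. \<Sum>j\<le>n. t j (u j n x))"
      by (intro continuous_map_sum) (auto simp: o_def)
  next
    fix x assume x: "x \<in> topspace \<tau>"
    define a where "a j n = (if j \<le> n then t j (u j n x) else 0)" for j n
    have lim: "(\<lambda>n. a j n) \<longlonglongrightarrow> k j x" for j
    proof (rule Lim_transform_eventually)
      have "isCont (t j) (k j x)" using t_cont by (simp add: continuous_on_eq_continuous_at)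
      then have "(\<lambda>n. t j (u j n x)) \<longlonglongrightarrow> t j (k j x)"
        using u(2)[OF x] by (rule isCont_tendsto_compose)
      then show "(\<lambda>n. t j (u j n x)) \<longlonglongrightarrow> k j x" using t_id[OF x] by simp
      show "\<forall>\<^sub>F n in sequentially. t j (u j n x) = a j n"
        using eventually_ge_at_top[of j] by eventually_elim (simp add: a_def)
    qed
    have "(\<lambda>n. \<Sum>j. a j n) \<longlonglongrightarrow> (\<Sum>j. k j x)"
    proof -
      have "\<bar>a j n\<bar> \<le> b j" for j n using tb[of j "u j n x"] b0[of j] by (simp add: a_def)
      then have "\<forall>\<^sub>F (j, n) in sequentially \<times>\<^sub>F sequentially. norm (a j n) \<le> b j"
        by (intro always_eventually) auto
      from tannerys_theorem[OF lim this sb] show ?thesis by simp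
    qed
    moreover have "(\<Sum>j. a j n) = (\<Sum>j\<le>n. t j (u j n x))" for n
      by (subst suminf_finite[of "{..n}"]) (auto simp: a_def)
    moreover have "(\<lambda>j. k j x) sums (f x - g 0 x)"
    proof -
      have "(\<lambda>j. f x - g j x) \<longlonglongrightarrow> 0"
        by (rule tendsto_rabs_zero_cancel, rule tendsto_sandwich[of "\<lambda>_. 0" _ _ "\<lambda>j. (1/2)^j"])
          (use g(2)[OF x] in \<open>auto intro!: LIMSEQ_realpow_zero\<close>)
      then have "(\<lambda>j. f x - (f x - g j x)) \<longlonglongrightarrow> f x - 0" by (intro tendsto_diff tendsto_const)
      then have "(\<lambda>j. g j x) \<longlonglongrightarrow> f x" by simp
      then show ?thesis unfolding k_def by (rule telescope_sums)
    qed
    ultimately show "(\<lambda>n. \<Sum>j\<le>n. t j (u j n x)) \<longlonglongrightarrow> f x - g 0 x"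
      by (simp add: sums_unique[symmetric])
  qed
  then have "baire \<tau> 1 (\<lambda>x. (f x - g 0 x) + g 0 x)" using g(1) by (intro baire_add)
  then show ?thesis by simp
qed

subsection \<open>Rank functions of separating sequences\<close>

text \<open>Continuity at limits, together with the empty intersection at a limit length, gives each
  x a largest index \<zeta> with x in F \<zeta>. That index is r x, and its parity tells on which
  side of the separation x lies.\<close>

lemma separating_seq_rank:
  assumes "metrizable_space \<tau>" "1 \<le> \<xi>" and sep: "separating_seq \<tau> \<xi> \<mu> F A B"
    and "A \<subseteq> topspace \<tau>" "B \<subseteq> topspace \<tau>"
  obtains r where "\<And>x. x \<in> topspace \<tau> \<Longrightarrow> r x < \<mu>"
    "\<And>\<eta>. Pi0 \<tau> \<xi> {x \<in> topspace \<tau>. \<eta> \<le> r x}"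
    "\<And>x. x \<in> A \<Longrightarrow> even_ordinal (r x)" "\<And>x. x \<in> B \<Longrightarrow> \<not> even_ordinal (r x)"
proof
  define r where "r x = (LEAST \<zeta>. x \<notin> F (succ \<zeta>))" for x
  have F_Pi0: "\<forall>\<eta><\<mu>. Pi0 \<tau> \<xi> (F \<eta>)" and F_anti: "\<forall>\<eta> \<zeta>. \<eta> \<le> \<zeta> \<and> \<zeta> < \<mu> \<longrightarrow> F \<zeta> \<subseteq> F \<eta>"
    and F_lim: "\<forall>\<theta><\<mu>. limit \<theta> \<longrightarrow> F \<theta> = (\<Inter>\<eta>\<in>{..<\<theta>}. F \<eta>)" and F_0: "F 0 = topspace \<tau>"
    and F_end: "limit \<mu> \<longrightarrow> (\<Inter>\<eta>\<in>{..<\<mu>}. F \<eta>) = {}" and F_empty: "\<forall>\<eta>\<ge>\<mu>. F \<eta> = {}"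
    and F_A: "A \<subseteq> (\<Union>\<eta>\<in>{\<eta>. \<eta> < \<mu> \<and> even_ordinal \<eta>}. F \<eta> - F (succ \<eta>))"
    and F_B: "(\<Union>\<eta>\<in>{\<eta>. \<eta> < \<mu> \<and> even_ordinal \<eta>}. F \<eta> - F (succ \<eta>)) \<subseteq> topspace \<tau> - B"
    using sep unfolding separating_seq_def by simp_all
  have anti: "F \<zeta> \<subseteq> F \<eta>" if "\<eta> \<le> \<zeta>" for \<eta> \<zeta>
    using F_anti F_empty that by (cases "\<zeta> < \<mu>") (auto simp: not_less)
  have lim: "x \<in> F \<theta>" if "limit \<theta>" "\<And>\<eta>. \<eta> < \<theta> \<Longrightarrow> x \<in> F \<eta>" for x \<theta>
  proof (rule linorder_cases[of \<theta> \<mu>])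
    assume "\<theta> < \<mu>"
    with F_lim that show ?thesis by auto
  next
    assume "\<theta> = \<mu>"
    with that F_end show ?thesis by auto
  next
    assume "\<mu> < \<theta>"
    with that(2)[of \<mu>] F_empty show ?thesis by auto
  qed
  have mem: "x \<in> F \<eta> \<longleftrightarrow> \<eta> \<le> r x" if x: "x \<in> topspace \<tau>" for x \<eta>
  proof
    assume "x \<in> F \<eta>"
    have "x \<notin> F (succ \<mu>)" using F_empty less_imp_le[OF less_succ] by blast
    then have "x \<notin> F (succ (r x))" unfolding r_def by (rule LeastI)
    then have "\<not> succ (r x) \<le> \<eta>" using \<open>x \<in> F \<eta>\<close> anti by blast
    then show "\<eta> \<le> r x" by (simp add: not_le)
  next
    show "\<eta> \<le> r x \<Longrightarrow> x \<in> F \<eta>"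
    proof (induction \<eta> rule: ordinal_induct)
      case zero
      then show ?case using x F_0 by simp
    next
      case (succ \<eta>)
      then have "\<eta> < r x" by (simp add: succ_le_iff)
      then show ?case unfolding r_def using not_less_Least by blast
    next
      case (limit \<theta>)
      show ?case
      proof (rule lim[OF limit(1)])
        fix \<eta> assume "\<eta> < \<theta>"
        with limit(3) have "\<eta> \<le> r x" by simp
        with limit(2)[OF \<open>\<eta> < \<theta>\<close>] show "x \<in> F \<eta>" by simp
      qed
    qed
  qed
  show less: "r x < \<mu>" if "x \<in> topspace \<tau>" for x
    using mem[OF that, of \<mu>] F_empty by (simp add: not_le)
  show "Pi0 \<tau> \<xi> {x \<in> topspace \<tau>. \<eta> \<le> r x}" for \<eta>
  proof (cases "\<eta> < \<mu>")
    case True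
    then have "Pi0 \<tau> \<xi> (F \<eta>)" using F_Pi0 by blast
    moreover have "{x \<in> topspace \<tau>. \<eta> \<le> r x} = F \<eta>"
      using mem Pi0_subset[OF \<open>Pi0 \<tau> \<xi> (F \<eta>)\<close>] by blast
    ultimately show ?thesis by simp
  next
    case False
    then have "{x \<in> topspace \<tau>. \<eta> \<le> r x} = {}" using less by fastforce
    then show ?thesis unfolding \<open>_ = {}\<close> using assms(1,2) by (simp add: Pi0_def Sigma0_topspace)
  qed
  show "even_ordinal (r x)" if xA: "x \<in> A" for x
  proof -
    have "x \<in> topspace \<tau>" using xA assms(4) by blast
    moreover obtain \<eta> where "even_ordinal \<eta>" "x \<in> F \<eta>" "x \<notin> F (succ \<eta>)"
      using xA F_A by blast
    ultimately have "\<eta> \<le> r x" "\<not> \<eta> < r x" using mem[of x] by (auto simp: succ_le_iff)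
    then have "r x = \<eta>" by simp
    with \<open>even_ordinal \<eta>\<close> show ?thesis by simp
  qed
  show "\<not> even_ordinal (r x)" if "x \<in> B" for x
  proof
    assume "even_ordinal (r x)"
    have x: "x \<in> topspace \<tau>" using that assms(5) by blast
    then have "x \<in> F (r x) - F (succ (r x))" using mem[OF x] by (simp add: succ_le_iff)
    then have "x \<in> topspace \<tau> - B" using F_B \<open>even_ordinal (r x)\<close> less[OF x] by blast
    with that show False by simp
  qed
qed

lemma sep_rank_le: "separating_seq \<tau> \<xi> \<mu> F A B \<Longrightarrow> sep_rank \<tau> \<xi> A B \<le> \<mu>"
  unfolding sep_rank_def by (auto intro!: Least_le)

lemma sep_rank_less_omega1D:
  "sep_rank \<tau> \<xi> A B < omega1 \<Longrightarrow> \<exists>F. separating_seq \<tau> \<xi> (sep_rank \<tau> \<xi> A B) F A B"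
proof -
  assume *: "sep_rank \<tau> \<xi> A B < omega1"
  then have ex: "\<exists>\<mu> F. separating_seq \<tau> \<xi> \<mu> F A B" unfolding sep_rank_def by (auto split: if_splits)
  then have "sep_rank \<tau> \<xi> A B = (LEAST \<mu>. \<exists>F. separating_seq \<tau> \<xi> \<mu> F A B)"
    by (simp add: sep_rank_def)
  then show ?thesis using LeastI_ex[OF ex] by simp
qed

lemma sep_rank_le_omega1: "sep_rank \<tau> \<xi> A B \<le> omega1"
proof (cases "\<exists>\<mu> F. separating_seq \<tau> \<xi> \<mu> F A B")
  case True
  then obtain \<mu> F where F: "separating_seq \<tau> \<xi> \<mu> F A B" by blast
  then have "\<mu> < omega1" by (simp add: separating_seq_def)
  then show ?thesis using sep_rank_le[OF F] by simp
qed (auto simp: sep_rank_def)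

lemma fun_sep_rank_leI:
  assumes "\<And>p q. p \<in> \<rat> \<Longrightarrow> q \<in> \<rat> \<Longrightarrow> p < q \<Longrightarrow>
    sep_rank \<tau> \<xi> {x \<in> topspace \<tau>. f x \<le> p} {x \<in> topspace \<tau>. q \<le> f x} \<le> \<beta>"
  shows "fun_sep_rank \<tau> \<xi> f \<le> \<beta>"
  unfolding fun_sep_rank_def
proof (rule cSup_least)
  have "(0::real) \<in> \<rat>" "(1::real) \<in> \<rat>" "(0::real) < 1" by auto
  then show "{sep_rank \<tau> \<xi> {x \<in> topspace \<tau>. f x \<le> p} {x \<in> topspace \<tau>. q \<le> f x} |p q.
     p \<in> \<rat> \<and> q \<in> \<rat> \<and> p < q} \<noteq> {}" by blast
qed (use assms in auto)

lemma fun_sep_rank_leD: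
  assumes "fun_sep_rank \<tau> \<xi> f \<le> \<beta>" "p \<in> \<rat>" "q \<in> \<rat>" "p < q"
  shows "sep_rank \<tau> \<xi> {x \<in> topspace \<tau>. f x \<le> p} {x \<in> topspace \<tau>. q \<le> f x} \<le> \<beta>"
proof -
  have "sep_rank \<tau> \<xi> {x \<in> topspace \<tau>. f x \<le> p} {x \<in> topspace \<tau>. q \<le> f x} \<le> fun_sep_rank \<tau> \<xi> f"
    unfolding fun_sep_rank_def
  proof (rule cSup_upper)
    show "bdd_above {sep_rank \<tau> \<xi> {x \<in> topspace \<tau>. f x \<le> p} {x \<in> topspace \<tau>. q \<le> f x} |p q.
        p \<in> \<rat> \<and> q \<in> \<rat> \<and> p < q}"
      unfolding bdd_above_def using sep_rank_le_omega1[of \<tau> \<xi>] by (intro exI[of _ omega1]) blast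
  qed (use assms in blast)
  with assms(1) show ?thesis by simp
qed

text \<open>As \<beta> < \<open>omega1\<close>, the default value \<open>omega1\<close> of
  \<open>sep_rank\<close> is excluded, so a separating sequence of the least length exists.\<close>

lemma fun_sep_rank_rank:
  assumes "metrizable_space \<tau>" "1 \<le> \<xi>" "fun_sep_rank \<tau> \<xi> f \<le> \<beta>" "\<beta> < omega1"
    "p \<in> \<rat>" "q \<in> \<rat>" "p < q"
  obtains r where "\<And>x. x \<in> topspace \<tau> \<Longrightarrow> r x < \<beta>"
    "\<And>\<eta>. Pi0 \<tau> \<xi> {x \<in> topspace \<tau>. \<eta> \<le> r x}"
    "\<And>x. x \<in> topspace \<tau> \<Longrightarrow> f x \<le> p \<Longrightarrow> even_ordinal (r x)"
    "\<And>x. x \<in> topspace \<tau> \<Longrightarrow> q \<le> f x \<Longrightarrow> \<not> even_ordinal (r x)"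
proof -
  let ?A = "{x \<in> topspace \<tau>. f x \<le> p}" let ?B = "{x \<in> topspace \<tau>. q \<le> f x}"
  have le: "sep_rank \<tau> \<xi> ?A ?B \<le> \<beta>" using assms by (intro fun_sep_rank_leD)
  then obtain F where F: "separating_seq \<tau> \<xi> (sep_rank \<tau> \<xi> ?A ?B) F ?A ?B"
    using sep_rank_less_omega1D assms(4) by (meson order.strict_trans1)
  have sub: "?A \<subseteq> topspace \<tau>" "?B \<subseteq> topspace \<tau>" by auto
  obtain r where r: "\<And>x. x \<in> topspace \<tau> \<Longrightarrow> r x < sep_rank \<tau> \<xi> ?A ?B"
    "\<And>\<eta>. Pi0 \<tau> \<xi> {x \<in> topspace \<tau>. \<eta> \<le> r x}"
    "\<And>x. x \<in> ?A \<Longrightarrow> even_ordinal (r x)" "\<And>x. x \<in> ?B \<Longrightarrow> \<not> even_ordinal (r x)"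
    by (rule separating_seq_rank[OF assms(1,2) F sub]) (rule that)
  show thesis
    by (rule that[of r]) (use r le in \<open>auto intro: order.strict_trans2\<close>)
qed

subsection \<open>Alternating closures\<close>

text \<open>
  In a refinement of the topology, the alternating closures form the fastest decreasing sequence
  of closed sets separating \<open>A\<close> from \<open>B\<close>.
\<close>

context
  notes [fundef_cong] = image_cong
begin

function alt_seq :: "'a topology \<Rightarrow> 'a set \<Rightarrow> 'a set \<Rightarrow> ordinal \<Rightarrow> 'a set" where
  "alt_seq \<sigma> A B \<theta> = topspace \<sigma> \<inter>
     (\<Inter>\<eta>\<in>{..<\<theta>}. \<sigma> closure_of (alt_seq \<sigma> A B \<eta> \<inter> (if even_ordinal \<eta> then B else A)))"
  by auto
termination
proof (relation "inv_image {(x, y). x < y} (\<lambda>(\<sigma>, A, B, \<theta>). \<theta>)")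
  show "wf (inv_image {(x, y). x < y}
      (\<lambda>(\<sigma> :: 'a topology, A :: 'a set, B :: 'a set, \<theta> :: ordinal). \<theta>))"
    by (simp add: wf)
qed auto

declare alt_seq.simps [simp del]

end

lemma mem_alt_seq_iff:
  "x \<in> alt_seq \<sigma> A B \<theta> \<longleftrightarrow> x \<in> topspace \<sigma> \<and>
     (\<forall>\<eta><\<theta>. x \<in> \<sigma> closure_of (alt_seq \<sigma> A B \<eta> \<inter> (if even_ordinal \<eta> then B else A)))"
  by (subst alt_seq.simps) blast

lemma alt_seq_0 [simp]: "alt_seq \<sigma> A B 0 = topspace \<sigma>"
  unfolding set_eq_iff mem_alt_seq_iff[of _ _ _ _ 0] by simp

lemma alt_seq_antimono: "\<eta> \<le> \<theta> \<Longrightarrow> alt_seq \<sigma> A B \<theta> \<subseteq> alt_seq \<sigma> A B \<eta>"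
proof
  fix x assume "\<eta> \<le> \<theta>" "x \<in> alt_seq \<sigma> A B \<theta>"
  then show "x \<in> alt_seq \<sigma> A B \<eta>"
    unfolding mem_alt_seq_iff[of x _ _ _ \<eta>] mem_alt_seq_iff[of x _ _ _ \<theta>] by simp
qed

lemma alt_seq_limit:
  assumes "limit \<theta>"
  shows "alt_seq \<sigma> A B \<theta> = (\<Inter>\<eta>\<in>{..<\<theta>}. alt_seq \<sigma> A B \<eta>)"
proof
  show "alt_seq \<sigma> A B \<theta> \<subseteq> (\<Inter>\<eta>\<in>{..<\<theta>}. alt_seq \<sigma> A B \<eta>)"
    using alt_seq_antimono[of _ \<theta> \<sigma> A B] by (intro INT_greatest) (simp add: less_imp_le)
  show "(\<Inter>\<eta>\<in>{..<\<theta>}. alt_seq \<sigma> A B \<eta>) \<subseteq> alt_seq \<sigma> A B \<theta>"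
  proof
    fix x assume x: "x \<in> (\<Inter>\<eta>\<in>{..<\<theta>}. alt_seq \<sigma> A B \<eta>)"
    have "x \<in> alt_seq \<sigma> A B 0" using x limit_pos[OF assms] by blast
    moreover have "x \<in> \<sigma> closure_of (alt_seq \<sigma> A B \<eta> \<inter> (if even_ordinal \<eta> then B else A))"
      if "\<eta> < \<theta>" for \<eta>
    proof -
      have "x \<in> alt_seq \<sigma> A B (succ \<eta>)" using x limit_succ_less[OF assms that] by blast
      then show ?thesis unfolding mem_alt_seq_iff[of x _ _ _ "succ \<eta>"] using less_succ by blast
    qed
    ultimately show "x \<in> alt_seq \<sigma> A B \<theta>" unfolding mem_alt_seq_iff[of x _ _ _ \<theta>] by simp
  qed
qed

lemma closedin_alt_seq: "closedin \<sigma> (alt_seq \<sigma> A B \<theta>)"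
proof -
  have "alt_seq \<sigma> A B \<theta> = \<Inter>(Set.insert (topspace \<sigma>)
      ((\<lambda>\<eta>. \<sigma> closure_of (alt_seq \<sigma> A B \<eta> \<inter> (if even_ordinal \<eta> then B else A))) ` {..<\<theta>}))"
    by (subst alt_seq.simps) simp
  also have "closedin \<sigma> \<dots>" by (intro closedin_Inter) auto
  finally show ?thesis .
qed

lemma alt_seq_succ_iff:
  "x \<in> alt_seq \<sigma> A B (succ \<eta>) \<longleftrightarrow>
     x \<in> alt_seq \<sigma> A B \<eta> \<and> x \<in> \<sigma> closure_of (alt_seq \<sigma> A B \<eta> \<inter> (if even_ordinal \<eta> then B else A))"
  unfolding mem_alt_seq_iff[of x _ _ _ "succ \<eta>"] mem_alt_seq_iff[of x _ _ _ \<eta>]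
  by (auto simp: le_less)

text \<open>Points of B survive every even stage and points of A every odd one, being in the set
  whose closure is taken. Every point leaves at a successor step below \<mu>, hence points of A
  leave at even and points of B at odd stages.\<close>

lemma sep_rank_le_alt_seq:
  assumes "refining_topology \<tau> \<xi> \<sigma>" "A \<subseteq> topspace \<tau>" "B \<subseteq> topspace \<tau>" "\<mu> < omega1" "alt_seq \<sigma> A B \<mu> = {}"
  shows "sep_rank \<tau> \<xi> A B \<le> \<mu>"
proof (rule sep_rank_le)
  let ?F = "alt_seq \<sigma> A B"
  have top: "topspace \<sigma> = topspace \<tau>" using assms(1) by (simp add: refining_topology_def)
  have stay: "x \<in> ?F (succ \<eta>)" if "x \<in> ?F \<eta>" "x \<in> (if even_ordinal \<eta> then B else A)" for x \<eta>
  proof -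
    let ?S = "?F \<eta> \<inter> (if even_ordinal \<eta> then B else A)"
    have "?S \<subseteq> topspace \<sigma>" using assms(2,3) top by auto
    then have "?S \<subseteq> \<sigma> closure_of ?S" by (rule closure_of_subset)
    with that show ?thesis unfolding alt_seq_succ_iff by blast
  qed
  have empty: "?F \<eta> = {}" if "\<mu> \<le> \<eta>" for \<eta>
    using alt_seq_antimono[OF that, of \<sigma> A B] assms(5) by simp
  have lev: "\<exists>\<eta><\<mu>. x \<in> ?F \<eta> - ?F (succ \<eta>)" if "x \<in> topspace \<tau>" for x
  proof -
    define \<zeta> where "\<zeta> = (LEAST \<zeta>. x \<notin> ?F \<zeta>)"
    have "x \<notin> ?F \<mu>" using assms(5) by simp
    then have out: "x \<notin> ?F \<zeta>" unfolding \<zeta>_def by (rule LeastI)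
    have inn: "x \<in> ?F \<eta>" if "\<eta> < \<zeta>" for \<eta> using that not_less_Least unfolding \<zeta>_def by blast
    obtain \<eta> where \<eta>: "\<zeta> = succ \<eta>"
    proof (cases \<zeta> rule: ordinal_cases)
      case zero
      then show ?thesis using out that top \<open>x \<in> topspace \<tau>\<close> by simp
    next
      case limit
      then show ?thesis using out inn alt_seq_limit[OF limit, of \<sigma> A B] by auto
    qed
    have "x \<in> ?F \<eta>" using inn \<eta> less_succ by simp
    moreover have "\<eta> < \<mu>"
    proof (rule ccontr)
      assume "\<not> \<eta> < \<mu>"
      then have "?F \<eta> = {}" using empty by simp
      with \<open>x \<in> ?F \<eta>\<close> show False by simp
    qed
    ultimately show ?thesis using out \<eta> by blast
  qed
  show "separating_seq \<tau> \<xi> \<mu> ?F A B"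
    unfolding separating_seq_def
  proof (intro conjI allI impI)
    show "\<mu> < omega1" by fact
    show "Pi0 \<tau> \<xi> (?F \<eta>)" for \<eta>
    proof -
      have "openin \<sigma> (topspace \<sigma> - ?F \<eta>)"
        by (rule openin_diff[OF openin_topspace closedin_alt_seq])
      moreover have "?F \<eta> \<subseteq> topspace \<sigma>" by (rule closedin_subset[OF closedin_alt_seq])
      ultimately show ?thesis using assms(1) unfolding refining_topology_def Pi0_def by auto
    qed
    show "?F \<zeta> \<subseteq> ?F \<eta>" if "\<eta> \<le> \<zeta> \<and> \<zeta> < \<mu>" for \<eta> \<zeta> using that by (intro alt_seq_antimono) simp
    show "?F \<theta> = \<Inter> (?F ` {..<\<theta>})" if "limit \<theta>" for \<theta> using that by (rule alt_seq_limit)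
    show "?F 0 = topspace \<tau>" using top by simp
    show "\<Inter> (?F ` {..<\<mu>}) = {}" if "limit \<mu>" using alt_seq_limit[OF that, of \<sigma> A B] assms(5) by simp
    show "?F \<eta> = {}" if "\<mu> \<le> \<eta>" for \<eta> using that by (rule empty)
    show "A \<subseteq> (\<Union>\<eta>\<in>{\<eta>. \<eta> < \<mu> \<and> even_ordinal \<eta>}. ?F \<eta> - ?F (succ \<eta>))"
    proof
      fix x assume x: "x \<in> A"
      then have "x \<in> topspace \<tau>" using assms(2) by blast
      from lev[OF this] obtain \<eta> where \<eta>: "\<eta> < \<mu>" "x \<in> ?F \<eta>" "x \<notin> ?F (succ \<eta>)" by blast
      then have "even_ordinal \<eta>" using stay[of x \<eta>] x by (cases "even_ordinal \<eta>") auto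
      with \<eta> show "x \<in> (\<Union>\<eta>\<in>{\<eta>. \<eta> < \<mu> \<and> even_ordinal \<eta>}. ?F \<eta> - ?F (succ \<eta>))" by blast
    qed
    show "(\<Union>\<eta>\<in>{\<eta>. \<eta> < \<mu> \<and> even_ordinal \<eta>}. ?F \<eta> - ?F (succ \<eta>)) \<subseteq> topspace \<tau> - B"
    proof
      fix x assume "x \<in> (\<Union>\<eta>\<in>{\<eta>. \<eta> < \<mu> \<and> even_ordinal \<eta>}. ?F \<eta> - ?F (succ \<eta>))"
      then obtain \<eta> where \<eta>: "even_ordinal \<eta>" "x \<in> ?F \<eta>" "x \<notin> ?F (succ \<eta>)" by blast
      then have "x \<notin> B" using stay[of x \<eta>] by auto
      moreover have "x \<in> topspace \<sigma>" using \<eta>(2) unfolding mem_alt_seq_iff[of x] by simp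
      ultimately show "x \<in> topspace \<tau> - B" using top by simp
    qed
  qed
qed

lemma closure_of_meets:
  "x \<in> \<sigma> closure_of S \<Longrightarrow> openin \<sigma> U \<Longrightarrow> x \<in> U \<Longrightarrow> \<exists>y\<in>S. y \<in> U"
  by (auto simp: in_closure_of)

text \<open>If r y < \<eta>, then y is a limit of points z at stage \<theta> + r y lying in the set
  whose parity contradicts r y. Near y one has r z \<le> r y, and the induction hypothesis gives r y
  \<le> r z, so z has the rank of y but the wrong parity. The parities of r are only needed on U and
  from stage \<theta> on.\<close>

lemma alt_seq_le_rank:
  assumes closed: "\<And>\<eta>. closedin \<sigma> {x \<in> topspace \<sigma>. \<eta> \<le> r x}"
    and "even_ordinal \<theta>" "openin \<sigma> U"
    and A: "\<And>z. z \<in> alt_seq \<sigma> A B \<theta> \<inter> U \<Longrightarrow> z \<in> A \<Longrightarrow> even_ordinal (r z)"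
    and B: "\<And>z. z \<in> alt_seq \<sigma> A B \<theta> \<inter> U \<Longrightarrow> z \<in> B \<Longrightarrow> \<not> even_ordinal (r z)"
  shows "y \<in> alt_seq \<sigma> A B (oadd \<theta> \<eta>) \<Longrightarrow> y \<in> U \<Longrightarrow> \<eta> \<le> r y"
proof (induction \<eta> arbitrary: y rule: less_induct)
  case (less \<eta>)
  show ?case
  proof (rule ccontr)
    assume "\<not> \<eta> \<le> r y"
    then have lt: "r y < \<eta>" by simp
    let ?\<zeta> = "oadd \<theta> (r y)"
    let ?V = "U - {x \<in> topspace \<sigma>. succ (r y) \<le> r x}"
    have op: "openin \<sigma> ?V" using assms(3) closed by (rule openin_diff)
    have y: "y \<in> ?V" using less.prems(2) by (simp add: succ_le_iff)
    have "y \<in> \<sigma> closure_of (alt_seq \<sigma> A B ?\<zeta> \<inter> (if even_ordinal ?\<zeta> then B else A))"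
      using less.prems(1) oadd_strict_mono[OF lt] unfolding mem_alt_seq_iff[of y] by blast
    from closure_of_meets[OF this op y] obtain z where z: "z \<in> alt_seq \<sigma> A B ?\<zeta>"
      "z \<in> (if even_ordinal ?\<zeta> then B else A)" "z \<in> ?V" by (elim bexE IntE)
    have "z \<in> topspace \<sigma>" using z(1) unfolding mem_alt_seq_iff[of z] by simp
    then have "r z \<le> r y" using z(3) by (simp add: succ_le_iff not_less)
    moreover have "r y \<le> r z" using less.IH[OF lt z(1)] z(3) by blast
    ultimately have "r z = r y" by simp
    have "z \<in> alt_seq \<sigma> A B \<theta> \<inter> U"
      using z(1,3) alt_seq_antimono[OF le_oadd_left[of \<theta> "r y"], of \<sigma> A B] by blast
    then show False
      using A[of z] B[of z] z(2) \<open>r z = r y\<close> even_ordinal_oadd[OF assms(2), of "r y"]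
      by (auto split: if_splits)
  qed
qed

text \<open>
  Two alternating closures pass to the next level of \<open>s\<close>, since \<open>g\<close> is locally constant on each level.
\<close>

lemma fun_sep_rank_le_locally_const:
  assumes ref: "refining_topology \<tau> \<xi> \<sigma>" and "limit \<Theta>" "\<Theta> < omega1"
    and s: "\<And>x. x \<in> topspace \<tau> \<Longrightarrow> s x < \<Theta>"
    and loc: "\<And>x. x \<in> topspace \<tau> \<Longrightarrow>
      \<exists>U. openin \<sigma> U \<and> x \<in> U \<and> (\<forall>y\<in>U. s y \<le> s x \<and> (s y = s x \<longrightarrow> g y = g x))"
  shows "fun_sep_rank \<tau> \<xi> g \<le> \<Theta>"
proof (rule fun_sep_rank_leI)
  fix p q :: real assume "p < q"
  let ?A = "{x \<in> topspace \<tau>. g x \<le> p}" let ?B = "{x \<in> topspace \<tau>. q \<le> g x}"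
  let ?F = "alt_seq \<sigma> ?A ?B"
  have top: "topspace \<sigma> = topspace \<tau>" using ref by (simp add: refining_topology_def)
  have inX: "x \<in> topspace \<tau>" if "x \<in> ?F \<zeta>" for x \<zeta>
    using that top unfolding mem_alt_seq_iff[of x] by simp
  \<comment> \<open>Here \<zeta> is the stage reached after spending two stages on each level below
    \<eta>. The middle clause records that this never crosses a limit, which suffices because
    \<Theta> is a limit.\<close>
  have claim: "\<exists>\<zeta>. even_ordinal \<zeta> \<and> (\<forall>\<theta>. limit \<theta> \<longrightarrow> \<eta> < \<theta> \<longrightarrow> \<zeta> < \<theta>) \<and> (\<forall>x\<in>?F \<zeta>. \<eta> \<le> s x)"
    for \<eta>
  proof (induction \<eta> rule: ordinal_induct)
    case zero
    then show ?case by (intro exI[of _ 0]) simp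
  next
    case (succ \<eta>)
    then obtain \<zeta> where \<zeta>: "even_ordinal \<zeta>" "\<forall>\<theta>. limit \<theta> \<longrightarrow> \<eta> < \<theta> \<longrightarrow> \<zeta> < \<theta>" "\<forall>x\<in>?F \<zeta>. \<eta> \<le> s x"
      by (elim exE conjE)
    have "succ \<eta> \<le> s x" if x: "x \<in> ?F (succ (succ \<zeta>))" for x
    proof (rule ccontr)
      assume "\<not> succ \<eta> \<le> s x"
      have x1: "x \<in> ?F (succ \<zeta>)" and clA: "x \<in> \<sigma> closure_of (?F (succ \<zeta>) \<inter> ?A)"
        using x \<zeta>(1) unfolding alt_seq_succ_iff[of x _ _ _ "succ \<zeta>"] by simp_all
      have x0: "x \<in> ?F \<zeta>" and clB: "x \<in> \<sigma> closure_of (?F \<zeta> \<inter> ?B)"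
        using x1 \<zeta>(1) unfolding alt_seq_succ_iff[of x _ _ _ "\<zeta>"] by simp_all
      have sx: "s x = \<eta>" using \<open>\<not> succ \<eta> \<le> s x\<close> x0 \<zeta>(3) by (force simp: succ_le_iff)
      obtain U where U: "openin \<sigma> U" "x \<in> U" "\<forall>y\<in>U. s y \<le> s x \<and> (s y = s x \<longrightarrow> g y = g x)"
        using loc[OF inX[OF x]] by blast
      have const: "g y = g x" if "y \<in> U" "y \<in> ?F \<zeta>" for y
        using bspec[OF U(3) that(1)] bspec[OF \<zeta>(3) that(2)] sx by simp
      obtain a where a: "a \<in> ?F (succ \<zeta>)" "a \<in> ?A" "a \<in> U"
        using closure_of_meets[OF clA U(1,2)] by blast
      obtain b where b: "b \<in> ?F \<zeta>" "b \<in> ?B" "b \<in> U"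
        using closure_of_meets[OF clB U(1,2)] by blast
      have "a \<in> ?F \<zeta>" using a(1) unfolding alt_seq_succ_iff[of a] by simp
      then have "g a = g x" "g b = g x" using const a b by blast+
      then show False using a(2) b(2) \<open>p < q\<close> by simp
    qed
    moreover have "succ (succ \<zeta>) < \<theta>" if "limit \<theta>" "succ \<eta> < \<theta>" for \<theta>
      using that \<zeta>(2) less_succ[of \<eta>] limit_succ_less by (meson order.strict_trans)
    ultimately show ?case using \<zeta>(1) by (intro exI[of _ "succ (succ \<zeta>)"]) auto
  next
    case (limit \<theta>)
    have "\<theta> \<le> s x" if x: "x \<in> ?F \<theta>" for x
    proof (rule limit_le_if[OF limit(1)])
      fix \<eta> assume "\<eta> < \<theta>"
      from limit(2)[OF this] obtain \<zeta> where \<zeta>: "\<forall>\<theta>. limit \<theta> \<longrightarrow> \<eta> < \<theta> \<longrightarrow> \<zeta> < \<theta>" "\<forall>x\<in>?F \<zeta>. \<eta> \<le> s x"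
        by (elim exE conjE)
      have "\<zeta> < \<theta>" using \<zeta>(1) limit(1) \<open>\<eta> < \<theta>\<close> by simp
      then have "x \<in> ?F \<zeta>" using x alt_seq_antimono[OF less_imp_le[of \<zeta> \<theta>], of \<sigma> ?A ?B] by blast
      then show "\<eta> \<le> s x" using \<zeta>(2) by simp
    qed
    then show ?case using limit(1) even_ordinal_limit by (intro exI[of _ \<theta>]) auto
  qed
  have "?F \<Theta> = {}"
  proof (rule ccontr)
    assume "?F \<Theta> \<noteq> {}"
    then obtain x where x: "x \<in> ?F \<Theta>" by blast
    from claim[of "succ (s x)"] obtain \<zeta> where \<zeta>: "\<forall>\<theta>. limit \<theta> \<longrightarrow> succ (s x) < \<theta> \<longrightarrow> \<zeta> < \<theta>"
      "\<forall>y\<in>?F \<zeta>. succ (s x) \<le> s y" by (elim exE conjE)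
    have "\<zeta> < \<Theta>"
      using \<zeta>(1) assms(2) limit_succ_less[OF assms(2) s[OF inX[OF x]]] by simp
    then have "x \<in> ?F \<zeta>" using x alt_seq_antimono[OF less_imp_le[of \<zeta> \<Theta>], of \<sigma> ?A ?B] by blast
    then show False using \<zeta>(2) by (auto simp: succ_le_iff)
  qed
  then show "sep_rank \<tau> \<xi> ?A ?B \<le> \<Theta>"
    by (intro sep_rank_le_alt_seq[OF ref]) (use assms(3) in auto)
qed

subsection \<open>The rank of a convergent sequence\<close>

text \<open>Removes the extended reals. The margin c < \<epsilon> is essential: bounding the
  differences strictly by \<epsilon> point by point would only bound their supremum by
  \<epsilon>.\<close>

lemma mem_seq_derivative_iff:
  assumes "\<epsilon> > 0"
  shows "x \<in> seq_derivative \<tau> fs \<epsilon> F \<longleftrightarrow> x \<in> F \<and>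
    \<not> (\<exists>U N c. openin \<tau> U \<and> x \<in> U \<and> c < \<epsilon> \<and> (\<forall>m\<ge>N. \<forall>n\<ge>N. \<forall>y\<in>U \<inter> F. \<bar>fs m y - fs n y\<bar> \<le> c))"
proof -
  let ?S = "\<lambda>U N. {ennreal \<bar>fs m y - fs n y\<bar> | m n y. N \<le> n \<and> N \<le> m \<and> y \<in> U \<inter> F}"
  have "seq_oscillation \<tau> fs x F < ennreal \<epsilon> \<longleftrightarrow>
    (\<exists>U N c. openin \<tau> U \<and> x \<in> U \<and> c < \<epsilon> \<and> (\<forall>m\<ge>N. \<forall>n\<ge>N. \<forall>y\<in>U \<inter> F. \<bar>fs m y - fs n y\<bar> \<le> c))"
  proof
    assume "seq_oscillation \<tau> fs x F < ennreal \<epsilon>"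
    then obtain U N where U: "openin \<tau> U" "x \<in> U" and less: "Sup (?S U N) < ennreal \<epsilon>"
      unfolding seq_oscillation_def INF_less_iff by blast
    define c where "c = enn2real (Sup (?S U N))"
    have c: "Sup (?S U N) = ennreal c" unfolding c_def
      using less ennreal_less_top order.strict_trans by (intro ennreal_enn2real[symmetric]) blast
    have "0 \<le> c" by (simp add: c_def)
    have "c < \<epsilon>" using less \<open>0 \<le> c\<close> unfolding c by (simp add: ennreal_less_iff)
    moreover have "\<bar>fs m y - fs n y\<bar> \<le> c" if "m \<ge> N" "n \<ge> N" "y \<in> U \<inter> F" for m n y
    proof -
      have "ennreal \<bar>fs m y - fs n y\<bar> \<le> Sup (?S U N)" using that by (intro Sup_upper) blast
      then show ?thesis using \<open>0 \<le> c\<close> unfolding c by (simp add: ennreal_le_iff)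
    qed
    ultimately show "\<exists>U N c. openin \<tau> U \<and> x \<in> U \<and> c < \<epsilon> \<and>
        (\<forall>m\<ge>N. \<forall>n\<ge>N. \<forall>y\<in>U \<inter> F. \<bar>fs m y - fs n y\<bar> \<le> c)"
      using U by (intro exI[of _ U] exI[of _ N] exI[of _ c]) auto
  next
    assume "\<exists>U N c. openin \<tau> U \<and> x \<in> U \<and> c < \<epsilon> \<and>
        (\<forall>m\<ge>N. \<forall>n\<ge>N. \<forall>y\<in>U \<inter> F. \<bar>fs m y - fs n y\<bar> \<le> c)"
    then obtain U N c where U: "openin \<tau> U" "x \<in> U" and "c < \<epsilon>"
      and c: "\<forall>m\<ge>N. \<forall>n\<ge>N. \<forall>y\<in>U \<inter> F. \<bar>fs m y - fs n y\<bar> \<le> c" by (elim exE conjE)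
    \<comment> \<open>c may be negative if U \<inter> F is empty.\<close>
    have "Sup (?S U N) \<le> ennreal (max 0 c)"
    proof (rule Sup_least)
      fix a assume "a \<in> ?S U N"
      then obtain m n y where *: "a = ennreal \<bar>fs m y - fs n y\<bar>" "N \<le> n" "N \<le> m" "y \<in> U \<inter> F" by blast
      then have "\<bar>fs m y - fs n y\<bar> \<le> max 0 c" using c by (auto simp: le_max_iff_disj)
      then show "a \<le> ennreal (max 0 c)" using *(1) by (simp add: ennreal_leI)
    qed
    also have "\<dots> < ennreal \<epsilon>" using assms \<open>c < \<epsilon>\<close> by (simp add: ennreal_less_iff)
    finally have "Sup (?S U N) < ennreal \<epsilon>" .
    then show "seq_oscillation \<tau> fs x F < ennreal \<epsilon>"
      unfolding seq_oscillation_def INF_less_iff using U by blast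
  qed
  then show ?thesis unfolding seq_derivative_def mem_Collect_eq not_less[symmetric] by simp
qed

lemma iter_derivative_0 [simp]: "iter_derivative D 0 F = F"
  by (simp add: iter_derivative.simps)

lemma iter_derivative_succ [simp]: "iter_derivative D (succ \<eta>) F = D (iter_derivative D \<eta> F)"
  by (simp add: iter_derivative.simps[of D "succ \<eta>"])

lemma iter_derivative_limit:
  "limit \<theta> \<Longrightarrow> iter_derivative D \<theta> F = (\<Inter>\<eta>\<in>{..<\<theta>}. iter_derivative D \<eta> F)"
  using limit_pos[of \<theta>] by (simp add: iter_derivative.simps[of D \<theta>] zero_less_ordinal_iff)

lemma iter_derivative_antimono:
  assumes "\<And>F. D F \<subseteq> F"
  shows "\<eta> \<le> \<theta> \<Longrightarrow> iter_derivative D \<theta> F \<subseteq> iter_derivative D \<eta> F"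
proof (induction \<theta> rule: ordinal_induct)
  case zero
  then show ?case by (metis antisym zero_le_ordinal order.refl)
next
  case (succ \<theta>)
  show ?case
  proof (cases "\<eta> = succ \<theta>")
    case False
    with succ.prems have "\<eta> \<le> \<theta>" by (metis le_less less_succ_iff)
    with succ.IH assms[of "iter_derivative D \<theta> F"] show ?thesis by auto
  qed simp
next
  case (limit \<theta>)
  then show ?case
    by (cases "\<eta> = \<theta>") (auto simp: iter_derivative_limit[OF limit(1)])
qed

lemma iter_derivative_stationary:
  assumes "\<And>F. D F \<subseteq> F" "iter_derivative D (succ \<eta>) F = iter_derivative D \<eta> F"
  shows "\<eta> \<le> \<theta> \<Longrightarrow> iter_derivative D \<theta> F = iter_derivative D \<eta> F"
proof (induction \<theta> rule: ordinal_induct)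
  case zero
  then show ?case by (metis antisym zero_le_ordinal)
next
  case (succ \<theta>)
  show ?case
  proof (cases "\<eta> = succ \<theta>")
    case False
    with succ.prems have "\<eta> \<le> \<theta>" by (metis le_less less_succ_iff)
    with succ.IH assms(2) show ?thesis by simp
  qed simp
next
  case (limit \<theta>)
  show ?case
  proof (cases "\<eta> = \<theta>")
    case False
    with limit.prems have "\<eta> < \<theta>" by simp
    have "iter_derivative D \<eta> F \<subseteq> iter_derivative D \<zeta> F" if "\<zeta> < \<theta>" for \<zeta>
    proof (cases "\<eta> \<le> \<zeta>")
      case True
      with limit.IH[OF that] show ?thesis by simp
    next
      case False
      then show ?thesis using iter_derivative_antimono[of D \<zeta> \<eta> F] assms(1) by simp
    qed
    with \<open>\<eta> < \<theta>\<close> show ?thesis unfolding iter_derivative_limit[OF limit(1)] by blast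
  qed simp
qed

lemma seq_derivative_subset: "seq_derivative \<tau> fs \<epsilon> F \<subseteq> F"
  by (auto simp: seq_derivative_def)

text \<open>Ensures that the supremum in \<open>convergence_rank\<close> is taken over a bounded
  set. Each step before the derivatives vanish loses a point, together with a basic open set that
  meets one derivative and misses the next; different steps use different basic sets, so there are
  countably many steps.\<close>

lemma derivative_rank_le_omega1:
  assumes sc: "second_countable \<tau>" and "\<epsilon> > 0"
  shows "derivative_rank \<tau> (seq_derivative \<tau> fs \<epsilon>) \<le> omega1"
proof -
  let ?D = "seq_derivative \<tau> fs \<epsilon>"
  let ?I = "\<lambda>\<eta>. iter_derivative ?D \<eta> (topspace \<tau>)"
  show ?thesis
  proof (cases "\<exists>\<theta>. ?I \<theta> = {}")
    case True
    define \<theta> where "\<theta> = (LEAST \<theta>. ?I \<theta> = {})"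
    have empty: "?I \<theta> = {}" unfolding \<theta>_def using True by (rule LeastI_ex)
    obtain \<B> where \<B>: "countable \<B>" "\<forall>U x. openin \<tau> U \<and> x \<in> U \<longrightarrow> (\<exists>V\<in>\<B>. x \<in> V \<and> V \<subseteq> U)"
      using sc unfolding second_countable_def by blast
    have "\<exists>V\<in>\<B>. V \<inter> ?I \<eta> \<noteq> {} \<and> V \<inter> ?I (succ \<eta>) = {}" if "\<eta> < \<theta>" for \<eta>
    proof -
      have "?I \<eta> \<noteq> {}" using that not_less_Least unfolding \<theta>_def by blast
      then have "?I (succ \<eta>) \<noteq> ?I \<eta>"
        using iter_derivative_stationary[of ?D \<eta> "topspace \<tau>" \<theta>] seq_derivative_subset that empty
        by (metis less_imp_le)
      then obtain x where x: "x \<in> ?I \<eta>" "x \<notin> ?D (?I \<eta>)"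
        using seq_derivative_subset[of \<tau> fs \<epsilon> "?I \<eta>"] by auto
      then obtain U N c where U: "openin \<tau> U" "x \<in> U" "c < \<epsilon>"
        "\<forall>m\<ge>N. \<forall>n\<ge>N. \<forall>y\<in>U \<inter> ?I \<eta>. \<bar>fs m y - fs n y\<bar> \<le> c"
        unfolding mem_seq_derivative_iff[OF \<open>\<epsilon> > 0\<close>] by blast
      obtain V where V: "V \<in> \<B>" "x \<in> V" "V \<subseteq> U" using \<B>(2) U(1,2) by blast
      have "z \<notin> ?D (?I \<eta>)" if "z \<in> V" for z
        unfolding mem_seq_derivative_iff[OF \<open>\<epsilon> > 0\<close>] using U V(3) that by blast
      then have "V \<inter> ?I (succ \<eta>) = {}" by auto
      with V x(1) show ?thesis by blast
    qed
    then obtain V where V: "\<And>\<eta>. \<eta> < \<theta> \<Longrightarrow> V \<eta> \<in> \<B>" "\<And>\<eta>. \<eta> < \<theta> \<Longrightarrow> V \<eta> \<inter> ?I \<eta> \<noteq> {}"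
      "\<And>\<eta>. \<eta> < \<theta> \<Longrightarrow> V \<eta> \<inter> ?I (succ \<eta>) = {}" by metis
    have neq: "V \<eta> \<noteq> V \<zeta>" if "\<eta> < \<zeta>" "\<zeta> < \<theta>" for \<eta> \<zeta>
    proof
      assume eq: "V \<eta> = V \<zeta>"
      have "?I \<zeta> \<subseteq> ?I (succ \<eta>)"
        using that by (intro iter_derivative_antimono seq_derivative_subset) (simp add: succ_le_iff)
      moreover have "V \<zeta> \<inter> ?I \<zeta> \<noteq> {}" "V \<eta> \<inter> ?I (succ \<eta>) = {}"
        using V(2,3) that by (auto simp del: iter_derivative_succ)
      ultimately show False using eq by blast
    qed
    have "inj_on V {..<\<theta>}"
    proof (rule inj_onI)
      fix \<eta> \<zeta> assume *: "\<eta> \<in> {..<\<theta>}" "\<zeta> \<in> {..<\<theta>}" "V \<eta> = V \<zeta>"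
      show "\<eta> = \<zeta>"
        using neq[of \<eta> \<zeta>] neq[of \<zeta> \<eta>] * by (cases \<eta> \<zeta> rule: linorder_cases) auto
    qed
    moreover have "countable (V ` {..<\<theta>})"
      using V(1) by (intro countable_subset[OF _ \<B>(1)]) auto
    ultimately have "countable {..<\<theta>}" using countable_image_inj_on by blast
    then have "\<theta> < omega1" by (simp add: less_omega1_iff)
    moreover have "derivative_rank \<tau> ?D = \<theta>"
      using True by (simp add: derivative_rank_def \<theta>_def)
    ultimately show ?thesis by simp
  qed (simp add: derivative_rank_def)
qed

lemma convergence_rank_le_omegaD:
  assumes "second_countable \<tau>" "convergence_rank \<tau> fs \<le> omega" "\<epsilon> > 0"
  shows "iter_derivative (seq_derivative \<tau> fs \<epsilon>) omega (topspace \<tau>) = {}"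
proof -
  let ?D = "seq_derivative \<tau> fs \<epsilon>"
  let ?I = "\<lambda>\<eta>. iter_derivative ?D \<eta> (topspace \<tau>)"
  have "derivative_rank \<tau> ?D \<le> convergence_rank \<tau> fs"
    unfolding convergence_rank_def
    by (rule cSUP_upper) (use assms derivative_rank_le_omega1 in \<open>auto simp: bdd_above_def\<close>)
  with assms have le: "derivative_rank \<tau> ?D \<le> omega" by simp
  have ex: "\<exists>\<theta>. ?I \<theta> = {}"
  proof (rule ccontr)
    assume "\<nexists>\<theta>. ?I \<theta> = {}"
    then have "derivative_rank \<tau> ?D = omega1" by (simp add: derivative_rank_def)
    with le omega_less_omega1 show False by simp
  qed
  then have "?I (LEAST \<theta>. ?I \<theta> = {}) = {}" by (rule LeastI_ex)
  with ex have "?I (derivative_rank \<tau> ?D) = {}" by (simp add: derivative_rank_def)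
  moreover have "?I omega \<subseteq> ?I (derivative_rank \<tau> ?D)"
    using le by (intro iter_derivative_antimono seq_derivative_subset)
  ultimately show ?thesis by simp
qed

lemma convergence_rank_le_omegaI:
  assumes "\<And>\<epsilon>. \<epsilon> > 0 \<Longrightarrow> iter_derivative (seq_derivative \<tau> fs \<epsilon>) omega (topspace \<tau>) = {}"
  shows "convergence_rank \<tau> fs \<le> omega"
  unfolding convergence_rank_def
proof (rule cSUP_least)
  show "{0::real<..} \<noteq> {}" by (auto intro: exI[of _ 1])
  fix \<epsilon> :: real assume "\<epsilon> \<in> {0<..}"
  then have "iter_derivative (seq_derivative \<tau> fs \<epsilon>) omega (topspace \<tau>) = {}" using assms by simp
  then show "derivative_rank \<tau> (seq_derivative \<tau> fs \<epsilon>) \<le> omega"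
    unfolding derivative_rank_def by (auto intro!: Least_le)
qed

subsection \<open>Pseudouniform limits have the expected rank\<close>

lemma tendsto_dist_le:
  fixes u :: "nat \<Rightarrow> real"
  assumes "u \<longlonglongrightarrow> a" "\<And>m. m \<ge> N \<Longrightarrow> \<bar>u m - b\<bar> \<le> c"
  shows "\<bar>a - b\<bar> \<le> c"
proof (rule LIMSEQ_le_const2)
  show "(\<lambda>m. \<bar>u m - b\<bar>) \<longlonglongrightarrow> \<bar>a - b\<bar>" by (intro tendsto_intros assms(1))
qed (use assms(2) in blast)

text \<open>Since w is a limit, every finite multiple of w is an even index, so the alternation can
  be restarted at the beginning of each block of w stages.\<close>

lemma fun_sep_rank_Phi_le:
  assumes \<tau>: "polish \<tau>" and \<xi>: "1 \<le> \<xi>" and "limit w" "w < omega1" and "\<Omega> < omega1"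
    and \<Omega>: "\<And>k. omult_nat w k \<le> \<Omega>"
    and rank: "\<And>n. fun_sep_rank \<tau> \<xi> (fs n) \<le> w"
    and ref: "refining_topology \<tau> \<xi> \<tau>'" and lim: "pseudouniform_limit \<tau>' fs f"
  shows "fun_sep_rank \<tau> \<xi> f \<le> \<Omega>"
proof (rule fun_sep_rank_leI)
  fix p q :: real assume pq: "p \<in> \<rat>" "q \<in> \<rat>" "p < q"
  let ?X = "topspace \<tau>"
  let ?A = "{x \<in> ?X. f x \<le> p}" let ?B = "{x \<in> ?X. q \<le> f x}"
  \<comment> \<open>An error of \<epsilon> turns f \<le> p into \<open>fs n\<close> \<le> p +
    \<epsilon> and f \<ge> q into \<open>fs n\<close> \<ge> q - \<epsilon>, and these thresholds are
    still rational and in the right order.\<close>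
  define \<epsilon> where "\<epsilon> = (q - p) / 3"
  have "\<epsilon> > 0" using pq by (simp add: \<epsilon>_def)
  have \<epsilon>: "\<epsilon> \<in> \<rat>" using pq by (auto simp: \<epsilon>_def)
  have top: "topspace \<tau>' = ?X" and "polish \<tau>'" using ref by (auto simp: refining_topology_def)
  have conv: "(\<lambda>n. fs n x) \<longlonglongrightarrow> f x" if "x \<in> ?X" for x
    using lim that top by (simp add: pseudouniform_limit_def)
  have "\<exists>r. (\<forall>x\<in>?X. r x < w) \<and> (\<forall>\<eta>. Pi0 \<tau> \<xi> {x \<in> ?X. \<eta> \<le> r x}) \<and>
      (\<forall>x\<in>?X. (fs n x \<le> p + \<epsilon> \<longrightarrow> even_ordinal (r x)) \<and> (q - \<epsilon> \<le> fs n x \<longrightarrow> \<not> even_ordinal (r x)))" for n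
  proof -
    have "p + \<epsilon> \<in> \<rat>" "q - \<epsilon> \<in> \<rat>" "p + \<epsilon> < q - \<epsilon>"
      using pq \<epsilon> by (auto simp: \<epsilon>_def field_simps)
    then obtain r where "\<And>x. x \<in> ?X \<Longrightarrow> r x < w" "\<And>\<eta>. Pi0 \<tau> \<xi> {x \<in> ?X. \<eta> \<le> r x}"
      "\<And>x. x \<in> ?X \<Longrightarrow> fs n x \<le> p + \<epsilon> \<Longrightarrow> even_ordinal (r x)"
      "\<And>x. x \<in> ?X \<Longrightarrow> q - \<epsilon> \<le> fs n x \<Longrightarrow> \<not> even_ordinal (r x)"
      by (rule fun_sep_rank_rank[OF polish_imp_metrizable[OF \<tau>] \<xi> rank[of n] \<open>w < omega1\<close>]) (rule that)
    then show ?thesis by (intro exI[of _ r]) simp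
  qed
  then obtain r where r: "\<And>n. \<forall>x\<in>?X. r n x < w" "\<And>n. \<forall>\<eta>. Pi0 \<tau> \<xi> {x \<in> ?X. \<eta> \<le> r n x}"
    "\<And>n. \<forall>x\<in>?X. (fs n x \<le> p + \<epsilon> \<longrightarrow> even_ordinal (r n x)) \<and> (q - \<epsilon> \<le> fs n x \<longrightarrow> \<not> even_ordinal (r n x))"
    by metis
  \<comment> \<open>Countably many sets cover all terms of the sequence at once; for \<eta> \<ge> w
    the sets are empty.\<close>
  let ?\<P> = "(\<lambda>(n, \<eta>). {x \<in> ?X. \<eta> \<le> r n x}) ` (UNIV \<times> {..<w})"
  have cnt: "countable ?\<P>" using \<open>w < omega1\<close> by (intro countable_image countable_SIGMA) (auto simp: countable_lessThan)
  have Pi0: "Pi0 \<tau> \<xi> P" if "P \<in> ?\<P>" for P using that r(2) by auto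
  obtain \<sigma> where \<sigma>: "refining_topology \<tau> \<xi> \<sigma>" "\<And>U. openin \<tau>' U \<Longrightarrow> openin \<sigma> U"
    and closed: "\<And>P. P \<in> ?\<P> \<Longrightarrow> closedin \<sigma> P"
    by (rule ex_refining_topology_closed[OF \<tau> ref \<xi> cnt Pi0], assumption) (rule that)
  have top\<sigma>: "topspace \<sigma> = ?X" using \<sigma>(1) by (simp add: refining_topology_def)
  have closed': "closedin \<sigma> {x \<in> topspace \<sigma>. \<eta> \<le> r n x}" for n \<eta>
  proof (cases "\<eta> < w")
    case True
    then have "{x \<in> ?X. \<eta> \<le> r n x} \<in> ?\<P>" by (intro image_eqI[of _ _ "(n, \<eta>)"]) auto
    then show ?thesis unfolding top\<sigma> by (rule closed)
  next
    case False
    then have "{x \<in> ?X. \<eta> \<le> r n x} = {}" using r(1)[of n] by fastforce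
    then show ?thesis unfolding top\<sigma> by (metis closedin_empty)
  qed
  let ?F = "alt_seq \<sigma> ?A ?B"
  let ?D = "seq_derivative \<tau>' fs \<epsilon>"
  let ?I = "\<lambda>\<theta>. iter_derivative ?D \<theta> (topspace \<tau>')"
  have inX: "x \<in> ?X" if "x \<in> ?F \<zeta>" for x \<zeta> using that top\<sigma> unfolding mem_alt_seq_iff[of x] by simp
  have sub: "?F (omult_nat w k) \<subseteq> ?I ((succ ^^ k) 0)" for k
  proof (induction k)
    case 0
    then show ?case using top top\<sigma> by simp
  next
    case (Suc k)
    let ?Ik = "?I ((succ ^^ k) 0)"
    show ?case
    proof
      fix y assume y: "y \<in> ?F (omult_nat w (Suc k))"
      have y0: "y \<in> ?F (omult_nat w k)"
        using y alt_seq_antimono[OF omult_nat_mono[of k "Suc k" w], of \<sigma> ?A ?B] by auto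
      have "y \<in> ?D ?Ik"
      proof (rule ccontr)
        assume "y \<notin> ?D ?Ik"
        moreover have "y \<in> ?Ik" using Suc.IH y0 by blast
        ultimately obtain U N c where U: "openin \<tau>' U" "y \<in> U" "c < \<epsilon>"
          and c: "\<forall>m\<ge>N. \<forall>n\<ge>N. \<forall>z\<in>U \<inter> ?Ik. \<bar>fs m z - fs n z\<bar> \<le> c"
          unfolding mem_seq_derivative_iff[OF \<open>\<epsilon> > 0\<close>] by blast
        have near: "z \<in> ?X \<and> \<bar>f z - fs N z\<bar> \<le> \<epsilon>" if z: "z \<in> ?F (omult_nat w k) \<inter> U" for z
        proof -
          have "z \<in> U \<inter> ?Ik" using z Suc.IH by blast
          moreover have "z \<in> ?X" using z inX by blast
          ultimately have "\<bar>f z - fs N z\<bar> \<le> c" using c by (intro tendsto_dist_le[OF conv, of z N]) auto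
          with \<open>c < \<epsilon>\<close> \<open>z \<in> ?X\<close> show ?thesis by simp
        qed
        \<comment> \<open>After w further stages inside U the rank of y for the single term
          \<open>fs N\<close> would have to reach w, but all its values are below w.\<close>
        have "w \<le> r N y"
        proof (rule alt_seq_le_rank[OF closed' even_omult_nat[OF \<open>limit w\<close>] \<sigma>(2)[OF U(1)]])
          show "y \<in> ?F (oadd (omult_nat w k) w)" using y by (simp add: omult_nat_Suc)
          show "y \<in> U" by fact
          fix z assume z: "z \<in> ?F (omult_nat w k) \<inter> U"
          note n = near[OF z]
          show "even_ordinal (r N z)" if "z \<in> ?A"
          proof -
            have "fs N z \<le> p + \<epsilon>" using n that by (auto simp: abs_le_iff)
            then show ?thesis using r(3) n by blast
          qed
          show "\<not> even_ordinal (r N z)" if "z \<in> ?B"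
          proof -
            have "q - \<epsilon> \<le> fs N z" using n that by (auto simp: abs_le_iff)
            then show ?thesis using r(3) n by blast
          qed
        qed
        moreover have "r N y < w" using r(1) inX[OF y] by blast
        ultimately show False by simp
      qed
      then show "y \<in> ?I ((succ ^^ Suc k) 0)" by simp
    qed
  qed
  have "?F \<Omega> \<subseteq> ?I omega"
  proof -
    have "?F \<Omega> \<subseteq> ?I ((succ ^^ k) 0)" for k
      using sub[of k] alt_seq_antimono[OF \<Omega>[of k], of \<sigma> ?A ?B] by blast
    then show ?thesis
      unfolding iter_derivative_limit[OF omega_limit] using less_omega_iff
      by (intro INT_greatest) auto
  qed
  moreover have "?I omega = {}"
    using lim \<open>polish \<tau>'\<close> \<open>\<epsilon> > 0\<close>
    by (intro convergence_rank_le_omegaD) (auto simp: polish_iff pseudouniform_limit_def)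
  ultimately show "sep_rank \<tau> \<xi> ?A ?B \<le> \<Omega>"
    by (intro sep_rank_le_alt_seq[OF \<sigma>(1)]) (use \<open>\<Omega> < omega1\<close> in auto)
qed

lemma omult_nat_le_opower_omega_succ: "omult_nat (opower omega \<nu>) k \<le> opower omega (succ \<nu>)"
  by (rule ordinal_leI) (use less_opower_omega_succ in blast)

text \<open>The terms may come from different classes below \<nu>; all that is used is their common
  rank bound \<omega>^\<nu>.\<close>

lemma Phi_subset:
  assumes \<tau>: "polish \<tau>" and \<xi>: "1 \<le> \<xi>" and \<nu>: "\<nu> \<noteq> 0" "\<nu> < omega1"
  shows "Phi \<tau> \<xi> (\<Union>\<eta>\<in>{..<\<nu>}. baire_rank_class \<tau> \<xi> (succ \<eta>)) \<subseteq> baire_rank_class \<tau> \<xi> (succ \<nu>)"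
proof
  fix f assume "f \<in> Phi \<tau> \<xi> (\<Union>\<eta>\<in>{..<\<nu>}. baire_rank_class \<tau> \<xi> (succ \<eta>))"
  then obtain fs \<tau>' where f: "bounded (f ` topspace \<tau>)" "baire \<tau> \<xi> f"
    and fs: "\<forall>n::nat. fs n \<in> (\<Union>\<eta>\<in>{..<\<nu>}. baire_rank_class \<tau> \<xi> (succ \<eta>))"
    and ref: "refining_topology \<tau> \<xi> \<tau>'" and lim: "pseudouniform_limit \<tau>' fs f"
    unfolding Phi_def refining_topology_def by blast
  have "fun_sep_rank \<tau> \<xi> (fs n) \<le> opower omega \<nu>" for n
  proof -
    obtain \<eta> where "\<eta> < \<nu>" "fun_sep_rank \<tau> \<xi> (fs n) \<le> opower omega (succ \<eta>)"
      using fs unfolding baire_rank_class_def by blast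
    moreover have "opower omega (succ \<eta>) \<le> opower omega \<nu>"
      using \<open>\<eta> < \<nu>\<close> by (intro opower_mono) (simp add: succ_le_iff)
    ultimately show ?thesis by simp
  qed
  then have "fun_sep_rank \<tau> \<xi> f \<le> opower omega (succ \<nu>)"
    using \<nu> limit_succ_less[OF limit_omega1]
    by (intro fun_sep_rank_Phi_le[OF \<tau> \<xi> limit_opower_omega _ _ omult_nat_le_opower_omega_succ _ ref lim]
        opower_omega_less_omega1)
  with f show "f \<in> baire_rank_class \<tau> \<xi> (succ \<nu>)" by (simp add: baire_rank_class_def)
qed

subsection \<open>Approximation by functions of smaller rank\<close>

text \<open>A bounded function meets finitely many cells of a grid. If f y were at least f x +
  \<epsilon>, some pair of adjacent grid points would lie between the two values, and the bit
  separating that pair would differ.\<close>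

lemma pattern_determines:
  fixes f :: "'a \<Rightarrow> real"
  assumes bdd: "bounded (f ` X)" and "\<epsilon> > 0"
    and S: "\<And>p q. p \<in> \<rat> \<Longrightarrow> q \<in> \<rat> \<Longrightarrow> p < q \<Longrightarrow>
      \<exists>i::nat. \<forall>x\<in>X. (f x \<le> p \<longrightarrow> S i x) \<and> (q \<le> f x \<longrightarrow> \<not> S i x)"
  obtains J where "\<And>x y. x \<in> X \<Longrightarrow> y \<in> X \<Longrightarrow> (\<And>i. i \<le> J \<Longrightarrow> S i x \<longleftrightarrow> S i y) \<Longrightarrow> \<bar>f x - f y\<bar> < \<epsilon>"
proof -
  obtain b where b: "\<And>x. x \<in> X \<Longrightarrow> \<bar>f x\<bar> \<le> b"
    using bdd unfolding bounded_iff by auto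
  obtain M :: nat where "b \<le> real M" using real_arch_simple by blast
  with b have M: "\<bar>f x\<bar> \<le> real M" if "x \<in> X" for x using that by force
  \<comment> \<open>Rounding f x up to the grid costs less than one cell and the separating pair
    takes one more, so two cells must fit into \<epsilon>.\<close>
  obtain N' :: nat where N': "1 / real (Suc N') < \<epsilon> / 2" using \<open>\<epsilon> > 0\<close> nat_approx_posE[of "\<epsilon> / 2"] by auto
  define N where "N = real (Suc N')"
  have N: "N > 0" "2 / N < \<epsilon>" using N' by (auto simp: N_def)
  have "\<exists>i. \<forall>x\<in>X. (f x \<le> real_of_int l / N \<longrightarrow> S i x) \<and> (real_of_int (l + 1) / N \<le> f x \<longrightarrow> \<not> S i x)" for l
    using N by (intro S) (auto simp: N_def divide_strict_right_mono)
  then obtain i where i: "\<And>l x. x \<in> X \<Longrightarrow> f x \<le> real_of_int l / N \<Longrightarrow> S (i l) x"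
    "\<And>l x. x \<in> X \<Longrightarrow> real_of_int (l + 1) / N \<le> f x \<Longrightarrow> \<not> S (i l) x" by metis
  \<comment> \<open>The grid index of any value of f lies between -K and K, so J is a maximum over
    finitely many pairs.\<close>
  define K where "K = int M * int (Suc N')"
  define J where "J = Max (i ` {-K..K})"
  have J: "i l \<le> J" if "-K \<le> l" "l \<le> K" for l
    unfolding J_def using that by (intro Max_ge) auto
  have less: "f y < f x + \<epsilon>" if xy: "x \<in> X" "y \<in> X" and eq: "\<And>i. i \<le> J \<Longrightarrow> S i x \<longleftrightarrow> S i y" for x y
  proof (rule ccontr)
    assume "\<not> f y < f x + \<epsilon>"
    define l where "l = \<lceil>f x * N\<rceil>"
    have l: "f x * N \<le> real_of_int l" "real_of_int l < f x * N + 1" unfolding l_def by linarith+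
    have "f x \<le> real_of_int l / N" using l N by (simp add: pos_le_divide_eq)
    moreover have "real_of_int (l + 1) / N \<le> f y"
    proof -
      have "real_of_int (l + 1) / N \<le> (f x * N + 2) / N" using l N by (intro divide_right_mono) auto
      also have "\<dots> = f x + 2 / N" using N by (simp add: field_simps)
      finally show ?thesis using \<open>\<not> f y < f x + \<epsilon>\<close> N(2) by simp
    qed
    moreover have "\<bar>f x * N\<bar> \<le> real_of_int K"
      using mult_right_mono[OF M[OF xy(1)], of N] N by (simp add: abs_mult K_def N_def)
    then have "-K \<le> l" "l \<le> K"
      using l by (auto simp: l_def abs_le_iff ceiling_le_iff) linarith
    then have "S (i l) x \<longleftrightarrow> S (i l) y" using eq J by blast
    ultimately show False using i xy by blast
  qed
  show thesis
  proof (rule that[of J])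
    fix x y assume xy: "x \<in> X" "y \<in> X" and eq: "\<And>i. i \<le> J \<Longrightarrow> S i x \<longleftrightarrow> S i y"
    have "f y < f x + \<epsilon>" by (rule less[OF xy eq])
    moreover have "f x < f y + \<epsilon>" by (rule less[OF xy(2,1)]) (simp add: eq)
    ultimately show "\<bar>f x - f y\<bar> < \<epsilon>" by (simp add: abs_less_iff)
  qed
qed

text \<open>Each level of r is a difference of two \<open>Pi0\<close> sets, and there are countably
  many levels. Applied to Q and to its negation this puts the set and its complement in
  \<open>Sigma0 \<tau> (succ \<xi>)\<close>, so Q may be arbitrary, in particular parity.\<close>

lemma baire_set_rank:
  assumes metr: "metrizable_space \<tau>" and \<xi>: "1 \<le> \<xi>" and "\<Omega> < omega1"
    and r: "\<And>x. x \<in> topspace \<tau> \<Longrightarrow> r x < \<Omega>" "\<And>\<eta>. Pi0 \<tau> \<xi> {x \<in> topspace \<tau>. \<eta> \<le> r x}"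
  shows "baire_set \<tau> \<xi> {x \<in> topspace \<tau>. Q (r x)}"
proof -
  let ?X = "topspace \<tau>"
  have *: "Sigma0 \<tau> (succ \<xi>) {x \<in> ?X. Q (r x)}" for Q
  proof -
    let ?L = "\<lambda>\<eta>. {x \<in> ?X. \<eta> \<le> r x} \<inter> (?X - {x \<in> ?X. succ \<eta> \<le> r x})"
    have "{x \<in> ?X. Q (r x)} = \<Union>(?L ` {\<eta>. \<eta> < \<Omega> \<and> Q \<eta>})"
    proof (intro equalityI subsetI)
      fix x assume "x \<in> {x \<in> ?X. Q (r x)}"
      then have "x \<in> ?L (r x)" "r x \<in> {\<eta>. \<eta> < \<Omega> \<and> Q \<eta>}" using r(1) by (auto simp: succ_le_iff)
      then show "x \<in> \<Union>(?L ` {\<eta>. \<eta> < \<Omega> \<and> Q \<eta>})" by blast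
    next
      fix x assume "x \<in> \<Union>(?L ` {\<eta>. \<eta> < \<Omega> \<and> Q \<eta>})"
      then obtain \<eta> where "Q \<eta>" "x \<in> ?X" "\<eta> \<le> r x" "\<not> succ \<eta> \<le> r x" by blast
      moreover from this have "r x = \<eta>" by (simp add: succ_le_iff)
      ultimately show "x \<in> {x \<in> ?X. Q (r x)}" by simp
    qed
    also have "Sigma0 \<tau> (succ \<xi>) \<dots>"
    proof (rule Sigma0_countable_Union[OF _ metr])
      have "countable {\<eta>. \<eta> < \<Omega> \<and> Q \<eta>}"
        by (rule countable_subset[OF _ countable_lessThan[OF \<open>\<Omega> < omega1\<close>]]) auto
      then show "countable (?L ` {\<eta>. \<eta> < \<Omega> \<and> Q \<eta>})" by (rule countable_image)
      show "1 \<le> succ \<xi>" by (rule order.trans[OF \<xi> less_imp_le[OF less_succ]])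
      fix A assume "A \<in> ?L ` {\<eta>. \<eta> < \<Omega> \<and> Q \<eta>}"
      then obtain \<eta> where A: "A = ?L \<eta>" by blast
      have "Sigma0 \<tau> (succ \<xi>) {x \<in> ?X. \<eta> \<le> r x}" by (rule Pi0_imp_Sigma0[OF r(2) less_succ])
      moreover have "Sigma0 \<tau> (succ \<xi>) (?X - {x \<in> ?X. succ \<eta> \<le> r x})"
        by (rule Sigma0_mono[OF metr Sigma0_compl_Pi0[OF r(2)] less_imp_le[OF less_succ]])
      ultimately show "Sigma0 \<tau> (succ \<xi>) A" unfolding A by (rule Sigma0_Int[OF metr])
    qed
    finally show ?thesis .
  qed
  have "?X - {x \<in> ?X. Q (r x)} = {x \<in> ?X. \<not> Q (r x)}" by blast
  then show ?thesis using *[of Q] *[of "\<lambda>\<eta>. \<not> Q \<eta>"] by (intro baire_set_if_Sigma0_succ[OF metr \<xi>]) simp_all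
qed

text \<open>Ranks failing G impose no constraint, and any point with the required parities supplies
  the value; x itself is a candidate. The value depends on x only through finitely many bits and
  stays in the range of f, which keeps it bounded.\<close>

definition approximant ::
  "'a set \<Rightarrow> ('a \<Rightarrow> real) \<Rightarrow> (nat \<Rightarrow> 'a \<Rightarrow> ordinal) \<Rightarrow> (ordinal \<Rightarrow> bool) \<Rightarrow> nat \<Rightarrow> 'a \<Rightarrow> real" where
  "approximant X f r G n x = f (SOME y. y \<in> X \<and>
     (\<forall>i\<le>n. G (r i x) \<longrightarrow> (even_ordinal (r i y) \<longleftrightarrow> even_ordinal (r i x))))"

lemma approximantE:
  assumes "x \<in> X"
  obtains y where "y \<in> X" "approximant X f r G n x = f y"
    "\<And>i. i \<le> n \<Longrightarrow> G (r i x) \<Longrightarrow> even_ordinal (r i y) \<longleftrightarrow> even_ordinal (r i x)"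
proof -
  let ?P = "\<lambda>y. y \<in> X \<and> (\<forall>i\<le>n. G (r i x) \<longrightarrow> (even_ordinal (r i y) \<longleftrightarrow> even_ordinal (r i x)))"
  have "?P x" using assms by simp
  then have "?P (SOME y. ?P y)" by (rule someI)
  then show thesis using that[of "SOME y. ?P y"] unfolding approximant_def by blast
qed

lemma approximant_cong:
  assumes "\<And>i. i \<le> n \<Longrightarrow> G (r i x) \<longleftrightarrow> G (r i x')"
    "\<And>i. i \<le> n \<Longrightarrow> G (r i x) \<Longrightarrow> even_ordinal (r i x) \<longleftrightarrow> even_ordinal (r i x')"
  shows "approximant X f r G n x = approximant X f r G n x'"
proof -
  have "(y \<in> X \<and> (\<forall>i\<le>n. G (r i x) \<longrightarrow> (even_ordinal (r i y) \<longleftrightarrow> even_ordinal (r i x)))) \<longleftrightarrow>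
    (y \<in> X \<and> (\<forall>i\<le>n. G (r i x') \<longrightarrow> (even_ordinal (r i y) \<longleftrightarrow> even_ordinal (r i x'))))" for y
    using assms by blast
  then show ?thesis unfolding approximant_def by simp
qed

lemma baire_approximant:
  assumes metr: "metrizable_space \<tau>" and \<xi>: "1 \<le> \<xi>" and "\<Omega> < omega1"
    and r: "\<And>i x. x \<in> topspace \<tau> \<Longrightarrow> r i x < \<Omega>" "\<And>i \<eta>. Pi0 \<tau> \<xi> {x \<in> topspace \<tau>. \<eta> \<le> r i x}"
  shows "baire \<tau> \<xi> (approximant (topspace \<tau>) f r G n)"
proof -
  let ?X = "topspace \<tau>"
  \<comment> \<open>One bit for each index and each parity, so that a pattern records both which
    ranks satisfy G and their parities. The condition under \<open>SOME\<close> in h is then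
    equivalent to the one in \<open>approximant\<close>, and the same point is chosen.\<close>
  define T where "T = (\<lambda>(i, b). {x \<in> ?X. G (r i x) \<and> (even_ordinal (r i x) \<longleftrightarrow> b)})"
  define h where "h P = f (SOME y. y \<in> ?X \<and> (\<forall>(i, b)\<in>P. even_ordinal (r i y) \<longleftrightarrow> b))" for P
  let ?I = "{..n} \<times> (UNIV :: bool set)"
  have "baire \<tau> \<xi> (\<lambda>x. h {k \<in> ?I. x \<in> T k})"
  proof (rule baire_pattern)
    fix k :: "nat \<times> bool"
    obtain i b where k: "k = (i, b)" by (cases k)
    show "baire_set \<tau> \<xi> (T k)"
      unfolding k T_def prod.case
      by (rule baire_set_rank[OF metr \<xi> \<open>\<Omega> < omega1\<close>, where r = "r i" and
          Q = "\<lambda>\<eta>. G \<eta> \<and> (even_ordinal \<eta> \<longleftrightarrow> b)"]) (fact r)+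
  qed (use \<xi> in auto)
  then show ?thesis
  proof (rule baire_cong)
    fix x assume "x \<in> ?X"
    then have "(\<forall>(i, b)\<in>{k \<in> ?I. x \<in> T k}. even_ordinal (r i y) \<longleftrightarrow> b) \<longleftrightarrow>
        (\<forall>i\<le>n. G (r i x) \<longrightarrow> (even_ordinal (r i y) \<longleftrightarrow> even_ordinal (r i x)))" for y
      unfolding T_def by auto
    then show "h {k \<in> ?I. x \<in> T k} = approximant ?X f r G n x"
      unfolding h_def approximant_def by presburger
  qed
qed

lemma subset_Phi:
  assumes \<tau>: "polish \<tau>" and \<xi>: "1 \<le> \<xi>" and \<nu>: "\<nu> \<noteq> 0" "\<nu> < omega1"
  shows "baire_rank_class \<tau> \<xi> (succ \<nu>) \<subseteq> Phi \<tau> \<xi> (\<Union>\<eta>\<in>{..<\<nu>}. baire_rank_class \<tau> \<xi> (succ \<eta>))"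
proof
  fix f assume "f \<in> baire_rank_class \<tau> \<xi> (succ \<nu>)"
  then have bdd: "bounded (f ` topspace \<tau>)" and f: "baire \<tau> \<xi> f"
    and rank: "fun_sep_rank \<tau> \<xi> f \<le> opower omega (succ \<nu>)" by (auto simp: baire_rank_class_def)
  define X where "X = topspace \<tau>"
  define w where "w = opower omega \<nu>"
  define \<Omega> where "\<Omega> = opower omega (succ \<nu>)"
  note metr = polish_imp_metrizable[OF \<tau>]
  have w: "limit w" "w < omega1" using \<nu> by (auto simp: w_def limit_opower_omega opower_omega_less_omega1)
  have \<Omega>: "\<Omega> < omega1"
    unfolding \<Omega>_def using \<nu> limit_succ_less[OF limit_omega1] by (intro opower_omega_less_omega1)
  have less_\<Omega>: "x < \<Omega> \<longleftrightarrow> (\<exists>m. x < omult_nat w m)" for x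
    unfolding \<Omega>_def w_def by (rule less_opower_omega_succ)

  \<comment> \<open>Rank functions for an enumeration of the rational pairs\<close>
  define \<Q> where "\<Q> = {(p, q). p \<in> (\<rat> :: real set) \<and> q \<in> \<rat> \<and> p < q}"
  have "(0, 1) \<in> \<Q>" by (simp add: \<Q>_def)
  have "countable \<Q>" by (rule countable_subset[of _ "\<rat> \<times> \<rat>"]) (auto simp: \<Q>_def countable_rat)
  define pq where "pq = from_nat_into \<Q>"
  have pq: "range pq = \<Q>" unfolding pq_def using \<open>(0, 1) \<in> \<Q>\<close> \<open>countable \<Q>\<close> by (intro range_from_nat_into) auto
  have "\<exists>r. (\<forall>x\<in>X. r x < \<Omega>) \<and> (\<forall>\<eta>. Pi0 \<tau> \<xi> {x \<in> X. \<eta> \<le> r x}) \<and>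
      (\<forall>x\<in>X. (f x \<le> fst (pq i) \<longrightarrow> even_ordinal (r x)) \<and> (snd (pq i) \<le> f x \<longrightarrow> \<not> even_ordinal (r x)))" for i
  proof -
    have "pq i \<in> \<Q>" using pq by blast
    then have "fst (pq i) \<in> \<rat>" "snd (pq i) \<in> \<rat>" "fst (pq i) < snd (pq i)" by (auto simp: \<Q>_def)
    then obtain r where "\<And>x. x \<in> X \<Longrightarrow> r x < \<Omega>" "\<And>\<eta>. Pi0 \<tau> \<xi> {x \<in> X. \<eta> \<le> r x}"
      "\<And>x. x \<in> X \<Longrightarrow> f x \<le> fst (pq i) \<Longrightarrow> even_ordinal (r x)"
      "\<And>x. x \<in> X \<Longrightarrow> snd (pq i) \<le> f x \<Longrightarrow> \<not> even_ordinal (r x)"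
      by (rule fun_sep_rank_rank[OF metr \<xi> rank[folded \<Omega>_def] \<Omega>, folded X_def]) (rule that)
    then show ?thesis by (intro exI[of _ r]) simp
  qed
  then obtain r where r: "\<And>i. \<forall>x\<in>X. r i x < \<Omega>" and r_Pi0: "\<And>i. \<forall>\<eta>. Pi0 \<tau> \<xi> {x \<in> X. \<eta> \<le> r i x}"
    and r_sep: "\<And>i. \<forall>x\<in>X. (f x \<le> fst (pq i) \<longrightarrow> even_ordinal (r i x)) \<and>
      (snd (pq i) \<le> f x \<longrightarrow> \<not> even_ordinal (r i x))"
    by metis
  have sep: "\<exists>i. \<forall>x\<in>X. (f x \<le> p \<longrightarrow> even_ordinal (r i x)) \<and> (q \<le> f x \<longrightarrow> \<not> even_ordinal (r i x))"
    if "p \<in> \<rat>" "q \<in> \<rat>" "p < q" for p q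
  proof -
    have "(p, q) \<in> range pq" using that pq by (simp add: \<Q>_def)
    then obtain i where "pq i = (p, q)" by (metis rangeE)
    with r_sep[of i] show ?thesis by (intro exI[of _ i]) simp
  qed

  \<comment> \<open>A refined topology with upper semicontinuous rank functions\<close>
  let ?\<P> = "(\<lambda>(i, \<eta>). {x \<in> X. \<eta> \<le> r i x}) ` (UNIV \<times> {..<\<Omega>})"
  have cnt: "countable ?\<P>" using \<Omega> by (intro countable_image countable_SIGMA) (auto simp: countable_lessThan)
  have Pi0: "Pi0 \<tau> \<xi> P" if "P \<in> ?\<P>" for P using that r_Pi0 by auto
  obtain \<tau>' where ref: "refining_topology \<tau> \<xi> \<tau>'" and closed0: "\<And>P. P \<in> ?\<P> \<Longrightarrow> closedin \<tau>' P"
    by (rule ex_refining_topology_closed[OF \<tau> refining_topology_self[OF \<tau> \<xi>] \<xi> cnt Pi0], assumption) (rule that)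
  have top: "topspace \<tau>' = X" and "polish \<tau>'" using ref by (auto simp: refining_topology_def X_def)
  have closed: "closedin \<tau>' {x \<in> X. \<eta> \<le> r i x}" for i \<eta>
  proof (cases "\<eta> < \<Omega>")
    case True
    then have "{x \<in> X. \<eta> \<le> r i x} \<in> ?\<P>" by (intro image_eqI[of _ _ "(i, \<eta>)"]) auto
    then show ?thesis by (rule closed0)
  next
    case False
    then have "{x \<in> X. \<eta> \<le> r i x} = {}" using r[of i] by fastforce
    then show ?thesis by (metis closedin_empty)
  qed
  \<comment> \<open>Finitely many rank functions are treated at once: the closed sets on which some
    \<open>r i\<close> exceeds \<open>r i x\<close> are removed.\<close>
  have nbhd: "\<exists>U. openin \<tau>' U \<and> x \<in> U \<and> (\<forall>y\<in>U. y \<in> X \<and> (\<forall>i\<le>n. r i y \<le> r i x))" if "x \<in> X" for x n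
  proof -
    let ?U = "\<Inter>i\<in>{..n}. X - {y \<in> X. succ (r i x) \<le> r i y}"
    have "openin \<tau>' ?U"
      using closed openin_topspace[of \<tau>'] top by (intro openin_INT2 openin_diff) auto
    moreover have "x \<in> ?U" using that by (auto simp: succ_le_iff)
    moreover have "y \<in> X \<and> (\<forall>i\<le>n. r i y \<le> r i x)" if "y \<in> ?U" for y
      using that by (auto simp: succ_le_iff not_less)
    ultimately show ?thesis by blast
  qed

  \<comment> \<open>A cofinal sequence in w\<close>
  have "{..<w} \<noteq> {}" using limit_pos[OF w(1)] by blast
  define e where "e = from_nat_into {..<w}"
  have e: "range e = {..<w}"
    unfolding e_def using \<open>{..<w} \<noteq> {}\<close> countable_lessThan[OF w(2)] by (rule range_from_nat_into)
  \<comment> \<open>Running maxima of an enumeration of w; \<open>succ\<close> makes the later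
    comparison strict, and the values stay below w because w is a limit.\<close>
  define \<rho> where "\<rho> n = Max ((\<lambda>i. succ (e i)) ` {..n})" for n :: nat
  have \<rho>_less: "\<rho> n < w" for n
    unfolding \<rho>_def using e limit_succ_less[OF w(1)] by (subst Max_less_iff) auto
  have \<rho>_ge: "\<exists>N. \<forall>n\<ge>N. c < \<rho> n" if "c < w" for c
  proof -
    have "c \<in> range e" using that e by simp
    then obtain k where "c = e k" by blast
    then have "c < \<rho> n" if "n \<ge> k" for n
      unfolding \<rho>_def using that by (subst Max_gr_iff) (auto simp: less_succ)
    then show ?thesis by blast
  qed

  \<comment> \<open>The approximants and their distance from f\<close>
  define fs where "fs n = approximant X f r (kept w (\<rho> n) n) n" for n
  \<comment> \<open>J depends on \<epsilon> alone and N on x, while the estimate is uniform in y.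
    This uniformity is what controls the derivatives; y = x gives pointwise convergence.\<close>
  have near: "\<exists>J. \<forall>x\<in>X. \<exists>N. \<forall>n\<ge>N. \<forall>y\<in>X.
      (\<forall>i\<le>J. blk w (r i y) = blk w (r i x) \<and> off w (r i y) \<le> off w (r i x)) \<longrightarrow> \<bar>fs n y - f y\<bar> < \<epsilon>"
    if "\<epsilon> > 0" for \<epsilon>
  proof -
    obtain J where J: "\<And>x y. x \<in> X \<Longrightarrow> y \<in> X \<Longrightarrow>
        (\<And>i. i \<le> J \<Longrightarrow> even_ordinal (r i x) \<longleftrightarrow> even_ordinal (r i y)) \<Longrightarrow> \<bar>f x - f y\<bar> < \<epsilon>"
      using pattern_determines[OF bdd[folded X_def] \<open>\<epsilon> > 0\<close>, of "\<lambda>i x. even_ordinal (r i x)"] sep by metis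
    show ?thesis
    proof (rule exI[of _ J], rule ballI)
      fix x assume x: "x \<in> X"
      have "\<exists>N. \<forall>n\<ge>N. off w (r i x) < \<rho> n" for i
      proof (rule \<rho>_ge)
        obtain m where "r i x < omult_nat w m" using r x less_\<Omega> by blast
        then show "off w (r i x) < w" by (rule blk_off)
      qed
      then obtain N0 where N0: "\<And>i n. n \<ge> N0 i \<Longrightarrow> off w (r i x) < \<rho> n" by metis
      \<comment> \<open>From N on, n is at least J and exceeds the block numbers of all
        \<open>r i x\<close> with i \<le> J, and \<open>\<rho> n\<close> exceeds their offsets.
        Hence these ranks are kept at every y in question.\<close>
      define N where "N = Max (Set.insert J ((\<lambda>i. max (N0 i) (Suc (blk w (r i x)))) ` {..J}))"
      have NJ: "J \<le> N" unfolding N_def by (intro Max_ge) auto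
      have Ni: "max (N0 i) (Suc (blk w (r i x))) \<le> N" if "i \<le> J" for i
        unfolding N_def using that by (intro Max_ge) auto
      show "\<exists>N. \<forall>n\<ge>N. \<forall>y\<in>X.
        (\<forall>i\<le>J. blk w (r i y) = blk w (r i x) \<and> off w (r i y) \<le> off w (r i x)) \<longrightarrow> \<bar>fs n y - f y\<bar> < \<epsilon>"
      proof (intro exI[of _ N] allI ballI impI)
        fix n y assume n: "N \<le> n" and y: "y \<in> X"
          and le: "\<forall>i\<le>J. blk w (r i y) = blk w (r i x) \<and> off w (r i y) \<le> off w (r i x)"
        have kept: "kept w (\<rho> n) n (r i y)" if "i \<le> J" for i
          using le that Ni[OF that] n N0[of i n] unfolding kept_def by (auto intro: order.strict_trans1)
        obtain z where z: "z \<in> X" "approximant X f r (kept w (\<rho> n) n) n y = f z"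
          "\<And>i. i \<le> n \<Longrightarrow> kept w (\<rho> n) n (r i y) \<Longrightarrow>
            even_ordinal (r i z) \<longleftrightarrow> even_ordinal (r i y)"
          by (rule approximantE[OF y]) (rule that)
        show "\<bar>fs n y - f y\<bar> < \<epsilon>"
          unfolding fs_def z(2) using z(3) kept n NJ by (intro J z(1) y) auto
      qed
    qed
  qed

  \<comment> \<open>The rank of the approximants\<close>
  have fs_class: "\<exists>\<gamma><\<nu>. fs n \<in> baire_rank_class \<tau> \<xi> (succ \<gamma>)" for n
  proof -
    \<comment> \<open>This \<gamma> is where the rank drops: \<open>\<rho> n\<close> lies strictly
      below \<omega>^\<nu>, hence below some \<omega>^(\<gamma>+1).\<close>
    obtain \<gamma> where \<gamma>: "\<gamma> < \<nu>" "\<rho> n < opower omega (succ \<gamma>)"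
      using \<rho>_less[of n] less_opower_omega_iff[OF \<nu>(1)] unfolding w_def by blast
    have "bounded (fs n ` X)"
    proof (rule bounded_subset[OF bdd[folded X_def]])
      show "fs n ` X \<subseteq> f ` X"
      proof (rule image_subsetI)
        fix x assume "x \<in> X"
        then obtain y where "y \<in> X" "fs n x = f y" unfolding fs_def by (rule approximantE)
        then show "fs n x \<in> f ` X" by simp
      qed
    qed
    moreover have "baire \<tau> \<xi> (fs n)"
      unfolding fs_def X_def using r r_Pi0 by (intro baire_approximant[OF metr \<xi> \<Omega>]) (auto simp: X_def)
    moreover have "fun_sep_rank \<tau> \<xi> (fs n) \<le> opower omega (succ \<gamma>)"
    proof (rule fun_sep_rank_le_locally_const[OF ref])
      \<comment> \<open>The level of x is the Hessenberg sum of its collapsed ranks. On equal levels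
        near x no collapsed rank changes, so the kept ranks agree exactly, and with them the
        parities that determine \<open>fs n\<close>.\<close>
      let ?c = "\<lambda>x i. collapse w (\<rho> n) n (r i x)"
      show "limit (opower omega (succ \<gamma>))" by (intro limit_opower_omega) simp
      show "opower omega (succ \<gamma>) < omega1"
        using limit_succ_less[OF limit_omega1] \<gamma>(1) \<nu>(2)
        by (intro opower_omega_less_omega1) (meson order.strict_trans)
      show "hsum_upto (?c x) n < opower omega (succ \<gamma>)" for x
        using \<gamma>(2) by (intro hsum_upto_less_opower_omega collapse_less_opower_omega) auto
      fix x assume "x \<in> topspace \<tau>"
      then have x: "x \<in> X" by (simp add: X_def)
      from nbhd[OF this, of n] obtain U where U: "openin \<tau>' U" "x \<in> U"
        and Ule: "\<forall>y\<in>U. y \<in> X \<and> (\<forall>i\<le>n. r i y \<le> r i x)" by blast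
      have c_le: "?c y i \<le> ?c x i" if "y \<in> U" "i \<le> n" for y i
      proof -
        obtain m where "r i x < omult_nat w m" using r x less_\<Omega> by blast
        with Ule that show ?thesis by (intro collapse_mono) auto
      qed
      have "fs n y = fs n x" if y: "y \<in> U" and s: "hsum_upto (?c y) n = hsum_upto (?c x) n" for y
        unfolding fs_def
      proof (rule approximant_cong)
        fix i assume i: "i \<le> n"
        have eq: "?c y i = ?c x i"
          by (rule hsum_upto_eq_mono[OF c_le[OF y]]) (use s i in auto)
        show "kept w (\<rho> n) n (r i y) \<longleftrightarrow> kept w (\<rho> n) n (r i x)" by (rule collapse_eq(1)[OF eq])
        assume k: "kept w (\<rho> n) n (r i y)"
        obtain m where m: "r i x < omult_nat w m" using r x less_\<Omega> by blast
        have "r i y \<le> r i x" using Ule y i by blast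
        then have "r i y < omult_nat w m" using m by simp
        then have "r i y = r i x" by (rule collapse_eq(2)[OF eq k _ m])
        then show "even_ordinal (r i y) \<longleftrightarrow> even_ordinal (r i x)" by simp
      qed
      moreover have "hsum_upto (?c y) n \<le> hsum_upto (?c x) n" if "y \<in> U" for y
        by (rule hsum_upto_mono[OF c_le[OF that]])
      ultimately show "\<exists>U. openin \<tau>' U \<and> x \<in> U \<and>
          (\<forall>y\<in>U. hsum_upto (?c y) n \<le> hsum_upto (?c x) n \<and>
            (hsum_upto (?c y) n = hsum_upto (?c x) n \<longrightarrow> fs n y = fs n x))"
        using U by (intro exI[of _ U]) blast
    qed
    ultimately show ?thesis using \<gamma>(1) by (auto simp: baire_rank_class_def X_def)
  qed

  \<comment> \<open>Baire class one in the refined topology\<close>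
  have baire_1: "baire \<tau>' 1 (approximant X f r G n)" for G n
  proof -
    have "baire \<tau>' 1 (approximant (topspace \<tau>') f r G n)"
      using r closed polish_imp_metrizable[OF \<open>polish \<tau>'\<close>] \<Omega>
      by (intro baire_approximant) (auto simp: top)
    then show ?thesis by (simp add: top)
  qed
  have f_baire_1: "baire \<tau>' 1 f"
  proof (rule baire_1_uniform_limit)
    fix \<epsilon> :: real assume "\<epsilon> > 0"
    obtain J where J: "\<And>x y. x \<in> X \<Longrightarrow> y \<in> X \<Longrightarrow>
        (\<And>i. i \<le> J \<Longrightarrow> even_ordinal (r i x) \<longleftrightarrow> even_ordinal (r i y)) \<Longrightarrow> \<bar>f x - f y\<bar> < \<epsilon>"
      using pattern_determines[OF bdd[folded X_def] \<open>\<epsilon> > 0\<close>, of "\<lambda>i x. even_ordinal (r i x)"] sep by metis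
    \<comment> \<open>With no rank discarded, the approximants from finitely many indices are
      uniformly close to f, so f is a uniform limit of Baire class one functions.\<close>
    have "\<bar>f x - approximant X f r (\<lambda>_. True) J x\<bar> \<le> \<epsilon>" if x: "x \<in> X" for x
    proof -
      obtain z where z: "z \<in> X" "approximant X f r (\<lambda>_. True) J x = f z"
        "\<And>i. i \<le> J \<Longrightarrow> True \<Longrightarrow> even_ordinal (r i z) \<longleftrightarrow> even_ordinal (r i x)"
        by (rule approximantE[OF x]) (rule that)
      have "\<bar>f x - f z\<bar> < \<epsilon>" using z(3) by (intro J x z(1)) simp
      then show ?thesis unfolding z(2) by simp
    qed
    then show "\<exists>g. baire \<tau>' 1 g \<and> (\<forall>x\<in>topspace \<tau>'. \<bar>f x - g x\<bar> \<le> \<epsilon>)"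
      unfolding top using baire_1 by blast
  qed

  \<comment> \<open>Pseudouniform convergence\<close>
  have conv: "(\<lambda>n. fs n x) \<longlonglongrightarrow> f x" if x: "x \<in> X" for x
  proof (rule LIMSEQ_I)
    fix \<epsilon> :: real assume "\<epsilon> > 0"
    from near[OF this] x obtain J N where "\<forall>n\<ge>N. \<forall>y\<in>X.
      (\<forall>i\<le>(J::nat). blk w (r i y) = blk w (r i x) \<and> off w (r i y) \<le> off w (r i x)) \<longrightarrow> \<bar>fs n y - f y\<bar> < \<epsilon>"
      by blast
    then show "\<exists>N. \<forall>n\<ge>N. norm (fs n x - f x) < \<epsilon>" using x by (intro exI[of _ N]) simp
  qed

  have "convergence_rank \<tau>' fs \<le> omega"
  proof (rule convergence_rank_le_omegaI)
    fix \<epsilon> :: real assume "\<epsilon> > 0"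
    \<comment> \<open>Comparing two terms through f costs two errors of \<epsilon>/3, which leaves a
      margin below \<epsilon>.\<close>
    then have "\<epsilon> / 3 > 0" by simp
    from near[OF this] obtain J where J: "\<forall>x\<in>X. \<exists>N. \<forall>n\<ge>N. \<forall>y\<in>X.
      (\<forall>i\<le>J. blk w (r i y) = blk w (r i x) \<and> off w (r i y) \<le> off w (r i x)) \<longrightarrow> \<bar>fs n y - f y\<bar> < \<epsilon> / 3" ..
    let ?D = "seq_derivative \<tau>' fs \<epsilon>"
    let ?I = "\<lambda>\<theta>. iter_derivative ?D \<theta> (topspace \<tau>')"
    let ?k = "\<lambda>x. \<Sum>i\<le>J. blk w (r i x)"
    have sub: "?I ((succ ^^ k) 0) \<subseteq> {x \<in> X. k \<le> ?k x}" for k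
    proof (induction k)
      case 0
      then show ?case using top by simp
    next
      case (Suc k)
      let ?Ik = "?I ((succ ^^ k) 0)"
      have "Suc k \<le> ?k x \<and> x \<in> X" if "x \<in> ?D ?Ik" for x
      proof -
        have "x \<in> ?Ik" using that seq_derivative_subset[of \<tau>' fs \<epsilon> ?Ik] by blast
        then have x: "x \<in> X" "k \<le> ?k x" using Suc.IH by auto
        \<comment> \<open>If the sum is exactly k at x, then near x the block numbers can only drop,
          while on the k-th derivative their sum is still at least k. So all block numbers agree
          with those at x and the offsets do not increase, which is the situation covered by
          \<open>near\<close>; x would then leave the next derivative.\<close>
        have "?k x \<noteq> k"
        proof
          assume kx: "?k x = k"
          from nbhd[OF x(1), of J] obtain U where U: "openin \<tau>' U" "x \<in> U"
            and Ule: "\<forall>y\<in>U. y \<in> X \<and> (\<forall>i\<le>J. r i y \<le> r i x)" by blast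
          from bspec[OF J x(1)] obtain N where N: "\<forall>n\<ge>N. \<forall>y\<in>X.
            (\<forall>i\<le>J. blk w (r i y) = blk w (r i x) \<and> off w (r i y) \<le> off w (r i x)) \<longrightarrow>
              \<bar>fs n y - f y\<bar> < \<epsilon> / 3" ..
          have close: "\<bar>fs n y - f y\<bar> < \<epsilon> / 3" if n: "n \<ge> N" and y: "y \<in> U" "y \<in> ?Ik" for n y
          proof -
            have yX: "y \<in> X" and ky: "k \<le> ?k y" using y(2) Suc.IH by auto
            have le: "r i y \<le> r i x" if "i \<le> J" for i using Ule y(1) that by blast
            have blk_le: "blk w (r i y) \<le> blk w (r i x)" if "i \<le> J" for i
            proof -
              obtain m where "r i x < omult_nat w m" using r x less_\<Omega> by blast
              then show ?thesis by (rule blk_mono[OF le[OF that]])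
            qed
            then have "?k y \<le> ?k x" by (intro sum_mono) simp
            with ky kx have "?k y = ?k x" by simp
            then have eq: "blk w (r i y) = blk w (r i x)" if "i \<le> J" for i
              using that blk_le by (intro sum_mono_inv[of "\<lambda>i. blk w (r i y)" "{..J}"]) auto
            have "off w (r i y) \<le> off w (r i x)" if "i \<le> J" for i
            proof -
              obtain m where "r i x < omult_nat w m" using r x less_\<Omega> by blast
              then show ?thesis by (rule off_mono[OF le[OF that] _ eq[OF that]])
            qed
            with eq N n yX show ?thesis by blast
          qed
          have "\<bar>fs m y - fs n y\<bar> \<le> 2 * \<epsilon> / 3" if "m \<ge> N" "n \<ge> N" "y \<in> U \<inter> ?Ik" for m n y
          proof -
            have "y \<in> U" "y \<in> ?Ik" using that(3) by blast+
            from close[OF that(1) this] close[OF that(2) this] show ?thesis by linarith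
          qed
          moreover have "2 * \<epsilon> / 3 < \<epsilon>" using \<open>\<epsilon> > 0\<close> by simp
          ultimately have "x \<notin> ?D ?Ik"
            unfolding mem_seq_derivative_iff[OF \<open>\<epsilon> > 0\<close>] using U by blast
          with that show False by simp
        qed
        with x show ?thesis by simp
      qed
      then show ?case by auto
    qed
    show "?I omega = {}"
    proof (rule ccontr)
      assume "?I omega \<noteq> {}"
      then obtain x where x: "x \<in> ?I omega" by blast
      \<comment> \<open>A point surviving \<omega> derivatives survives one more than its own sum of
        block numbers allows.\<close>
      have "(succ ^^ Suc (?k x)) 0 < omega" using less_omega_iff by blast
      then have "x \<in> ?I ((succ ^^ Suc (?k x)) 0)"
        using x unfolding iter_derivative_limit[OF omega_limit] by blast
      then show False using sub[of "Suc (?k x)"] by auto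
    qed
  qed
  then have "pseudouniform_limit \<tau>' fs f" using conv top by (simp add: pseudouniform_limit_def)
  moreover have "\<forall>n. fs n \<in> (\<Union>\<eta>\<in>{..<\<nu>}. baire_rank_class \<tau> \<xi> (succ \<eta>))" using fs_class by blast
  moreover have "\<forall>n. baire \<tau>' 1 (fs n)" unfolding fs_def using baire_1 by blast
  ultimately show "f \<in> Phi \<tau> \<xi> (\<Union>\<eta>\<in>{..<\<nu>}. baire_rank_class \<tau> \<xi> (succ \<eta>))"
    unfolding Phi_def using bdd f f_baire_1 ref[unfolded refining_topology_def] by blast
qed

theorem theorem4p11:
  fixes \<tau> :: "'a topology" and \<xi> \<nu> :: ordinal
  assumes "polish \<tau>"
    and "uncountable (topspace \<tau>)"
    and "1 < \<xi>" and "\<xi> < omega1"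
    and "\<nu> < omega1"
  shows "Phi_iter \<tau> \<xi> \<nu> = baire_rank_class \<tau> \<xi> (succ \<nu>)"
  using \<open>\<nu> < omega1\<close>
proof (induction \<nu> rule: less_induct)
  case (less \<nu>)
  show ?case
  proof (cases "\<nu> = 0")
    case True
    \<comment> \<open>The base class has exponent 1, which is \<open>succ 0\<close>; this is the
      source of the shift by one between the two hierarchies.\<close>
    then show ?thesis by (simp add: Phi_iter.simps[of _ _ 0] one_ordinal_def)
  next
    case False
    have "Phi_iter \<tau> \<xi> \<eta> = baire_rank_class \<tau> \<xi> (succ \<eta>)" if "\<eta> < \<nu>" for \<eta>
      using less.IH[OF that] less.prems that by simp
    then have "Phi_iter \<tau> \<xi> \<nu> = Phi \<tau> \<xi> (\<Union>\<eta>\<in>{..<\<nu>}. baire_rank_class \<tau> \<xi> (succ \<eta>))"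
      using False by (simp add: Phi_iter.simps[of _ _ \<nu>])
    also have "\<dots> = baire_rank_class \<tau> \<xi> (succ \<nu>)"
      using Phi_subset[OF assms(1) _ False less.prems] subset_Phi[OF assms(1) _ False less.prems]
        assms(3) by (intro antisym) auto
    finally show ?thesis .
  qed
qed

end
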